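(* Let $M$ be a Riemannian manifold. Let $\gamma_1,\gamma_2\in\mathcal{P}M_c$ with $\gamma_1\simeq_{bt}\gamma_2$, and let $X_i\in T_{\gamma_i}\mathcal{P}M_c$, $i=1,2$, with $X_1\simeq_{bt}X_2$. For $i=1,2$ let ${}^i\Gamma:[a,b]\to\mathcal{P}M$ be the path space geodesic obtained from the initial conditions $(\gamma_i,X_i)$, where $[a,b]$ is an interval containing $0$, and let ${}^i\Gamma^s:[0,1]\to M$, ${}^i\Gamma^s(t)={}^i\Gamma(s,t)$, be its longitudinal paths. Then, for each $s\in[a,b]$, $${}^1\Gamma^s\simeq_{bt}{}^2\Gamma^s.$$
   Context: $\mathcal{P}M=C^\infty([0,1],M)$; $T_\gamma\mathcal{P}M$ is the space of smooth vector fields along $\gamma$. $\mathcal{P}M_c\subset\mathcal{P}M$ is the set of paths constant near the end points (for some $\delta>0$, constant on $[0,\delta)$ and on $(1-\delta,1]$), and $T_\gamma\mathcal{P}M_c$ is the set of smooth vector fields along $\gamma$ that are constant near the end points $0,1$. The path space geodesic with initial conditions $(\gamma,X)$ is the map $\Gamma:[a,b]\times[0,1]\to M$ such that for each $t\in[0,1]$ the transverse path $\Gamma_t(s)=\Gamma(s,t)$ is the geodesic of $M$ (for the Riemannian connection) with $\Gamma_t(0)=\gamma(t)$ and $\frac{\partial\Gamma_t(s)}{\partial s}\big|_{0}=X(t)$ (assumed to be defined on $[a,b]$). Back-track equivalence: paths differing by a strictly increasing continuous reparametrization $\phi:[0,1]\to[0,1]$, $\phi(0)=0$, $\phi(1)=1$,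 are identified. Two paths are elementary back-track equivalent if, after strictly increasing reparametrizations, one of them traverses successively smooth paths $\lambda_3$, $\lambda_2$, the reverse of $\lambda_2$, and $\lambda_1$, while the other traverses successively $\lambda_3$ and $\lambda_1$ (i.e. it is obtained by erasing the back-tracked part). Two paths are back-track equivalent, written $\simeq_{bt}$, if they are connected by a finite sequence of paths with consecutive ones elementary back-track equivalent. For vector fields $X_1,X_2$ along paths, $X_1\simeq_{bt}X_2$ means that they are back-track equivalent when regarded as paths $t\mapsto X_i(t)$ in $TM$. *)

theory Defs
  imports "HOL-Analysis.Analysis"
begin

section \<open>Smoothness in normed spaces\<close>

text \<open>
  \<open>C_k_on k S f\<close> is only applied to sets \<open>S\<close> that are open or are nondegenerate intervals of
  \<open>real\<close>; there the derivative within \<open>S\<close> is unique (and one-sided at an end point belonging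
  to an interval), so that \<open>frechet_derivative\<close> is meaningful.
\<close>

primrec C_k_on ::
    "nat \<Rightarrow> 'a::real_normed_vector set \<Rightarrow> ('a \<Rightarrow> 'b::real_normed_vector) \<Rightarrow> bool" where
  "C_k_on 0 S f \<longleftrightarrow> continuous_on S f"
| "C_k_on (Suc k) S f \<longleftrightarrow>
     f differentiable_on S \<and> (\<forall>v. C_k_on k S (\<lambda>x. frechet_derivative f (at x within S) v))"

definition smooth_on ::
    "'a::real_normed_vector set \<Rightarrow> ('a \<Rightarrow> 'b::real_normed_vector) \<Rightarrow> bool" where
  "smooth_on S f \<longleftrightarrow> (\<forall>k. C_k_on k S f)"


section \<open>Smooth manifolds and their tangent bundles\<close>

text \<open>A chart consists of its domain and its coordinate map, whose values outside the domain are
  irrelevant.\<close>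

type_synonym ('m, 'e) chart = "'m set \<times> ('m \<Rightarrow> 'e)"

abbreviation dom_of :: "('m, 'e) chart \<Rightarrow> 'm set" where
  "dom_of \<equiv> fst"

abbreviation coord :: "('m, 'e) chart \<Rightarrow> 'm \<Rightarrow> 'e" where
  "coord \<equiv> snd"

abbreviation chart_inv :: "('m, 'e) chart \<Rightarrow> 'e \<Rightarrow> 'm" where
  "chart_inv c \<equiv> inv_into (dom_of c) (coord c)"

definition transition :: "('m, 'e) chart \<Rightarrow> ('m, 'e) chart \<Rightarrow> 'e \<Rightarrow> 'e" where
  "transition c d = (\<lambda>x. coord d (chart_inv c x))"

text \<open>The manifold is the whole type \<open>'m\<close>, with the topology of its type class; \<open>A\<close> is
  any atlas (not necessarily maximal) defining its smooth structure.\<close>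

locale smooth_manifold =
  fixes A :: "('m::{t2_space, second_countable_topology}, 'e::euclidean_space) chart set"
  assumes charts_cover: "(\<Union>c\<in>A. dom_of c) = UNIV"
    and chart_open: "c \<in> A \<Longrightarrow> open (dom_of c)"
    and chart_image_open: "c \<in> A \<Longrightarrow> open (coord c ` dom_of c)"
    and chart_homeomorphism:
      "c \<in> A \<Longrightarrow> homeomorphism (dom_of c) (coord c ` dom_of c) (coord c) (chart_inv c)"
    and transition_smooth:
      "\<lbrakk>c \<in> A; d \<in> A\<rbrakk> \<Longrightarrow> smooth_on (coord c ` (dom_of c \<inter> dom_of d)) (transition c d)"

text \<open>A tangent vector at \<open>p\<close> is the family of its components in all charts around \<open>p\<close>, the
  components in different charts being related by the derivatives of the transition maps.
  For charts not around \<open>p\<close> the component is set to \<open>0\<close>, so that equality of tangent vectors is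
  equality of functions.\<close>

type_synonym ('m, 'e) tvec = "('m, 'e) chart \<Rightarrow> 'e"

definition tangent_space ::
    "('m, 'e::real_normed_vector) chart set \<Rightarrow> 'm \<Rightarrow> ('m, 'e) tvec set" where
  "tangent_space A p =
     {v. (\<forall>c\<in>A. \<forall>d\<in>A. p \<in> dom_of c \<inter> dom_of d \<longrightarrow>
            v d = frechet_derivative (transition c d) (at (coord c p)) (v c)) \<and>
         (\<forall>c. \<not> (c \<in> A \<and> p \<in> dom_of c) \<longrightarrow> v c = 0)}"

text \<open>The tangent vector at \<open>p\<close> whose component in the chart \<open>c\<close> is \<open>u\<close>.\<close>

definition coord_tvec ::
    "('m, 'e::real_normed_vector) chart set \<Rightarrow> ('m, 'e) chart \<Rightarrow> 'm \<Rightarrow> 'e \<Rightarrow> ('m, 'e) tvec" where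
  "coord_tvec A c p u =
     (\<lambda>d. if d \<in> A \<and> p \<in> dom_of d
          then frechet_derivative (transition c d) (at (coord c p)) u else 0)"

definition tangent_bundle ::
    "('m, 'e::real_normed_vector) chart set \<Rightarrow> ('m \<times> ('m, 'e) tvec) set" where
  "tangent_bundle A = Sigma UNIV (tangent_space A)"

definition bundle_chart ::
    "('m, 'e::real_normed_vector) chart set \<Rightarrow> ('m, 'e) chart
       \<Rightarrow> ('m \<times> ('m, 'e) tvec, 'e \<times> 'e) chart" where
  "bundle_chart A c =
     ({z \<in> tangent_bundle A. fst z \<in> dom_of c}, \<lambda>z. (coord c (fst z), snd z c))"

definition tangent_atlas ::
    "('m, 'e::real_normed_vector) chart set \<Rightarrow> ('m \<times> ('m, 'e) tvec, 'e \<times> 'e) chart set" where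
  "tangent_atlas A = bundle_chart A ` A"


section \<open>Paths and back-track equivalence\<close>

text \<open>The definitions below depend only on the given charts, hence apply both to an atlas of a
  manifold \<open>M\<close> and to \<open>tangent_atlas\<close>, i.e. to paths in \<open>TM\<close>. A path is represented by a function
  on \<open>real\<close> of which only the values on \<open>{0..1}\<close> matter.

  Continuity of a smooth curve is part of the definition: the curve is required to
  stay in the domain of \<open>c\<close> near \<open>t\<close>, and its coordinate expression is continuous there.\<close>

definition smooth_curve_on ::
    "('a, 'e::real_normed_vector) chart set \<Rightarrow> real set \<Rightarrow> (real \<Rightarrow> 'a) \<Rightarrow> bool" where
  "smooth_curve_on A I f \<longleftrightarrow>
     f ` I \<subseteq> (\<Union>c\<in>A. dom_of c) \<and>
     (\<forall>c\<in>A. \<forall>t\<in>I. f t \<in> dom_of c \<longrightarrow>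
        (\<exists>\<epsilon>>0. f ` (I \<inter> ball t \<epsilon>) \<subseteq> dom_of c \<and> smooth_on (I \<inter> ball t \<epsilon>) (\<lambda>r. coord c (f r))))"

definition constant_near_ends :: "(real \<Rightarrow> 'a) \<Rightarrow> bool" where
  "constant_near_ends f \<longleftrightarrow>
     (\<exists>\<delta>>0. (\<forall>t\<in>{0..1}. t < \<delta> \<longrightarrow> f t = f 0) \<and> (\<forall>t\<in>{0..1}. t > 1 - \<delta> \<longrightarrow> f t = f 1))"

definition path_space :: "('a, 'e::real_normed_vector) chart set \<Rightarrow> (real \<Rightarrow> 'a) set" where
  "path_space A = {\<gamma>. smooth_curve_on A {0..1} \<gamma>}"

definition path_space_c :: "('a, 'e::real_normed_vector) chart set \<Rightarrow> (real \<Rightarrow> 'a) set" where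
  "path_space_c A = {\<gamma> \<in> path_space A. constant_near_ends \<gamma>}"

definition tangent_path_space_c ::
    "('m, 'e::real_normed_vector) chart set \<Rightarrow> (real \<Rightarrow> 'm)
       \<Rightarrow> (real \<Rightarrow> 'm \<times> ('m, 'e) tvec) set" where
  "tangent_path_space_c A \<gamma> =
     {X \<in> path_space_c (tangent_atlas A). \<forall>t\<in>{0..1}. fst (X t) = \<gamma> t}"

definition reparametrization_of :: "(real \<Rightarrow> 'a) \<Rightarrow> (real \<Rightarrow> 'a) \<Rightarrow> bool" where
  "reparametrization_of p q \<longleftrightarrow>
     (\<exists>\<phi>. continuous_on {0..1} \<phi> \<and> strict_mono_on {0..1} \<phi> \<and> \<phi> 0 = (0::real) \<and> \<phi> 1 = (1::real) \<and>
          (\<forall>t\<in>{0..1}. p t = q (\<phi> t)))"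

text \<open>\<open>q\<close> arises from \<open>p\<close> by erasing one back-tracked part. The type class of \<open>'a\<close> is
  the one of the library's operation \<open>+++\<close>; the topology itself plays no role here.\<close>

definition backtrack_erasure ::
    "('a::topological_space, 'e::real_normed_vector) chart set
       \<Rightarrow> (real \<Rightarrow> 'a) \<Rightarrow> (real \<Rightarrow> 'a) \<Rightarrow> bool" where
  "backtrack_erasure A p q \<longleftrightarrow>
     (\<exists>l1\<in>path_space A. \<exists>l2\<in>path_space A. \<exists>l3\<in>path_space A.
        pathfinish l3 = pathstart l2 \<and> pathfinish l3 = pathstart l1 \<and>
        reparametrization_of p (l3 +++ (l2 +++ (reversepath l2 +++ l1))) \<and>
        reparametrization_of q (l3 +++ l1))"

definition elementary_bt_equivalent ::
    "('a::topological_space, 'e::real_normed_vector) chart set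
       \<Rightarrow> (real \<Rightarrow> 'a) \<Rightarrow> (real \<Rightarrow> 'a) \<Rightarrow> bool" where
  "elementary_bt_equivalent A p q \<longleftrightarrow> backtrack_erasure A p q \<or> backtrack_erasure A q p"

text \<open>Paths differing by a reparametrization are identified, hence the first disjunct.\<close>

definition bt_equivalent ::
    "('a::topological_space, 'e::real_normed_vector) chart set
       \<Rightarrow> (real \<Rightarrow> 'a) \<Rightarrow> (real \<Rightarrow> 'a) \<Rightarrow> bool" where
  "bt_equivalent A = (\<lambda>p q. reparametrization_of p q \<or> elementary_bt_equivalent A p q)\<^sup>*\<^sup>*"


section \<open>Riemannian metrics, the Riemannian connection and geodesics\<close>

text \<open>The expression in the chart \<open>c\<close>, at the point with coordinates \<open>x\<close>, of a family of
  functions of two tangent vectors.\<close>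

definition metric_in_chart ::
    "('m, 'e::real_normed_vector) chart set
       \<Rightarrow> ('m \<Rightarrow> ('m, 'e) tvec \<Rightarrow> ('m, 'e) tvec \<Rightarrow> real)
       \<Rightarrow> ('m, 'e) chart \<Rightarrow> 'e \<Rightarrow> 'e \<Rightarrow> 'e \<Rightarrow> real" where
  "metric_in_chart A g c x u w =
     g (chart_inv c x) (coord_tvec A c (chart_inv c x) u) (coord_tvec A c (chart_inv c x) w)"

locale riemannian_manifold = smooth_manifold A
  for A :: "('m::{t2_space, second_countable_topology}, 'e::euclidean_space) chart set" +
  fixes g :: "'m \<Rightarrow> ('m, 'e) tvec \<Rightarrow> ('m, 'e) tvec \<Rightarrow> real"
  assumes metric_sym:
      "\<lbrakk>u \<in> tangent_space A p; v \<in> tangent_space A p\<rbrakk> \<Longrightarrow> g p u v = g p v u"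
    and metric_add:
      "\<lbrakk>u \<in> tangent_space A p; v \<in> tangent_space A p; w \<in> tangent_space A p\<rbrakk>
         \<Longrightarrow> g p (\<lambda>c. u c + v c) w = g p u w + g p v w"
    and metric_scale:
      "\<lbrakk>u \<in> tangent_space A p; w \<in> tangent_space A p\<rbrakk> \<Longrightarrow> g p (\<lambda>c. r *\<^sub>R u c) w = r * g p u w"
    and metric_pos:
      "\<lbrakk>u \<in> tangent_space A p; u \<noteq> (\<lambda>c. 0)\<rbrakk> \<Longrightarrow> g p u u > 0"
    and metric_smooth:
      "c \<in> A \<Longrightarrow> smooth_on (coord c ` dom_of c) (\<lambda>x. metric_in_chart A g c x y z)"

text \<open>
  In a chart, a connection has the form \<open>\<nabla>\<^bsub>u\<^esub> Y = D\<^bsub>u\<^esub> Y + G(u, Y)\<close>, where \<open>G\<close> is, at each point, a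
  bilinear map (the Christoffel symbols). It is torsion free iff \<open>G\<close> is symmetric, and compatible
  with the metric iff \<open>D\<^bsub>u\<^esub> (g(v, w)) = g(G(u, v), w) + g(v, G(u, w))\<close> for constant \<open>v\<close> and \<open>w\<close>.
  The Riemannian (Levi-Civita) connection is the unique connection with these two properties.
\<close>

definition riemannian_connection ::
    "('m, 'e::euclidean_space) chart set
       \<Rightarrow> ('m \<Rightarrow> ('m, 'e) tvec \<Rightarrow> ('m, 'e) tvec \<Rightarrow> real)
       \<Rightarrow> ('m, 'e) chart \<Rightarrow> 'e \<Rightarrow> 'e \<Rightarrow> 'e \<Rightarrow> 'e" where
  "riemannian_connection A g c x =
     (THE G. bilinear G \<and>
        (\<forall>u v. G u v = G v u) \<and>
        (\<forall>u v w. frechet_derivative (\<lambda>y. metric_in_chart A g c y v w) (at x) u =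
           metric_in_chart A g c x (G u v) w + metric_in_chart A g c x v (G u w)))"

definition velocity ::
    "('m, 'e::real_normed_vector) chart set \<Rightarrow> real set \<Rightarrow> (real \<Rightarrow> 'm) \<Rightarrow> real
       \<Rightarrow> 'm \<times> ('m, 'e) tvec" where
  "velocity A I \<sigma> s =
     (\<sigma> s, \<lambda>c. if c \<in> A \<and> \<sigma> s \<in> dom_of c
               then vector_derivative (\<lambda>r. coord c (\<sigma> r)) (at s within I) else 0)"

text \<open>The component in the chart \<open>c\<close> of the covariant derivative of a vector field \<open>V\<close> along the
  curve \<open>fst \<circ> V\<close> in \<open>M\<close>.\<close>

definition covariant_derivative ::
    "('m, 'e::euclidean_space) chart set
       \<Rightarrow> ('m \<Rightarrow> ('m, 'e) tvec \<Rightarrow> ('m, 'e) tvec \<Rightarrow> real)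
       \<Rightarrow> real set \<Rightarrow> (real \<Rightarrow> 'm \<times> ('m, 'e) tvec) \<Rightarrow> real \<Rightarrow> ('m, 'e) chart \<Rightarrow> 'e" where
  "covariant_derivative A g I V s c =
     vector_derivative (\<lambda>r. snd (V r) c) (at s within I) +
     riemannian_connection A g c (coord c (fst (V s)))
       (vector_derivative (\<lambda>r. coord c (fst (V r))) (at s within I)) (snd (V s) c)"

definition geodesic_on ::
    "('m, 'e::euclidean_space) chart set
       \<Rightarrow> ('m \<Rightarrow> ('m, 'e) tvec \<Rightarrow> ('m, 'e) tvec \<Rightarrow> real) \<Rightarrow> real set \<Rightarrow> (real \<Rightarrow> 'm) \<Rightarrow> bool" where
  "geodesic_on A g I \<sigma> \<longleftrightarrow>
     smooth_curve_on A I \<sigma> \<and>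
     (\<forall>s\<in>I. \<forall>c\<in>A. \<sigma> s \<in> dom_of c \<longrightarrow> covariant_derivative A g I (velocity A I \<sigma>) s c = 0)"

text \<open>Since \<open>velocity\<close> takes values in \<open>TM\<close>, the last equation contains \<open>\<Gamma> 0 t = fst (X t)\<close>.\<close>

definition path_space_geodesic ::
    "('m, 'e::euclidean_space) chart set
       \<Rightarrow> ('m \<Rightarrow> ('m, 'e) tvec \<Rightarrow> ('m, 'e) tvec \<Rightarrow> real) \<Rightarrow> real \<Rightarrow> real
       \<Rightarrow> (real \<Rightarrow> 'm) \<Rightarrow> (real \<Rightarrow> 'm \<times> ('m, 'e) tvec) \<Rightarrow> (real \<Rightarrow> real \<Rightarrow> 'm) \<Rightarrow> bool" where
  "path_space_geodesic A g a b \<gamma> X \<Gamma> \<longleftrightarrow>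
     (\<forall>t\<in>{0..1}. geodesic_on A g {a..b} (\<lambda>s. \<Gamma> s t) \<and>
        \<Gamma> 0 t = \<gamma> t \<and> velocity A {a..b} (\<lambda>s. \<Gamma> s t) 0 = X t)"

end

theory Submission
  imports Defs
begin

text \<open>
  For a tangent vector \<open>v\<close> at \<open>p\<close> let \<open>E v\<close> be the value at time 1 of the geodesic with initial velocity \<open>v\<close>.
  By homogeneity of geodesics the longitudinal paths are \<open>t \<mapsto> E (s X(t))\<close>, and composition with a map
  that sends smooth curves to smooth curves preserves back-track equivalence. The paths of
  a chain joining \<open>X1\<close> to \<open>X2\<close> may however leave the set of vectors \<open>v\<close> for which \<open>E (s v)\<close> is defined. As this
  set is open and star-shaped in each fibre, there is a smooth \<open>\<kappa> : TM \<rightarrow> [0,1]\<close> that equals 1 on the images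
  of \<open>X1\<close> and \<open>X2\<close> and is supported in it; then \<open>v \<mapsto> E (\<kappa>(v) s v)\<close> is defined on all of \<open>TM\<close> and
  maps the chain to a chain joining the longitudinal paths.

  Openness of the domain and smoothness of \<open>E\<close> along curves are smooth dependence on initial
  conditions for the geodesic spray. Along a curve of initial values there is a single parameter
  \<open>t\<close>, and the \<open>t\<close>-derivatives of the solutions are controlled by the variational equation.
\<close>

text \<open>The part \<open>l2\<close> of a back-track may run through vectors far from both fields,
  where geodesics need not last long enough. Joining and reversing are respected by composition with
  one fixed map, not by constructions made path by path; hence a map on all of TM. Its values off
  the two given fields are immaterial, so \<kappa> may shrink vectors there, down to 0, whose
  geodesic is constant. Smoothness of \<kappa>, too, is asked only along curves. So \<kappa> can be
  put together from bump functions in charts as 1 - (1 - \<kappa>1)(1 - \<kappa>2), with the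
  compactness of [0,1] doing the work of a partition of unity. As a type, the set of pairs that
  contains TM does not carry the bundle topology: components are set to 0 outside their chart domain
  and so jump there. The flow is therefore developed in charts alone, with uniqueness of limits
  standing for the Hausdorff property. In each chart the field is cut off to a global one with
  bounded derivative, for which a contraction argument works on all intervals below a fixed
  length.\<close>

section \<open>Calculus of \<open>C\<^sup>k\<close> maps\<close>

text \<open>The hypothesis of \<open>frechet_derivative_unique_within\<close>.\<close>

definition thick :: "'a::euclidean_space set \<Rightarrow> bool" where
  "thick S \<longleftrightarrow> (\<forall>x\<in>S. \<forall>i\<in>Basis. \<forall>e>0. \<exists>d. 0 < \<bar>d\<bar> \<and> \<bar>d\<bar> < e \<and> x + d *\<^sub>R i \<in> S)"

lemma thick_open: "open S \<Longrightarrow> thick S"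
  unfolding thick_def
proof safe
  fix x i :: 'a and e :: real assume "open S" "x \<in> S" "i \<in> Basis" "0 < e"
  then obtain d where d: "d > 0" "ball x d \<subseteq> S" by (meson openE)
  show "\<exists>d. 0 < \<bar>d\<bar> \<and> \<bar>d\<bar> < e \<and> x + d *\<^sub>R i \<in> S"
    by (rule exI[of _ "min d e / 2"]) (use d \<open>e > 0\<close> \<open>i \<in> Basis\<close> in \<open>auto intro!: subsetD[OF d(2)] simp: dist_norm\<close>)
qed

lemma thick_convex_real:
  fixes S :: "real set"
  assumes "convex S" "p \<in> S" "q \<in> S" "p \<noteq> q"
  shows "thick S"
  unfolding thick_def
proof safe
  fix x i e :: real assume x: "x \<in> S" and i: "i \<in> Basis" and e: "0 < e"
  obtain y where y: "y \<in> S" "y \<noteq> x" using assms by metis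
  \<comment> \<open>Displacement from x towards another point y of S. The factor is at most 1, so
    that convexity keeps the new point in S, and small enough to make the displacement less than
    e.\<close>
  define d where "d = min 1 (e / (2 * \<bar>y - x\<bar>)) * (y - x)"
  have 1: "0 < min 1 (e / (2 * \<bar>y - x\<bar>))" "min 1 (e / (2 * \<bar>y - x\<bar>)) \<le> 1"
    using y e by auto
  have "\<bar>d\<bar> = min 1 (e / (2 * \<bar>y - x\<bar>)) * \<bar>y - x\<bar>" using 1 by (simp add: d_def abs_mult)
  also have "\<dots> \<le> e / (2 * \<bar>y - x\<bar>) * \<bar>y - x\<bar>" by (intro mult_right_mono) auto
  also have "\<dots> < e" using y e by (simp add: field_simps)
  finally have "\<bar>d\<bar> < e" .
  moreover have "0 < \<bar>d\<bar>" using 1 y by (simp add: d_def)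
  moreover have "x + d \<in> S"
  proof -
    let ?u = "min 1 (e / (2 * \<bar>y - x\<bar>))"
    have "(1 - ?u) *\<^sub>R x + ?u *\<^sub>R y \<in> S"
      using assms(1) x y(1) 1 unfolding convex_alt by (metis less_imp_le)
    then show ?thesis by (simp add: d_def algebra_simps)
  qed
  ultimately show "\<exists>d. 0 < \<bar>d\<bar> \<and> \<bar>d\<bar> < e \<and> x + d *\<^sub>R i \<in> S" using i by auto
qed

lemma thick_unique_derivative:
  assumes "thick S" "x \<in> S" "(f has_derivative f') (at x within S)"
  shows "frechet_derivative f (at x within S) = f'"
proof -
  have "f differentiable (at x within S)" using assms(3) by (rule differentiableI)
  then have "(f has_derivative frechet_derivative f (at x within S)) (at x within S)"
    by (simp add: frechet_derivative_works)
  then show ?thesis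
    using assms by (intro frechet_derivative_unique_within) (auto simp: thick_def)
qed

lemma C_k_on_cong:
  "(\<And>x. x \<in> S \<Longrightarrow> f x = g x) \<Longrightarrow> C_k_on k S f \<longleftrightarrow> C_k_on k S g"
proof (induction k arbitrary: f g)
  case 0
  then show ?case by (simp cong: continuous_on_cong)
next
  case (Suc k)
  have hd: "(f has_derivative D) (at x within S) \<longleftrightarrow> (g has_derivative D) (at x within S)" if "x \<in> S"
    for x D
    using Suc.prems that by (metis has_derivative_transform)
  then have "frechet_derivative f (at x within S) = frechet_derivative g (at x within S)" if "x \<in> S"
    for x
    using that by (simp add: frechet_derivative_def)
  then have "C_k_on k S (\<lambda>x. frechet_derivative f (at x within S) v) \<longleftrightarrow>
      C_k_on k S (\<lambda>x. frechet_derivative g (at x within S) v)" for v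
    by (intro Suc.IH) auto
  moreover have "f differentiable_on S \<longleftrightarrow> g differentiable_on S"
    unfolding differentiable_on_def differentiable_def using hd by blast
  ultimately show ?case by simp
qed

text \<open>The definition differentiates with \<open>frechet_derivative\<close>, a choice operator.
  Derivatives within a thick set are unique, so any explicit derivative may be used instead; the
  closure rules below rest on this.\<close>

lemma C_k_on_SucI:
  assumes "thick S"
    and der: "\<And>x. x \<in> S \<Longrightarrow> (f has_derivative f' x) (at x within S)"
    and k: "\<And>v. C_k_on k S (\<lambda>x. f' x v)"
  shows "C_k_on (Suc k) S f"
proof -
  have "C_k_on k S (\<lambda>x. frechet_derivative f (at x within S) v)" for v
    using k[of v] by (subst C_k_on_cong[where g = "\<lambda>x. f' x v"])
      (simp_all add: thick_unique_derivative[OF assms(1) _ der])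
  moreover have "f differentiable_on S"
    using der by (auto simp: differentiable_on_def differentiable_def)
  ultimately show ?thesis by simp
qed

lemma C_k_on_SucD:
  assumes "C_k_on (Suc k) S f" "x \<in> S"
  shows "(f has_derivative frechet_derivative f (at x within S)) (at x within S)"
  using assms by (simp add: differentiable_on_def frechet_derivative_works)

lemma C_k_on_Suc_imp: "C_k_on (Suc k) S f \<Longrightarrow> C_k_on k S f"
proof (induction k arbitrary: f)
  case 0
  then show ?case by (simp add: differentiable_imp_continuous_on)
next
  case (Suc k)
  from Suc.prems have "f differentiable_on S" by simp
  moreover have "C_k_on k S (\<lambda>x. frechet_derivative f (at x within S) v)" for v
    using Suc.prems Suc.IH by (simp del: C_k_on.simps add: C_k_on.simps(2)[of "Suc k"])
  ultimately show ?case by simp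
qed

lemma C_k_on_imp_continuous: "C_k_on k S f \<Longrightarrow> continuous_on S f"
  by (induction k) (use C_k_on_Suc_imp in \<open>auto simp del: C_k_on.simps(2)\<close>)

lemma C_k_on_const: "thick S \<Longrightarrow> C_k_on k S (\<lambda>x. c)"
proof (induction k arbitrary: c)
  case (Suc k)
  show ?case by (rule C_k_on_SucI[OF Suc.prems has_derivative_const]) (auto intro!: Suc)
qed simp

lemma C_k_on_linear: "thick S \<Longrightarrow> bounded_linear h \<Longrightarrow> C_k_on k S f \<Longrightarrow> C_k_on k S (\<lambda>x. h (f x))"
proof (induction k arbitrary: f)
  case 0
  then show ?case by (auto intro: bounded_linear.continuous_on)
next
  case (Suc k)
  show ?case
    by (rule C_k_on_SucI[OF Suc.prems(1) bounded_linear.has_derivative[OF Suc.prems(2) C_k_on_SucD[OF Suc.prems(3)]]])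
      (use Suc in auto)
qed

lemma C_k_on_id: "thick S \<Longrightarrow> C_k_on k S (\<lambda>x. x)"
  by (cases k) (auto intro!: C_k_on_SucI[OF _ has_derivative_ident] C_k_on_const simp del: C_k_on.simps(2))

lemma C_k_on_add: "thick S \<Longrightarrow> C_k_on k S f \<Longrightarrow> C_k_on k S g \<Longrightarrow> C_k_on k S (\<lambda>x. f x + g x)"
proof (induction k arbitrary: f g)
  case 0
  then show ?case by (auto intro: continuous_intros)
next
  case (Suc k)
  show ?case
    by (rule C_k_on_SucI[OF Suc.prems(1) has_derivative_add[OF C_k_on_SucD[OF Suc.prems(2)] C_k_on_SucD[OF Suc.prems(3)]]])
      (use Suc in auto)
qed

lemma C_k_on_sum: "thick S \<Longrightarrow> (\<And>i. i \<in> I \<Longrightarrow> C_k_on k S (f i)) \<Longrightarrow> C_k_on k S (\<lambda>x. \<Sum>i\<in>I. f i x)"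
  by (induction I rule: infinite_finite_induct) (auto intro: C_k_on_add C_k_on_const)

text \<open>The product rule contains f and g next to their derivatives, so the induction hypothesis
  is applied to f and g at an order one less than the one given.\<close>

lemma C_k_on_bilinear:
  assumes "thick S" "bounded_bilinear h"
  shows "C_k_on k S f \<Longrightarrow> C_k_on k S g \<Longrightarrow> C_k_on k S (\<lambda>x. h (f x) (g x))"
proof (induction k arbitrary: f g)
  case 0
  then show ?case by (auto intro: bounded_bilinear.continuous_on[OF assms(2)])
next
  case (Suc k)
  have fg: "C_k_on k S f" "C_k_on k S g" using Suc.prems C_k_on_Suc_imp by blast+
  have "C_k_on k S (\<lambda>x. frechet_derivative f (at x within S) v)"
    "C_k_on k S (\<lambda>x. frechet_derivative g (at x within S) v)" for v
    using Suc.prems by simp_all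
  then show ?case
    by (intro C_k_on_SucI[OF assms(1) bounded_bilinear.FDERIV[OF assms(2) C_k_on_SucD[OF Suc.prems(1)] C_k_on_SucD[OF Suc.prems(2)]]]
        C_k_on_add assms(1) Suc.IH fg)
qed

lemmas C_k_on_scaleR = C_k_on_bilinear[OF _ bounded_bilinear_scaleR]
lemmas C_k_on_mult = C_k_on_bilinear[OF _ bounded_bilinear_mult]

lemma C_k_on_Pair: "thick S \<Longrightarrow> C_k_on k S f \<Longrightarrow> C_k_on k S g \<Longrightarrow> C_k_on k S (\<lambda>x. (f x, g x))"
  using C_k_on_add[of S k "\<lambda>x. (f x, 0)" "\<lambda>x. (0, g x)"]
    C_k_on_linear[of S "\<lambda>y. (y, 0)" k f] C_k_on_linear[of S "\<lambda>y. (0, y)" k g]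
  by (simp add: bounded_linear_Pair bounded_linear_ident bounded_linear_zero)

lemma C_k_on_subset: "C_k_on k S f \<Longrightarrow> thick T \<Longrightarrow> T \<subseteq> S \<Longrightarrow> C_k_on k T f"
proof (induction k arbitrary: f)
  case 0
  then show ?case by (auto intro: continuous_on_subset)
next
  case (Suc k)
  show ?case
    by (rule C_k_on_SucI[OF Suc.prems(2), where f' = "\<lambda>x. frechet_derivative f (at x within S)"])
      (use Suc C_k_on_SucD[OF Suc.prems(1)] in \<open>auto intro: has_derivative_subset\<close>)
qed

text \<open>A linear map that varies with a point is handled throughout by its values on basis
  vectors. Continuity and differentiability then concern finitely many vector-valued functions
  instead of an operator-valued one.\<close>

lemma linear_sum_Basis:
  fixes h :: "'a::euclidean_space \<Rightarrow> 'b::real_vector"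
  assumes "linear h" shows "h v = (\<Sum>i\<in>Basis. (v \<bullet> i) *\<^sub>R h i)"
proof -
  have "h v = h (\<Sum>i\<in>Basis. (v \<bullet> i) *\<^sub>R i)" by (simp add: euclidean_representation)
  also have "\<dots> = (\<Sum>i\<in>Basis. (v \<bullet> i) *\<^sub>R h i)"
    using assms by (simp add: linear_sum linear_scale)
  finally show ?thesis .
qed

lemma C_k_on_inner_left: "thick S \<Longrightarrow> C_k_on k S f \<Longrightarrow> C_k_on k S (\<lambda>x. f x \<bullet> i)"
  by (rule C_k_on_linear) (auto intro: bounded_linear_inner_left)

text \<open>The chain rule puts a varying vector into a varying derivative, whereas
  \<open>C_k_on\<close> controls directional derivatives at fixed vectors. Expansion in the basis
  gives a sum of products, and the induction hypothesis is applied to the partial derivatives of g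
  composed with f.\<close>

lemma C_k_on_compose:
  fixes f :: "'a::euclidean_space \<Rightarrow> 'b::euclidean_space" and g :: "'b \<Rightarrow> 'c::real_normed_vector"
  assumes "thick S" "f ` S \<subseteq> T"
  shows "C_k_on k S f \<Longrightarrow> C_k_on k T g \<Longrightarrow> C_k_on k S (\<lambda>x. g (f x))"
proof (induction k arbitrary: g)
  case 0
  then show ?case using assms by (auto intro: continuous_on_compose2)
next
  case (Suc k)
  define D where "D y = frechet_derivative g (at y within T)" for y
  define f' where "f' x = frechet_derivative f (at x within S)" for x
  have D: "(g has_derivative D y) (at y within T)" if "y \<in> T" for y
    using C_k_on_SucD[OF Suc.prems(2) that] by (simp add: D_def)
  have f': "(f has_derivative f' x) (at x within S)" if "x \<in> S" for x
    using C_k_on_SucD[OF Suc.prems(1) that] by (simp add: f'_def)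
  show ?case
  proof (rule C_k_on_SucI[OF assms(1), where f' = "\<lambda>x v. \<Sum>i\<in>Basis. (f' x v \<bullet> i) *\<^sub>R D (f x) i"])
    fix x assume x: "x \<in> S"
    have Dx: "(g has_derivative D (f x)) (at (f x) within f ` S)"
      using D[of "f x"] x assms by (auto intro: has_derivative_subset)
    have "((\<lambda>x. g (f x)) has_derivative (\<lambda>v. D (f x) (f' x v))) (at x within S)"
      using diff_chain_within[OF f'[OF x] Dx] by (simp add: o_def)
    moreover have "linear (D (f x))" using Dx has_derivative_linear by blast
    ultimately show "((\<lambda>x. g (f x)) has_derivative (\<lambda>v. \<Sum>i\<in>Basis. (f' x v \<bullet> i) *\<^sub>R D (f x) i)) (at x within S)"
      by (simp add: linear_sum_Basis[of "D (f x)", symmetric])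
  next
    fix v
    have "C_k_on k S (\<lambda>x. D (f x) i)" for i
      using Suc.prems C_k_on_Suc_imp by (intro Suc.IH) (auto simp: D_def)
    moreover have "C_k_on k S (\<lambda>x. f' x v)" using Suc.prems by (simp add: f'_def)
    ultimately show "C_k_on k S (\<lambda>x. \<Sum>i\<in>Basis. (f' x v \<bullet> i) *\<^sub>R D (f x) i)"
      by (intro C_k_on_sum C_k_on_scaleR C_k_on_inner_left assms(1)) auto
  qed
qed

lemma smooth_on_deriv:
  assumes "smooth_on S f" "open S"
  shows "smooth_on S (\<lambda>x. frechet_derivative f (at x) v)"
  unfolding smooth_on_def
proof
  fix k
  have "C_k_on (Suc k) S f" using assms by (simp add: smooth_on_def del: C_k_on.simps)
  then have "C_k_on k S (\<lambda>x. frechet_derivative f (at x within S) v)" by simp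
  then show "C_k_on k S (\<lambda>x. frechet_derivative f (at x) v)"
    by (subst C_k_on_cong[where g = "\<lambda>x. frechet_derivative f (at x within S) v"])
      (simp_all add: at_within_open[OF _ assms(2)])
qed

lemma smooth_on_has_derivative:
  assumes "smooth_on S f" "open S" "x \<in> S"
  shows "(f has_derivative frechet_derivative f (at x)) (at x)"
proof -
  have "C_k_on (Suc 0) S f" using assms by (simp add: smooth_on_def del: C_k_on.simps)
  from C_k_on_SucD[OF this assms(3)] show ?thesis using assms
    by (simp add: at_within_open[OF _ assms(2)])
qed

lemma smooth_on_continuous: "smooth_on S f \<Longrightarrow> continuous_on S f"
  unfolding smooth_on_def using C_k_on_imp_continuous by blast

lemma smooth_on_cong: "(\<And>x. x \<in> S \<Longrightarrow> f x = g x) \<Longrightarrow> smooth_on S f \<longleftrightarrow> smooth_on S g"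
  unfolding smooth_on_def using C_k_on_cong by blast

lemma smooth_on_const: "thick S \<Longrightarrow> smooth_on S (\<lambda>x. c)"
  by (simp add: smooth_on_def C_k_on_const)

lemma smooth_on_id: "thick S \<Longrightarrow> smooth_on S (\<lambda>x. x)"
  by (simp add: smooth_on_def C_k_on_id)

lemma smooth_on_linear: "thick S \<Longrightarrow> bounded_linear h \<Longrightarrow> smooth_on S f \<Longrightarrow> smooth_on S (\<lambda>x. h (f x))"
  by (simp add: smooth_on_def C_k_on_linear)

lemma smooth_on_add: "thick S \<Longrightarrow> smooth_on S f \<Longrightarrow> smooth_on S g \<Longrightarrow> smooth_on S (\<lambda>x. f x + g x)"
  by (simp add: smooth_on_def C_k_on_add)

lemma smooth_on_minus: "thick S \<Longrightarrow> smooth_on S f \<Longrightarrow> smooth_on S (\<lambda>x. - f x)"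
  by (rule smooth_on_linear) (auto intro: bounded_linear_minus bounded_linear_ident)

lemma smooth_on_diff: "thick S \<Longrightarrow> smooth_on S f \<Longrightarrow> smooth_on S g \<Longrightarrow> smooth_on S (\<lambda>x. f x - g x)"
  using smooth_on_add[of S f "\<lambda>x. - g x"] smooth_on_minus[of S g] by simp

lemma smooth_on_sum: "thick S \<Longrightarrow> (\<And>i. i \<in> I \<Longrightarrow> smooth_on S (f i)) \<Longrightarrow> smooth_on S (\<lambda>x. \<Sum>i\<in>I. f i x)"
  by (simp add: smooth_on_def C_k_on_sum)

lemma smooth_on_scaleR: "thick S \<Longrightarrow> smooth_on S f \<Longrightarrow> smooth_on S g \<Longrightarrow> smooth_on S (\<lambda>x. f x *\<^sub>R g x)"
  by (simp add: smooth_on_def C_k_on_scaleR)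

lemma smooth_on_mult:
  fixes f g :: "'a::euclidean_space \<Rightarrow> 'b::real_normed_algebra"
  shows "thick S \<Longrightarrow> smooth_on S f \<Longrightarrow> smooth_on S g \<Longrightarrow> smooth_on S (\<lambda>x. f x * g x)"
  by (simp add: smooth_on_def C_k_on_mult)

lemma smooth_on_inner:
  "thick S \<Longrightarrow> smooth_on S f \<Longrightarrow> smooth_on S g \<Longrightarrow> smooth_on S (\<lambda>x. f x \<bullet> g x)"
  by (simp add: smooth_on_def C_k_on_bilinear[OF _ bounded_bilinear_inner])

lemma smooth_on_Pair: "thick S \<Longrightarrow> smooth_on S f \<Longrightarrow> smooth_on S g \<Longrightarrow> smooth_on S (\<lambda>x. (f x, g x))"
  by (simp add: smooth_on_def C_k_on_Pair)

lemma smooth_on_subset: "smooth_on S f \<Longrightarrow> thick T \<Longrightarrow> T \<subseteq> S \<Longrightarrow> smooth_on T f"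
  by (meson smooth_on_def C_k_on_subset)

lemma smooth_on_compose:
  fixes f :: "'a::euclidean_space \<Rightarrow> 'b::euclidean_space" and g :: "'b \<Rightarrow> 'c::real_normed_vector"
  shows "thick S \<Longrightarrow> f ` S \<subseteq> T \<Longrightarrow> smooth_on S f \<Longrightarrow> smooth_on T g \<Longrightarrow> smooth_on S (\<lambda>x. g (f x))"
  unfolding smooth_on_def using C_k_on_compose by blast

section \<open>Bump functions\<close>

lemma DERIV_inverse_power:
  fixes x :: real
  assumes "x \<noteq> 0"
  shows "((\<lambda>x. inverse x ^ n) has_real_derivative - (n * inverse x ^ Suc n)) (at x within S)"
proof (induction n)
  case (Suc n)
  have "((\<lambda>x. inverse x * inverse x ^ n) has_real_derivative
      - (inverse x * inverse x) * inverse x ^ n + - (n * inverse x ^ Suc n) * inverse x) (at x within S)"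
    using assms by (intro DERIV_mult Suc) (auto intro!: derivative_eq_intros)
  then show ?case by (simp add: algebra_simps)
qed simp

text \<open>The family c / x^n is closed under differentiation, which is what the induction over k
  needs; n = 1 gives the inverse.\<close>

lemma C_k_on_inverse_power: "C_k_on k {0<..} (\<lambda>x::real. c * inverse x ^ n)"
proof (induction k arbitrary: c n)
  case 0
  then show ?case by (auto intro!: continuous_intros)
next
  case (Suc k)
  have th: "thick {0::real<..}" by (simp add: thick_open)
  show ?case
  proof (rule C_k_on_SucI[OF th, where f' = "\<lambda>x v. v * (- (c * n) * inverse x ^ Suc n)"])
    fix x :: real assume "x \<in> {0<..}"
    then show "((\<lambda>x. c * inverse x ^ n) has_derivative (\<lambda>v. v * (- (c * n) * inverse x ^ Suc n))) (at x within {0<..})"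
      by (intro has_derivative_eq_rhs[OF DERIV_cmult[OF DERIV_inverse_power, unfolded has_field_derivative_def]])
        (auto simp: fun_eq_iff mult_ac)
  next
    fix v
    have "C_k_on k {0<..} (\<lambda>x::real. (v * - (c * n)) * inverse x ^ Suc n)" by (rule Suc)
    then show "C_k_on k {0<..} (\<lambda>x::real. v * (- (c * n) * inverse x ^ Suc n))" by (simp add: mult.assoc)
  qed
qed

lemma smooth_on_inverse:
  fixes f :: "'a::euclidean_space \<Rightarrow> real"
  assumes "thick S" "smooth_on S f" "\<And>x. x \<in> S \<Longrightarrow> 0 < f x"
  shows "smooth_on S (\<lambda>x. inverse (f x))"
proof (rule smooth_on_compose[OF assms(1) _ assms(2)])
  show "smooth_on {0<..} (inverse :: real \<Rightarrow> real)"
    using C_k_on_inverse_power[of _ 1 1] by (simp add: smooth_on_def)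
qed (use assms in auto)

text \<open>For n = 0 this is the usual flat function exp(-1/x). The powers of 1/x arise on
  differentiation; with them the family is closed under taking derivatives, up to linear
  combinations.\<close>

definition flat_exp :: "nat \<Rightarrow> real \<Rightarrow> real" where
  "flat_exp n x = (if 0 < x then inverse x ^ n * exp (- inverse x) else 0)"

text \<open>With y = 1/x the limit from the right is the decay of y^n / exp y at infinity; on the
  left the function is 0.\<close>

lemma flat_exp_tendsto: "(flat_exp n \<longlongrightarrow> 0) (at 0)"
proof -
  have "((\<lambda>x. inverse x ^ n * exp (- inverse x)) \<longlongrightarrow> 0) (at_right (0::real))"
  proof -
    have "((\<lambda>y. y ^ n / exp y) \<longlongrightarrow> 0) (at_top :: real filter)" by (rule tendsto_power_div_exp_0)
    then have "((\<lambda>x. inverse x ^ n / exp (inverse x)) \<longlongrightarrow> 0) (at_right (0::real))"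
      by (rule filterlim_compose) (rule filterlim_inverse_at_top_right)
    then show ?thesis by (simp add: exp_minus field_simps)
  qed
  then have "(flat_exp n \<longlongrightarrow> 0) (at_right 0)"
    by (rule tendsto_cong[THEN iffD1, rotated]) (auto simp: flat_exp_def eventually_at_filter)
  moreover have "(flat_exp n \<longlongrightarrow> 0) (at_left 0)"
    by (rule tendsto_eventually) (auto simp: flat_exp_def eventually_at_filter)
  ultimately show ?thesis by (intro filterlim_split_at)
qed

lemma flat_exp_deriv:
  "(flat_exp n has_real_derivative flat_exp (n + 2) x - n * flat_exp (n + 1) x) (at x)"
proof -
  consider "x > 0" | "x < 0" | "x = 0" by linarith
  then show ?thesis
  proof cases
    case 1
    have "((\<lambda>x. inverse x ^ n * exp (- inverse x)) has_real_derivative flat_exp (n + 2) x - n * flat_exp (n + 1) x) (at x)"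
    proof -
      have "((\<lambda>x. exp (- inverse x)) has_real_derivative exp (- inverse x) * (inverse x * inverse x)) (at x)"
        using 1 by (auto intro!: derivative_eq_intros)
      from DERIV_mult[OF DERIV_inverse_power this, of n] 1 show ?thesis
        by (simp add: flat_exp_def algebra_simps)
    qed
    then show ?thesis
      by (rule has_field_derivative_transform_within_open[of _ _ _
        "{0<..}"]) (use 1 in \<open>auto simp: flat_exp_def\<close>)
  next
    case 2
    have "((\<lambda>x. 0) has_real_derivative flat_exp (n + 2) x - n * flat_exp (n + 1) x) (at x)"
      using 2 by (auto simp: flat_exp_def)
    then show ?thesis
      by (rule has_field_derivative_transform_within_open[of _ _ _
        "{..<0}"]) (use 2 in \<open>auto simp: flat_exp_def\<close>)
  next
    case 3
    \<comment> \<open>\<open>flat_exp n\<close> vanishes at 0, and its quotient by h is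
      \<open>flat_exp (Suc n)\<close>, which tends to 0.\<close>
    have "((\<lambda>h. (flat_exp n (0 + h) - flat_exp n 0) / h) \<longlongrightarrow> 0) (at 0)"
      by (rule tendsto_cong[THEN iffD1, OF _ flat_exp_tendsto[of "Suc n"]])
        (auto simp: flat_exp_def eventually_at_filter field_simps)
    then show ?thesis using 3 by (simp add: DERIV_def flat_exp_def)
  qed
qed

lemma C_k_on_flat_exp: "C_k_on k UNIV (flat_exp n)"
proof (induction k arbitrary: n)
  case 0
  show ?case by simp (meson DERIV_isCont flat_exp_deriv continuous_at_imp_continuous_on)
next
  case (Suc k)
  have th: "thick (UNIV::real set)" by (simp add: thick_open)
  show ?case
  proof (rule C_k_on_SucI[OF th, where f' =
    "\<lambda>x v. v * (flat_exp (n + 2) x + (- real n) * flat_exp (n + 1) x)"])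
    show "(flat_exp n has_derivative (\<lambda>v. v * (flat_exp (n + 2) x + - real n * flat_exp (n + 1) x))) (at x within UNIV)" for x
      using flat_exp_deriv[of n x] by (simp add: has_field_derivative_def mult.commute[of _ "_ - _"])
  next
    show "C_k_on k UNIV (\<lambda>x. v * (flat_exp (n + 2) x + - real n * flat_exp (n + 1) x))" for v
      by (intro C_k_on_mult C_k_on_add C_k_on_const th Suc)
  qed
qed

lemma flat_exp_nonneg: "0 \<le> flat_exp n x" and flat_exp_pos: "0 < x \<Longrightarrow> 0 < flat_exp n x"
  by (auto simp: flat_exp_def)

text \<open>For r > 0 this is 1 up to distance r from p and 0 from distance 2r on. The squared
  distance y avoids the singularity of the norm at p, and since r^2 < 4 r^2, at least one summand of
  the denominator is positive.\<close>

definition bump :: "'a::euclidean_space \<Rightarrow> real \<Rightarrow> 'a \<Rightarrow> real" where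
  "bump p r x = (let y = (x - p) \<bullet> (x - p) in
     flat_exp 0 (4 * r\<^sup>2 - y) * inverse (flat_exp 0 (4 * r\<^sup>2 - y) + flat_exp 0 (y - r\<^sup>2)))"

lemma bump_denominator:
  fixes y r :: real
  assumes "0 < r" shows "0 < flat_exp 0 (4 * r\<^sup>2 - y) + flat_exp 0 (y - r\<^sup>2)"
proof (cases "y < 4 * r\<^sup>2")
  case True
  then show ?thesis by (intro add_pos_nonneg flat_exp_pos flat_exp_nonneg) simp
next
  case False
  moreover have "r\<^sup>2 < 4 * r\<^sup>2" using assms by simp
  ultimately show ?thesis by (intro add_nonneg_pos flat_exp_pos flat_exp_nonneg) linarith
qed

lemma smooth_on_bump: 
  assumes "0 < r" shows "smooth_on UNIV (bump p r)"
proof -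
  have th: "thick (UNIV::'a set)" by (simp add: thick_open)
  have sh: "smooth_on UNIV (flat_exp 0)" by (simp add: smooth_on_def C_k_on_flat_exp)
  have y: "smooth_on UNIV (\<lambda>x. (x - p) \<bullet> (x - p))"
    by (intro smooth_on_inner smooth_on_diff smooth_on_const smooth_on_id th)
  have 1: "smooth_on UNIV (\<lambda>x. flat_exp 0 (4 * r\<^sup>2 - (x - p) \<bullet> (x - p)))"
    by (rule smooth_on_compose[OF th _ _ sh]) (auto intro!: smooth_on_diff smooth_on_const y th)
  have 2: "smooth_on UNIV (\<lambda>x. flat_exp 0 ((x - p) \<bullet> (x - p) - r\<^sup>2))"
    by (rule smooth_on_compose[OF th _ _ sh]) (auto intro!: smooth_on_diff smooth_on_const y th)
  show ?thesis
    unfolding bump_def[abs_def] Let_def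
    by (intro smooth_on_mult smooth_on_inverse smooth_on_add 1 2 th bump_denominator assms)
qed

lemma bump_range: "0 < r \<Longrightarrow> 0 \<le> bump p r x \<and> bump p r x \<le> 1"
  using bump_denominator[of r] flat_exp_nonneg
  by (auto simp: bump_def Let_def field_simps)

lemma bump_eq_1: 
  assumes "0 < r" "dist x p \<le> r" shows "bump p r x = 1"
proof -
  have *: "(x - p) \<bullet> (x - p) \<le> r\<^sup>2"
    using assms by (simp add: dist_norm dot_square_norm power_mono)
  then have "flat_exp 0 ((x - p) \<bullet> (x - p) - r\<^sup>2) = 0" by (simp add: flat_exp_def)
  moreover have "0 < flat_exp 0 (4 * r\<^sup>2 - (x - p) \<bullet> (x - p))"
    using * assms by (intro flat_exp_pos) (simp add: power2_eq_square, smt (verit) mult_pos_pos)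
  ultimately show ?thesis by (simp add: bump_def Let_def)
qed

lemma bump_eq_0:
  assumes "0 < r" "2 * r \<le> dist x p" shows "bump p r x = 0"
proof -
  have "(2 * r)\<^sup>2 \<le> (x - p) \<bullet> (x - p)"
    unfolding dot_square_norm by (rule power_mono) (use assms in \<open>auto simp: dist_norm\<close>)
  then show ?thesis by (simp add: bump_def Let_def flat_exp_def power_mult_distrib)
qed

section \<open>Ordinary differential equations and their parameters\<close>

text \<open>The squared norm is differentiated, as the norm may fail to be differentiable at zeros
  of w. The factor exp(-K(s - \<alpha>)) and the correction \<epsilon>^2 (s - \<alpha>) make the
  resulting function h nonincreasing. The constant is generous: what matters is that it depends only
  on L and the interval, and that the bound is linear in initial value and error.\<close>

lemma gronwall:
  fixes w :: "real \<Rightarrow> 'a::euclidean_space"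
  assumes der: "\<And>s. s \<in> {\<alpha>..\<beta>} \<Longrightarrow> (w has_vector_derivative w' s) (at s within {\<alpha>..\<beta>})"
    and bound: "\<And>s. s \<in> {\<alpha>..\<beta>} \<Longrightarrow> norm (w' s) \<le> L * norm (w s) + \<epsilon>"
    and "0 \<le> L" "0 \<le> \<epsilon>" and s: "s \<in> {\<alpha>..\<beta>}"
  shows "norm (w s) \<le> exp ((L + 1) * (\<beta> - \<alpha>)) * (1 + (\<beta> - \<alpha>)) * (norm (w \<alpha>) + \<epsilon>)"
proof -
  \<comment> \<open>2|w|(L|w| + \<epsilon>) \<le> (2L + 1)|w|^2 + \<epsilon>^2 by the inequality
    2|w|\<epsilon> \<le> |w|^2 + \<epsilon>^2, and K is the coefficient of |w|^2.\<close>
  define K where "K = 2 * L + 1"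
  define h where "h s = exp (- K * (s - \<alpha>)) * (w s \<bullet> w s) - \<epsilon>\<^sup>2 * (s - \<alpha>)" for s
  have T: "0 \<le> s - \<alpha>" "s - \<alpha> \<le> \<beta> - \<alpha>" "0 \<le> \<beta> - \<alpha>" using s by auto
  have hder: "(h has_real_derivative
      exp (- K * (s - \<alpha>)) * (2 * (w s \<bullet> w' s)) - K * exp (- K * (s - \<alpha>)) * (w s \<bullet> w s) - \<epsilon>\<^sup>2) (at s within {\<alpha>..\<beta>})"
    if "s \<in> {\<alpha>..\<beta>}" for s
  proof -
    have "((\<lambda>s. w s \<bullet> w s) has_derivative (\<lambda>x. w s \<bullet> (x *\<^sub>R w' s) + (x *\<^sub>R w' s) \<bullet> w s)) (at s within {\<alpha>..\<beta>})"
      using der[OF that] by (intro has_derivative_inner) (auto simp: has_vector_derivative_def)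
    then have ww: "((\<lambda>s. w s \<bullet> w s) has_real_derivative 2 * (w s \<bullet> w' s)) (at s within {\<alpha>..\<beta>})"
      unfolding has_field_derivative_def
      by (rule has_derivative_eq_rhs) (auto simp: fun_eq_iff inner_commute algebra_simps)
    show ?thesis
      unfolding h_def by (rule derivative_eq_intros ww refl | simp)+
  qed
  have "h s \<le> h \<alpha>"
  proof (rule DERIV_nonpos_imp_decreasing_open[of \<alpha> s h])
    show "\<alpha> \<le> s" using s by simp
    show "continuous_on {\<alpha>..s} h"
    proof (rule continuous_on_subset[OF DERIV_continuous_on])
      show "(h has_real_derivative
        exp (- K * (r - \<alpha>)) * (2 * (w r \<bullet> w' r)) - K * exp (- K * (r - \<alpha>)) * (w r \<bullet> w r) - \<epsilon>\<^sup>2)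
          (at r within {\<alpha>..\<beta>})" if "r \<in> {\<alpha>..\<beta>}" for r
        by (rule hder[OF that])
    qed (use s in auto)
    fix r assume r: "\<alpha> < r" "r < s"
    then have r': "r \<in> {\<alpha>..\<beta>}" using s by auto
    let ?d = "exp (- K * (r - \<alpha>)) * (2 * (w r \<bullet> w' r)) - K * exp (- K * (r - \<alpha>)) * (w r \<bullet> w r) - \<epsilon>\<^sup>2"
    have "(h has_real_derivative ?d) (at r)"
      using hder[OF r'] r s by (simp add: at_within_Icc_at)
    moreover have "?d \<le> 0"
    proof -
      have "2 * (w r \<bullet> w' r) \<le> 2 * (norm (w r) * norm (w' r))"
        using norm_cauchy_schwarz[of "w r" "w' r"] by simp
      also have "\<dots> \<le> 2 * (norm (w r) * (L * norm (w r) + \<epsilon>))"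
        using bound[OF r'] by (intro mult_left_mono) auto
      also have "\<dots> \<le> K * (norm (w r))\<^sup>2 + \<epsilon>\<^sup>2"
        using sum_squares_ge_zero[of "norm (w r) - \<epsilon>" 0]
          by (simp add: K_def power2_eq_square algebra_simps)
      finally have 1: "2 * (w r \<bullet> w' r) - K * (w r \<bullet> w r) \<le> \<epsilon>\<^sup>2" by (simp add: dot_square_norm)
      have "?d = exp (- K * (r - \<alpha>)) * (2 * (w r \<bullet> w' r) - K * (w r \<bullet> w r)) - \<epsilon>\<^sup>2"
        by (simp add: algebra_simps)
      also have "\<dots> \<le> exp (- K * (r - \<alpha>)) * \<epsilon>\<^sup>2 - \<epsilon>\<^sup>2" using 1 by simp
      also have "\<dots> \<le> 1 * \<epsilon>\<^sup>2 - \<epsilon>\<^sup>2"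
      proof (intro diff_right_mono mult_right_mono)
        have "0 \<le> K * (r - \<alpha>)" using r \<open>0 \<le> L\<close> by (intro mult_nonneg_nonneg) (auto simp: K_def)
        then show "exp (- K * (r - \<alpha>)) \<le> 1" by (simp del: right_diff_distrib)
      qed simp
      finally show ?thesis by simp
    qed
    ultimately show "\<exists>y. (h has_real_derivative y) (at r) \<and> y \<le> 0" by blast
  qed
  then have "exp (- K * (s - \<alpha>)) * (norm (w s))\<^sup>2 \<le> (norm (w \<alpha>))\<^sup>2 + \<epsilon>\<^sup>2 * (s - \<alpha>)"
    by (simp add: h_def dot_square_norm)
  then have "exp (K * (s - \<alpha>)) * (exp (- (K * (s - \<alpha>))) * (norm (w s))\<^sup>2)
      \<le> exp (K * (s - \<alpha>)) * ((norm (w \<alpha>))\<^sup>2 + \<epsilon>\<^sup>2 * (s - \<alpha>))"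
    by (intro mult_left_mono) auto
  then have "(norm (w s))\<^sup>2 \<le> exp (K * (s - \<alpha>)) * ((norm (w \<alpha>))\<^sup>2 + \<epsilon>\<^sup>2 * (s - \<alpha>))"
    by (simp only: exp_minus_inverse mult.assoc[symmetric] mult_1_left)
  also have "\<dots> \<le> (exp ((L + 1) * (\<beta> - \<alpha>)))\<^sup>2 * ((1 + (\<beta> - \<alpha>)) * (norm (w \<alpha>) + \<epsilon>))\<^sup>2"
  proof (rule mult_mono)
    have "K * (s - \<alpha>) \<le> 2 * (L + 1) * (\<beta> - \<alpha>)"
      using T \<open>0 \<le> L\<close> by (intro mult_mono) (auto simp: K_def)
    then show "exp (K * (s - \<alpha>)) \<le> (exp ((L + 1) * (\<beta> - \<alpha>)))\<^sup>2"
      by (simp flip: exp_double add: algebra_simps)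
    \<comment> \<open>R dominates both 1 and s - \<alpha>, hence serves for the two summands
      alike.\<close>
    define R where "R = (1 + (\<beta> - \<alpha>))\<^sup>2"
    have R: "1 \<le> R" "s - \<alpha> \<le> R"
    proof -
      define U where "U = \<beta> - \<alpha>"
      have R: "R = 1 + U + (U + U * U)" by (simp add: R_def U_def power2_eq_square algebra_simps)
      have U: "0 \<le> U" "0 \<le> U + U * U" "s - \<alpha> \<le> U" using T by (auto simp: U_def)
      show "1 \<le> R" using U(1,2) unfolding R by linarith
      show "s - \<alpha> \<le> R" using U(2,3) unfolding R by linarith
    qed
    have "(norm (w \<alpha>))\<^sup>2 + \<epsilon>\<^sup>2 * (s - \<alpha>) \<le> (norm (w \<alpha>))\<^sup>2 * R + \<epsilon>\<^sup>2 * R"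
      using R mult_left_mono[OF R(1), of "(norm (w \<alpha>))\<^sup>2"] mult_left_mono[OF R(2), of "\<epsilon>\<^sup>2"] by simp
    also have "\<dots> = R * ((norm (w \<alpha>))\<^sup>2 + \<epsilon>\<^sup>2)" by (simp add: algebra_simps)
    also have "\<dots> \<le> R * (norm (w \<alpha>) + \<epsilon>)\<^sup>2"
      using \<open>0 \<le> \<epsilon>\<close> R by (intro mult_left_mono) (auto simp: power2_sum)
    finally show "(norm (w \<alpha>))\<^sup>2 + \<epsilon>\<^sup>2 * (s - \<alpha>) \<le> ((1 + (\<beta> - \<alpha>)) * (norm (w \<alpha>) + \<epsilon>))\<^sup>2"
      by (simp add: power_mult_distrib R_def)
  qed (use T in auto)
  also have "\<dots> = (exp ((L + 1) * (\<beta> - \<alpha>)) * (1 + (\<beta> - \<alpha>)) * (norm (w \<alpha>) + \<epsilon>))\<^sup>2"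
    by (simp add: power_mult_distrib)
  finally show ?thesis
    by (rule power2_le_imp_le) (use T \<open>0 \<le> \<epsilon>\<close> in auto)
qed

lemma has_vector_derivative_imp_continuous_on:
  "(\<And>x. x \<in> S \<Longrightarrow> (f has_vector_derivative f' x) (at x within S)) \<Longrightarrow> continuous_on S f"
  unfolding continuous_on_eq_continuous_within by (blast intro: has_vector_derivative_continuous)

lemma has_derivative_imp_has_vector_derivative:
  assumes "(f has_derivative D) F"
  shows "(f has_vector_derivative D 1) F"
proof -
  have "D h = h *\<^sub>R D 1" for h
    using linear_scale[OF has_derivative_linear[OF assms], of h 1] by simp
  then have "D = (\<lambda>h. h *\<^sub>R D 1)" by blast
  then show ?thesis using assms by (simp add: has_vector_derivative_def)
qed

text \<open>The integral operator is a contraction for the sup norm, with factor L(\<beta> -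
  \<alpha>) \<le> 1/2. Longer times are reached by chaining short intervals.\<close>

lemma picard:
  fixes h :: "real \<Rightarrow> 'a::euclidean_space \<Rightarrow> 'a"
  assumes "\<alpha> \<le> \<beta>"
    and cont: "continuous_on ({\<alpha>..\<beta>} \<times> UNIV) (\<lambda>(s, u). h s u)"
    and lip: "\<And>s u v. s \<in> {\<alpha>..\<beta>} \<Longrightarrow> norm (h s u - h s v) \<le> L * norm (u - v)"
    and "0 \<le> L" and small: "L * (\<beta> - \<alpha>) \<le> 1 / 2"
  obtains y where "y \<alpha> = z"
    and "\<And>s. s \<in> {\<alpha>..\<beta>} \<Longrightarrow> (y has_vector_derivative h s (y s)) (at s within {\<alpha>..\<beta>})"
proof -
  \<comment> \<open>Clamping the time to the interval turns curves on it into bounded continuous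
    functions on the whole real line. These form a type that is a complete metric space, so the
    fixed point theorem for types applies.\<close>
  define cl where "cl s = max \<alpha> (min \<beta> s)" for s :: real
  have cl: "cl s \<in> {\<alpha>..\<beta>}" "s \<in> {\<alpha>..\<beta>} \<Longrightarrow> cl s = s" for s using \<open>\<alpha> \<le> \<beta>\<close> by (auto simp: cl_def)
  have hu: "continuous_on {\<alpha>..\<beta>} (\<lambda>r. h r (u r))" if "continuous_on {\<alpha>..\<beta>} u" for u
    using continuous_on_compose2[OF cont continuous_on_Pair[OF continuous_on_id that]] by auto
  define Q where "Q u s = z + integral {\<alpha>..cl s} (\<lambda>r. h r (u r))" for u :: "real \<Rightarrow> 'a" and s
  have Q: "Q u \<in> bcontfun" if u: "continuous_on {\<alpha>..\<beta>} u" for u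
  proof -
    have c: "continuous_on {\<alpha>..\<beta>} (\<lambda>s. z + integral {\<alpha>..s} (\<lambda>r. h r (u r)))"
      by (intro continuous_intros indefinite_integral_continuous_1 integrable_continuous_interval hu u)
    have "continuous_on UNIV cl" unfolding cl_def by (intro continuous_intros)
    from continuous_on_compose2[OF c this] cl(1) have "continuous_on UNIV (Q u)"
      unfolding Q_def[abs_def] by blast
    moreover have "bounded (range (Q u))"
      by (rule bounded_subset[OF compact_imp_bounded[OF compact_continuous_image[OF c compact_Icc]]])
        (use cl in \<open>auto simp: Q_def\<close>)
    ultimately show ?thesis by (simp add: bcontfun_def)
  qed
  define P where "P u = Bcontfun (Q (apply_bcontfun u))" for u
  have uc: "continuous_on S (apply_bcontfun u)" for u :: "real \<Rightarrow>\<^sub>C 'a" and S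
    using apply_bcontfun[of u] by (auto simp: bcontfun_def intro: continuous_on_subset)
  have P: "apply_bcontfun (P u) = Q (apply_bcontfun u)" for u
    unfolding P_def by (rule Bcontfun_inverse[OF Q[OF uc]])
  have "\<exists>!u. P u = u"
  proof (rule banach_fix_type[of "1/2"])
    show "\<forall>u v. dist (P u) (P v) \<le> 1 / 2 * dist u v"
    proof (intro allI dist_bound)
      fix u v s
      let ?I = "{\<alpha>..cl s}"
      have sub: "?I \<subseteq> {\<alpha>..\<beta>}" using cl(1)[of s] by auto
      have ci: "continuous_on ?I (\<lambda>r. h r (apply_bcontfun u r))" for u
        using continuous_on_subset[OF hu[OF uc] sub] .
      have "dist (P u s) (P v s) = norm (integral ?I (\<lambda>r. h r (u r)) - integral ?I (\<lambda>r. h r (v r)))"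
        by (simp add: P Q_def dist_norm)
      also have "\<dots> = norm (integral ?I (\<lambda>r. h r (u r) - h r (v r)))"
        by (subst integral_diff) (auto intro: integrable_continuous_interval ci)
      also have "\<dots> \<le> (L * dist u v) * (cl s - \<alpha>)"
      proof (rule integral_bound)
        show "continuous_on ?I (\<lambda>r. h r (u r) - h r (v r))" by (intro continuous_intros ci)
        fix r assume "r \<in> ?I"
        then have "norm (h r (u r) - h r (v r)) \<le> L * dist (u r) (v r)"
          using lip sub by (auto simp: dist_norm)
        also have "\<dots> \<le> L * dist u v" using \<open>0 \<le> L\<close> dist_bounded[of u r v] by (intro mult_left_mono)
        finally show "norm (h r (u r) - h r (v r)) \<le> L * dist u v" .
      qed (use cl in auto)
      also have "\<dots> \<le> (L * dist u v) * (\<beta> - \<alpha>)"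
        using cl(1)[of s] \<open>0 \<le> L\<close> by (intro mult_left_mono) auto
      also have "\<dots> = (L * (\<beta> - \<alpha>)) * dist u v" by simp
      also have "\<dots> \<le> 1 / 2 * dist u v" using small by (intro mult_right_mono) auto
      finally show "dist (P u s) (P v s) \<le> 1 / 2 * dist u v" .
    qed
  qed auto
  then obtain u where u: "P u = u" by blast
  have fixpt: "u s = z + integral {\<alpha>..s} (\<lambda>r. h r (u r))" if "s \<in> {\<alpha>..\<beta>}" for s
    using P[of u] cl(2)[OF that] unfolding u by (metis Q_def)
  show thesis
  proof (rule that[of "apply_bcontfun u"])
    show "u \<alpha> = z" using fixpt[of \<alpha>] \<open>\<alpha> \<le> \<beta>\<close> by simp
    fix s assume s: "s \<in> {\<alpha>..\<beta>}"
    have "((\<lambda>s. integral {\<alpha>..s} (\<lambda>r. h r (u r))) has_vector_derivative h s (u s)) (at s within {\<alpha>..\<beta>})"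
      by (rule integral_has_vector_derivative[OF hu[OF uc] s])
    then have "((\<lambda>s. z + integral {\<alpha>..s} (\<lambda>r. h r (u r))) has_vector_derivative h s (u s)) (at s within {\<alpha>..\<beta>})"
      by (auto intro!: derivative_eq_intros)
    then show "(u has_vector_derivative h s (u s)) (at s within {\<alpha>..\<beta>})"
      by (rule has_vector_derivative_transform[OF s, rotated]) (simp add: fixpt)
  qed
qed

text \<open>For h = \<tau> - t the defect w = x s \<tau> - x s t - h y s satisfies w' = D w up to an
  error that is small against |h| + |w|, and its initial value is o(h). Gronwall then makes w itself
  o(h). In this abstract form, with the linearisation error bounded by \<open>est\<close>, the lemma
  serves both the nonlinear flow and the linear equations of its higher derivatives.\<close>

lemma parameter_derivative:
  fixes x X' :: "real \<Rightarrow> real \<Rightarrow> 'a::euclidean_space"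
  assumes t: "t \<in> J"
    and der: "\<And>s \<tau>. s \<in> {\<alpha>..\<beta>} \<Longrightarrow> \<tau> \<in> J \<Longrightarrow>
        ((\<lambda>s. x s \<tau>) has_vector_derivative X' s \<tau>) (at s within {\<alpha>..\<beta>})"
    and init: "(x \<alpha> has_vector_derivative y \<alpha>) (at t within J)"
    and y: "\<And>s. s \<in> {\<alpha>..\<beta>} \<Longrightarrow> (y has_vector_derivative D s (y s) + c s) (at s within {\<alpha>..\<beta>})"
    and D: "\<And>s. linear (D s)" "\<And>s v. norm (D s v) \<le> L * norm v" and L: "0 \<le> L"
    and est: "\<And>\<epsilon>. 0 < \<epsilon> \<Longrightarrow> \<exists>\<delta>>0. \<forall>\<tau>\<in>J. \<bar>\<tau> - t\<bar> < \<delta> \<longrightarrow> (\<forall>s\<in>{\<alpha>..\<beta>}.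
        norm (X' s \<tau> - X' s t - D s (x s \<tau> - x s t) - (\<tau> - t) *\<^sub>R c s)
          \<le> \<epsilon> * (\<bar>\<tau> - t\<bar> + norm (x s \<tau> - x s t)))"
    and s: "s \<in> {\<alpha>..\<beta>}"
  shows "(x s has_vector_derivative y s) (at t within J)"
proof -
  have "continuous_on {\<alpha>..\<beta>} y"
    by (rule has_vector_derivative_imp_continuous_on[OF y])
  then have "bounded (y ` {\<alpha>..\<beta>})" by (intro compact_imp_bounded compact_continuous_image) auto
  then obtain Y where Y: "0 < Y" "\<And>s. s \<in> {\<alpha>..\<beta>} \<Longrightarrow> norm (y s) \<le> Y"
    unfolding bounded_pos by auto
  define G where "G = exp ((L + 1 + 1) * (\<beta> - \<alpha>)) * (1 + (\<beta> - \<alpha>))"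
  have G: "0 < G" using s by (auto simp: G_def)
  show ?thesis
    unfolding has_vector_derivative_def has_derivative_within_alt
  proof (intro conjI allI impI)
    show "bounded_linear (\<lambda>h. h *\<^sub>R y s)" by (rule bounded_linear_scaleR_left)
    fix e :: real assume "0 < e"
    \<comment> \<open>The bound 1 lets \<eta>|w| be absorbed by raising L to L + 1. In the other
      bound G is Gronwall's constant, and 2 + Y collects \<eta>|h| from the initial values and
      \<eta>|h|(1 + Y) from the equation.\<close>
    define \<eta> where "\<eta> = min 1 (e / (G * (2 + Y)))"
    have \<eta>: "0 < \<eta>" "\<eta> \<le> 1" "G * (\<eta> * (2 + Y)) \<le> e"
    proof -
      show "0 < \<eta>" "\<eta> \<le> 1" using \<open>0 < e\<close> G Y by (auto simp: \<eta>_def)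
      have "\<eta> * (G * (2 + Y)) \<le> e / (G * (2 + Y)) * (G * (2 + Y))"
        using G Y by (intro mult_right_mono) (auto simp: \<eta>_def)
      then show "G * (\<eta> * (2 + Y)) \<le> e" using G Y by (simp add: mult_ac)
    qed
    obtain \<delta>1 where \<delta>1: "0 < \<delta>1" "\<And>\<tau> s. \<tau> \<in> J \<Longrightarrow> \<bar>\<tau> - t\<bar> < \<delta>1 \<Longrightarrow> s \<in> {\<alpha>..\<beta>} \<Longrightarrow>
        norm (X' s \<tau> - X' s t - D s (x s \<tau> - x s t) - (\<tau> - t) *\<^sub>R c s) \<le> \<eta> * (\<bar>\<tau> - t\<bar> + norm (x s \<tau> - x s t))"
      using est[OF \<eta>(1)] by blast
    obtain \<delta>2 where \<delta>2: "0 < \<delta>2" "\<And>\<tau>. \<tau> \<in> J \<Longrightarrow> \<bar>\<tau> - t\<bar> < \<delta>2 \<Longrightarrow>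
        norm (x \<alpha> \<tau> - x \<alpha> t - (\<tau> - t) *\<^sub>R y \<alpha>) \<le> \<eta> * \<bar>\<tau> - t\<bar>"
      using init \<eta>(1) unfolding has_vector_derivative_def has_derivative_within_alt real_norm_def
        by blast
    show "\<exists>d>0. \<forall>\<tau>\<in>J. norm (\<tau> - t) < d \<longrightarrow> norm (x s \<tau> - x s t - (\<tau> - t) *\<^sub>R y s) \<le> e * norm (\<tau> - t)"
    proof (intro exI[of _ "min \<delta>1 \<delta>2"] conjI ballI impI)
      show "0 < min \<delta>1 \<delta>2" using \<delta>1 \<delta>2 by simp
      fix \<tau> assume \<tau>: "\<tau> \<in> J" "norm (\<tau> - t) < min \<delta>1 \<delta>2"
      define h where "h = \<tau> - t"
      define w where "w s = x s \<tau> - x s t - h *\<^sub>R y s" for s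
      define w' where "w' s = X' s \<tau> - X' s t - h *\<^sub>R (D s (y s) + c s)" for s
      have "norm (w s) \<le> exp ((L + 1 + 1) * (\<beta> - \<alpha>)) * (1 + (\<beta> - \<alpha>)) * (norm (w \<alpha>) + \<eta> * \<bar>h\<bar> * (1 + Y))"
      proof (rule gronwall[OF _ _ _ _ s])
        fix r assume r: "r \<in> {\<alpha>..\<beta>}"
        show "(w has_vector_derivative w' r) (at r within {\<alpha>..\<beta>})"
          unfolding w_def w'_def
          by (intro has_vector_derivative_diff der r \<tau> t
              bounded_linear.has_vector_derivative[OF bounded_linear_scaleR_right] y)
        have lin: "D r (x r \<tau> - x r t) = D r (w r) + h *\<^sub>R D r (y r)"
          using D(1)[of r] by (simp add: w_def linear_diff linear_scale)
        have "norm (w' r) = norm (D r (w r) + (X' r \<tau> - X' r t - D r (x r \<tau> - x r t) - h *\<^sub>R c r))"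
          by (simp add: lin w'_def algebra_simps)
        also have "\<dots> \<le> L * norm (w r) + \<eta> * (\<bar>h\<bar> + norm (x r \<tau> - x r t))"
          using D(2)[of r "w r"] \<delta>1(2)[of \<tau> r] \<tau> r unfolding h_def
          by (intro norm_triangle_le add_mono) auto
        also have "norm (x r \<tau> - x r t) \<le> norm (w r) + \<bar>h\<bar> * Y"
        proof -
          have "x r \<tau> - x r t = w r + h *\<^sub>R y r" by (simp add: w_def)
          then have "norm (x r \<tau> - x r t) \<le> norm (w r) + \<bar>h\<bar> * norm (y r)"
            by (metis norm_scaleR norm_triangle_ineq)
          also have "\<dots> \<le> norm (w r) + \<bar>h\<bar> * Y" using Y(2)[OF r]
            by (intro add_left_mono mult_left_mono) auto
          finally show ?thesis .
        qed
        finally have "norm (w' r) \<le> L * norm (w r) + \<eta> * (\<bar>h\<bar> + (norm (w r) + \<bar>h\<bar> * Y))"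
          using \<eta>(1) by (simp add: mult_left_mono)
        also have "\<dots> = L * norm (w r) + \<eta> * norm (w r) + \<eta> * \<bar>h\<bar> * (1 + Y)" by (simp add: algebra_simps)
        also have "\<eta> * norm (w r) \<le> 1 * norm (w r)" using \<eta> by (intro mult_right_mono) auto
        finally show "norm (w' r) \<le> (L + 1) * norm (w r) + \<eta> * \<bar>h\<bar> * (1 + Y)"
          by (simp add: algebra_simps)
      qed (use L \<eta> Y in auto)
      also have "\<dots> = G * (norm (w \<alpha>) + \<eta> * \<bar>h\<bar> * (1 + Y))" by (simp add: G_def)
      also have "\<dots> \<le> G * (\<eta> * \<bar>h\<bar> + \<eta> * \<bar>h\<bar> * (1 + Y))"
        using \<delta>2(2)[of \<tau>] \<tau> G by (intro mult_left_mono add_right_mono) (auto simp: w_def h_def)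
      also have "\<dots> = G * (\<eta> * (2 + Y)) * \<bar>h\<bar>" by (simp add: algebra_simps)
      also have "\<dots> \<le> e * \<bar>h\<bar>" using \<eta>(3) by (intro mult_right_mono) auto
      finally show "norm (x s \<tau> - x s t - (\<tau> - t) *\<^sub>R y s) \<le> e * norm (\<tau> - t)"
        by (simp add: w_def h_def)
    qed
  qed
qed

section \<open>Families of curves with one parameter: uniformity over a compact time
  interval\<close>

lemma uniform_parameter_continuity:
  fixes u :: "real \<Rightarrow> real \<Rightarrow> 'a::real_normed_vector"
  assumes c: "continuous_on (I \<times> J) (\<lambda>(s, t). u s t)" and "compact I" "t \<in> J" "0 < \<epsilon>"
  obtains \<delta> where "0 < \<delta>" "\<And>\<tau> s. \<tau> \<in> J \<Longrightarrow> \<bar>\<tau> - t\<bar> < \<delta> \<Longrightarrow> s \<in> I \<Longrightarrow> norm (u s \<tau> - u s t) \<le> \<epsilon>"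
proof -
  have "continuous_on (J \<times> I) (\<lambda>(t, s). u s t)"
    using continuous_on_compose2[OF c continuous_on_swap[of "J \<times> I"]]
    by (simp add: case_prod_unfold product_swap)
  from continuous_on_prod_compactE[OF this \<open>compact I\<close> \<open>t \<in> J\<close> \<open>0 < \<epsilon>\<close>]
  obtain X0 where X0: "t \<in> X0" "open X0" "\<forall>x\<in>X0 \<inter> J. \<forall>s\<in>I. dist (u s x) (u s t) \<le> \<epsilon>" by auto
  then obtain \<delta> where "0 < \<delta>" "ball t \<delta> \<subseteq> X0" by (meson openE)
  then show thesis using X0 by (intro that[of \<delta>]) (auto simp: dist_norm abs_minus_commute subset_eq)
qed

text \<open>Mean value inequality for \<open>u s\<close> minus its linearisation at t. By the
  preceding lemma the variation of \<open>u'\<close> near t is small uniformly in s, and convexity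
  keeps the segment from t to \<tau> in J.\<close>

lemma uniform_parameter_differentiability:
  fixes u u' :: "real \<Rightarrow> real \<Rightarrow> 'a::real_normed_vector"
  assumes c: "continuous_on (I \<times> J) (\<lambda>(s, t). u' s t)" and "compact I" "convex J" "t \<in> J" "0 < \<epsilon>"
    and der: "\<And>s t. s \<in> I \<Longrightarrow> t \<in> J \<Longrightarrow> (u s has_vector_derivative u' s t) (at t within J)"
  obtains \<delta> where "0 < \<delta>"
    "\<And>\<tau> s. \<tau> \<in> J \<Longrightarrow> \<bar>\<tau> - t\<bar> < \<delta> \<Longrightarrow> s \<in> I \<Longrightarrow> norm (u s \<tau> - u s t - (\<tau> - t) *\<^sub>R u' s t) \<le> \<epsilon> * \<bar>\<tau> - t\<bar>"
proof -
  obtain \<delta> where \<delta>: "0 < \<delta>" "\<And>\<tau> s. \<tau> \<in> J \<Longrightarrow> \<bar>\<tau> - t\<bar> < \<delta> \<Longrightarrow> s \<in> I \<Longrightarrow> norm (u' s \<tau> - u' s t) \<le> \<epsilon>"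
    using uniform_parameter_continuity[OF c \<open>compact I\<close> \<open>t \<in> J\<close> \<open>0 < \<epsilon>\<close>] by blast
  show thesis
  proof (rule that[OF \<delta>(1)])
    fix \<tau> s assume \<tau>: "\<tau> \<in> J" "\<bar>\<tau> - t\<bar> < \<delta>" and s: "s \<in> I"
    let ?S = "J \<inter> ball t \<delta>"
    have "norm (u s \<tau> - u s t - (\<tau> - t) *\<^sub>R u' s t) \<le> norm (\<tau> - t) * \<epsilon>"
    proof (rule vector_differentiable_bound_linearization[where S = ?S])
      show "(u s has_vector_derivative u' s r) (at r within ?S)" if "r \<in> ?S" for r
        using der[OF s] that by (auto intro: has_vector_derivative_within_subset)
      show "closed_segment t \<tau> \<subseteq> ?S"
        using \<tau> \<open>t \<in> J\<close> \<delta>(1) \<open>convex J\<close>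
        by (intro closed_segment_subset convex_Int) (auto simp: dist_norm abs_minus_commute)
      show "norm (u' s r - u' s t) \<le> \<epsilon>" if "r \<in> ?S" for r
        using \<delta>(2)[of r s] that s by (auto simp: dist_norm abs_minus_commute)
    qed (use \<open>t \<in> J\<close> \<delta> in auto)
    then show "norm (u s \<tau> - u s t - (\<tau> - t) *\<^sub>R u' s t) \<le> \<epsilon> * \<bar>\<tau> - t\<bar>" by (simp add: mult.commute)
  qed
qed

lemma continuous_on_parameterI:
  fixes u :: "real \<Rightarrow> real \<Rightarrow> 'a::real_normed_vector"
  assumes "\<And>t. t \<in> J \<Longrightarrow> continuous_on I (\<lambda>s. u s t)"
    and "\<And>t \<epsilon>. t \<in> J \<Longrightarrow> 0 < \<epsilon> \<Longrightarrow> \<exists>\<delta>>0. \<forall>\<tau>\<in>J. \<bar>\<tau> - t\<bar> < \<delta> \<longrightarrow> (\<forall>s\<in>I. norm (u s \<tau> - u s t) \<le> \<epsilon>)"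
  shows "continuous_on (I \<times> J) (\<lambda>(s, t). u s t)"
  unfolding continuous_on_iff
proof (intro ballI allI impI)
  fix p0 and e :: real assume p0: "p0 \<in> I \<times> J" and "0 < e"
  then obtain s t where st: "s \<in> I" "t \<in> J" and [simp]: "p0 = (s, t)" by blast
  have "0 < e / 3" using \<open>0 < e\<close> by simp
  then obtain d1 where d1: "d1 > 0" "\<And>r. r \<in> I \<Longrightarrow> dist r s < d1 \<Longrightarrow> dist (u r t) (u s t) < e / 3"
    using assms(1)[OF st(2)] st(1) unfolding continuous_on_iff by meson
  obtain d2 where d2: "d2 > 0" "\<And>\<tau> s. \<tau> \<in> J \<Longrightarrow> \<bar>\<tau> - t\<bar> < d2 \<Longrightarrow> s \<in> I \<Longrightarrow> norm (u s \<tau> - u s t) \<le> e / 3"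
    using assms(2)[OF st(2) \<open>0 < e / 3\<close>] by blast
  show "\<exists>d>0. \<forall>x'\<in>I \<times> J. dist x' p0 < d \<longrightarrow>
      dist (case x' of (s, t) \<Rightarrow> u s t) (case p0 of (s, t) \<Rightarrow> u s t) < e"
  proof (intro exI[of _ "min d1 d2"] conjI ballI impI)
    fix p assume p: "p \<in> I \<times> J" "dist p p0 < min d1 d2"
    obtain r \<tau> where [simp]: "p = (r, \<tau>)" by fastforce
    have "dist r s < d1" "dist \<tau> t < d2"
      using p dist_fst_le[of p "(s, t)"] dist_snd_le[of p "(s, t)"] by auto
    then have "dist (u r t) (u s t) < e / 3" "dist (u r \<tau>) (u r t) \<le> e / 3"
      using p d1(2)[of r] d2(2)[of \<tau> r] by (auto simp: dist_norm)
    then show "dist (case p of (s, t) \<Rightarrow> u s t) (case p0 of (s, t) \<Rightarrow> u s t) < e"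
      using dist_triangle[of "u r \<tau>" "u s t" "u r t"] \<open>0 < e\<close> by simp
  qed (use d1 d2 in auto)
qed

text \<open>Derivatives are taken in the parameter t only, but each has to be continuous jointly
  with the time s: over a compact time interval this yields the uniformity in s that differentiating
  a solution requires. Any function with the right property may serve as derivative, so that
  solutions of the differentiated equation can be used directly.\<close>

primrec C_k_param ::
    "nat \<Rightarrow> real set \<Rightarrow> real set \<Rightarrow> (real \<Rightarrow> real \<Rightarrow> 'a::real_normed_vector) \<Rightarrow> bool" where
  "C_k_param 0 I J u \<longleftrightarrow> continuous_on (I \<times> J) (\<lambda>(s, t). u s t)"
| "C_k_param (Suc k) I J u \<longleftrightarrow> continuous_on (I \<times> J) (\<lambda>(s, t). u s t) \<and>
     (\<exists>u'. (\<forall>s\<in>I. \<forall>t\<in>J. (u s has_vector_derivative u' s t) (at t within J)) \<and> C_k_param k I J u')"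

lemma C_k_param_imp_continuous: "C_k_param k I J u \<Longrightarrow> continuous_on (I \<times> J) (\<lambda>(s, t). u s t)"
  by (cases k) auto

lemma C_k_param_Suc_imp: "C_k_param (Suc k) I J u \<Longrightarrow> C_k_param k I J u"
proof (induction k arbitrary: u)
  case (Suc k)
  from Suc.prems obtain u' where "continuous_on (I \<times> J) (\<lambda>(s, t). u s t)"
    "\<forall>s\<in>I. \<forall>t\<in>J. (u s has_vector_derivative u' s t) (at t within J)" "C_k_param (Suc k) I J u'"
    unfolding C_k_param.simps(2)[of "Suc k"] by blast
  with Suc.IH[of u'] show ?case unfolding C_k_param.simps(2)[of k] by blast
qed simp

lemma C_k_param_slice:
  "thick J \<Longrightarrow> s \<in> I \<Longrightarrow> C_k_param k I J u \<Longrightarrow> C_k_on k J (u s)"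
proof (induction k arbitrary: u)
  case 0
  then show ?case
  proof -
    have "continuous_on J (Pair s)" by (intro continuous_intros)
    from continuous_on_compose2[OF _ this, of "I \<times> J" "\<lambda>(s, t). u s t"] 0 show ?thesis by auto
  qed
next
  case (Suc k)
  then obtain u' where u': "\<forall>s\<in>I. \<forall>t\<in>J. (u s has_vector_derivative u' s t) (at t within J)"
    "C_k_param k I J u'"
    by auto
  have "C_k_on k J (u' s)" using Suc u' by blast
  then have "C_k_on k J (\<lambda>t. v *\<^sub>R u' s t)" for v
    by (intro C_k_on_scaleR C_k_on_const Suc.prems(1))
  then show ?case
    using u'(1) Suc.prems(2)
    by (intro C_k_on_SucI[OF Suc.prems(1), where f' =
      "\<lambda>t v. v *\<^sub>R u' s t"]) (auto simp: has_vector_derivative_def)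
qed

lemma C_k_param_add:
  "C_k_param k I J u \<Longrightarrow> C_k_param k I J v \<Longrightarrow> C_k_param k I J (\<lambda>s t. u s t + v s t)"
proof (induction k arbitrary: u v)
  case 0
  then show ?case by (auto simp: case_prod_unfold intro: continuous_intros)
next
  case (Suc k)
  then obtain u' v' where
    "\<forall>s\<in>I. \<forall>t\<in>J. (u s has_vector_derivative u' s t) (at t within J)" "C_k_param k I J u'"
    "\<forall>s\<in>I. \<forall>t\<in>J. (v s has_vector_derivative v' s t) (at t within J)" "C_k_param k I J v'"
    by auto
  with Suc show ?case
    by (auto simp: case_prod_unfold intro!: continuous_intros exI[of _
      "\<lambda>s t. u' s t + v' s t"] has_vector_derivative_add)
qed

lemma C_k_param_zero: "C_k_param k I J (\<lambda>s t. 0)"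
  by (induction k) (auto intro: exI[of _ "\<lambda>s t. 0"])

lemma C_k_param_sum:
  "(\<And>i. i \<in> B \<Longrightarrow> C_k_param k I J (u i)) \<Longrightarrow> C_k_param k I J (\<lambda>s t. \<Sum>i\<in>B. u i s t)"
  by (induction B rule: infinite_finite_induct) (auto intro: C_k_param_add C_k_param_zero)

lemma C_k_param_inner: "C_k_param k I J u \<Longrightarrow> C_k_param k I J (\<lambda>s t. u s t \<bullet> i)"
proof (induction k arbitrary: u)
  case 0
  then show ?case by (auto simp: case_prod_unfold intro: continuous_intros)
next
  case (Suc k)
  then obtain u' where
    "\<forall>s\<in>I. \<forall>t\<in>J. (u s has_vector_derivative u' s t) (at t within J)" "C_k_param k I J u'"
    by auto
  with Suc show ?case
    by (auto simp: case_prod_unfold intro!: continuous_intros exI[of _ "\<lambda>s t. u' s t \<bullet> i"]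
        bounded_linear.has_vector_derivative[OF bounded_linear_inner_left])
qed

lemma C_k_param_scaleR:
  "C_k_param k I J u \<Longrightarrow> C_k_param k I J v \<Longrightarrow> C_k_param k I J (\<lambda>s t. u s t *\<^sub>R v s t)"
proof (induction k arbitrary: u v)
  case 0
  then show ?case by (auto simp: case_prod_unfold intro: continuous_intros)
next
  case (Suc k)
  then obtain u' v' where
    uv: "\<forall>s\<in>I. \<forall>t\<in>J. (u s has_vector_derivative u' s t) (at t within J)" "C_k_param k I J u'"
    "\<forall>s\<in>I. \<forall>t\<in>J. (v s has_vector_derivative v' s t) (at t within J)" "C_k_param k I J v'"
    by auto
  have "C_k_param k I J u" "C_k_param k I J v" using Suc.prems C_k_param_Suc_imp by blast+
  then have "C_k_param k I J (\<lambda>s t. u s t *\<^sub>R v' s t + u' s t *\<^sub>R v s t)"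
    using uv by (intro C_k_param_add Suc.IH)
  moreover have "((\<lambda>t. u s t *\<^sub>R v s t) has_vector_derivative u s t *\<^sub>R v' s t + u' s t *\<^sub>R v s t) (at t within J)"
    if "s \<in> I" "t \<in> J" for s t
    using uv that by (intro has_vector_derivative_scaleR) (auto simp: has_real_derivative_iff_has_vector_derivative)
  ultimately show ?case
    using Suc.prems by (auto simp: case_prod_unfold intro!: continuous_intros
        exI[of _ "\<lambda>s t. u s t *\<^sub>R v' s t + u' s t *\<^sub>R v s t"])
qed

lemma C_k_param_apply:
  fixes D :: "real \<Rightarrow> real \<Rightarrow> 'a::euclidean_space \<Rightarrow> 'b::real_normed_vector"
  assumes "\<And>s t. linear (D s t)" "\<And>v. C_k_param k I J (\<lambda>s t. D s t v)" "C_k_param k I J u"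
  shows "C_k_param k I J (\<lambda>s t. D s t (u s t))"
proof -
  have "C_k_param k I J (\<lambda>s t. \<Sum>i\<in>Basis. (u s t \<bullet> i) *\<^sub>R D s t i)"
    by (intro C_k_param_sum C_k_param_scaleR C_k_param_inner assms)
  then show ?thesis by (simp add: linear_sum_Basis[OF assms(1), symmetric])
qed

text \<open>The \<open>t\<close>-derivative of a solution solves the linear equation with the same operators \<open>D s t\<close> and
  an inhomogeneity that is only as regular as the solution itself; hence the induction on the order
  of differentiability stays within this class of equations.\<close>

lemma linear_ode_C_k_param:
  fixes y :: "real \<Rightarrow> real \<Rightarrow> 'a::euclidean_space"
  assumes J: "convex J" "thick J" and ab: "\<alpha> \<le> \<beta>"
    and D: "\<And>s t. linear (D s t)" "\<And>s t v. norm (D s t v) \<le> L * norm v"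
    and L: "0 \<le> L" "L * (\<beta> - \<alpha>) \<le> 1 / 2"
  shows "(\<And>v. C_k_param k {\<alpha>..\<beta>} J (\<lambda>s t. D s t v)) \<Longrightarrow> C_k_param k {\<alpha>..\<beta>} J b \<Longrightarrow> C_k_on k J (y \<alpha>) \<Longrightarrow>
    (\<And>s t. s \<in> {\<alpha>..\<beta>} \<Longrightarrow> t \<in> J \<Longrightarrow>
      ((\<lambda>s. y s t) has_vector_derivative D s t (y s t) + b s t) (at s within {\<alpha>..\<beta>})) \<Longrightarrow>
    C_k_param k {\<alpha>..\<beta>} J y"
proof (induction k arbitrary: b y)
  case 0
  have ys: "continuous_on {\<alpha>..\<beta>} (\<lambda>s. y s t)" if "t \<in> J" for t
    by (rule has_vector_derivative_imp_continuous_on[OF 0(4)[OF _ that]])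
  define G where "G = exp ((L + 1) * (\<beta> - \<alpha>)) * (1 + (\<beta> - \<alpha>))"
  have G: "0 < G" using ab by (auto simp: G_def intro!: mult_pos_pos)
  have "continuous_on ({\<alpha>..\<beta>} \<times> J) (\<lambda>(s, t). y s t)"
  proof (rule continuous_on_parameterI[OF ys])
    fix t and \<epsilon> :: real assume t: "t \<in> J" and "0 < \<epsilon>"
    \<comment> \<open>The right-hand side with the solution frozen at parameter t. The equations at
      \<tau> and t differ by D s \<tau> applied to the difference of the solutions plus p s \<tau> -
      p s t, and the latter is small uniformly in s.\<close>
    define p where "p s \<tau> = D s \<tau> (y s t) + b s \<tau>" for s \<tau>
    have "C_k_param 0 {\<alpha>..\<beta>} J (\<lambda>s \<tau>. y s t)"
    proof -
      have "continuous_on ({\<alpha>..\<beta>} \<times> J) (\<lambda>x. y (fst x) t)"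
        by (rule continuous_on_compose2[OF ys[OF t] continuous_on_fst[OF continuous_on_id]]) auto
      then show ?thesis by (simp add: case_prod_unfold)
    qed
    then have "C_k_param 0 {\<alpha>..\<beta>} J p"
      unfolding p_def[abs_def] by (intro C_k_param_add C_k_param_apply[OF D(1) 0(1)] 0(2))
    then have pc: "continuous_on ({\<alpha>..\<beta>} \<times> J) (\<lambda>(s, t). p s t)" by simp
    have \<eta>: "0 < \<epsilon> / (2 * G)" using G \<open>0 < \<epsilon>\<close> by simp
    obtain \<delta>1 where \<delta>1: "0 < \<delta>1"
      "\<And>\<tau> s. \<tau> \<in> J \<Longrightarrow> \<bar>\<tau> - t\<bar> < \<delta>1 \<Longrightarrow> s \<in> {\<alpha>..\<beta>} \<Longrightarrow> norm (p s \<tau> - p s t) \<le> \<epsilon> / (2 * G)"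
      using uniform_parameter_continuity[OF pc compact_Icc t \<eta>] by blast
    obtain \<delta>2 where \<delta>2: "0 < \<delta>2" "\<And>\<tau>. \<tau> \<in> J \<Longrightarrow> dist \<tau> t < \<delta>2 \<Longrightarrow> dist (y \<alpha> \<tau>) (y \<alpha> t) < \<epsilon> / (2 * G)"
      using 0(3) t \<eta> unfolding C_k_on.simps continuous_on_iff by meson
    show "\<exists>\<delta>>0. \<forall>\<tau>\<in>J. \<bar>\<tau> - t\<bar> < \<delta> \<longrightarrow> (\<forall>s\<in>{\<alpha>..\<beta>}. norm (y s \<tau> - y s t) \<le> \<epsilon>)"
    proof (intro exI[of _ "min \<delta>1 \<delta>2"] conjI ballI impI)
      fix \<tau> s assume \<tau>: "\<tau> \<in> J" "\<bar>\<tau> - t\<bar> < min \<delta>1 \<delta>2" and s: "s \<in> {\<alpha>..\<beta>}"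
      have "norm (y s \<tau> - y s t) \<le> exp ((L + 1) * (\<beta> - \<alpha>)) * (1 + (\<beta> - \<alpha>)) * (norm (y \<alpha> \<tau> - y \<alpha> t) + \<epsilon> / (2 * G))"
      proof (rule gronwall[OF _ _ _ _ s])
        fix r assume r: "r \<in> {\<alpha>..\<beta>}"
        show "((\<lambda>s. y s \<tau> - y s t) has_vector_derivative (D r \<tau> (y r \<tau>) + b r \<tau>) - (D r t (y r t) + b r t)) (at r within {\<alpha>..\<beta>})"
          by (intro has_vector_derivative_diff 0(4) r \<tau> t)
        have "(D r \<tau> (y r \<tau>) + b r \<tau>) - (D r t (y r t) + b r t) = D r \<tau> (y r \<tau> - y r t) + (p r \<tau> - p r t)"
          using D(1)[of r \<tau>] by (simp add: p_def linear_diff)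
        moreover have "norm (D r \<tau> (y r \<tau> - y r t) + (p r \<tau> - p r t)) \<le> L * norm (y r \<tau> - y r t) + \<epsilon> / (2 * G)"
          using D(2) \<delta>1(2)[of \<tau> r] \<tau> r by (intro norm_triangle_le add_mono) auto
        ultimately show "norm ((D r \<tau> (y r \<tau>) + b r \<tau>) - (D r t (y r t) + b r t)) \<le> L * norm (y r \<tau> - y r t) + \<epsilon> / (2 * G)"
          by simp
      qed (use L \<eta> in auto)
      also have "\<dots> = G * (norm (y \<alpha> \<tau> - y \<alpha> t) + \<epsilon> / (2 * G))" by (simp add: G_def)
      also have "\<dots> \<le> G * (\<epsilon> / (2 * G) + \<epsilon> / (2 * G))"
        using \<delta>2(2)[of \<tau>] \<tau> G by (intro mult_left_mono add_right_mono) (auto simp: dist_norm)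
      also have "\<dots> = \<epsilon>" using G by simp
      finally show "norm (y s \<tau> - y s t) \<le> \<epsilon>" .
    qed (use \<delta>1 \<delta>2 in auto)
  qed
  then show ?case by simp
next
  case (Suc k)
  let ?I = "{\<alpha>..\<beta>}"
  have Dk: "C_k_param k ?I J (\<lambda>s t. D s t v)" for v using Suc.prems(1) C_k_param_Suc_imp by blast
  have yk: "C_k_param k ?I J y"
    by (rule Suc.IH[OF Dk C_k_param_Suc_imp[OF Suc.prems(2)] C_k_on_Suc_imp[OF Suc.prems(3)] Suc.prems(4)])
  have "\<forall>i. \<exists>d. (\<forall>s\<in>?I. \<forall>t\<in>J. ((\<lambda>t. D s t i) has_vector_derivative d s t) (at t within J)) \<and> C_k_param k ?I J d"
    using Suc.prems(1) by simp
  from choice[OF this] obtain d where d: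
    "\<And>i s t. s \<in> ?I \<Longrightarrow> t \<in> J \<Longrightarrow> ((\<lambda>t. D s t i) has_vector_derivative d i s t) (at t within J)"
    "\<And>i. C_k_param k ?I J (d i)"
    by blast
  obtain b' where b': "\<And>s t. s \<in> ?I \<Longrightarrow> t \<in> J \<Longrightarrow> (b s has_vector_derivative b' s t) (at t within J)"
    "C_k_param k ?I J b'"
    using Suc.prems(2) unfolding C_k_param.simps by blast
  \<comment> \<open>Inhomogeneity of the differentiated equation, namely the t-derivative of D
    applied to y plus that of b; \<open>d i\<close> is the derivative of D at the basis vector i. It
    is C^k because y is already known to be C^k.\<close>
  define c where "c s t = (\<Sum>i\<in>Basis. (y s t \<bullet> i) *\<^sub>R d i s t) + b' s t" for s t
  have ck: "C_k_param k ?I J c"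
    unfolding c_def[abs_def]
      by (intro C_k_param_add C_k_param_sum C_k_param_scaleR C_k_param_inner yk d(2) b'(2))
  define y0' where "y0' t = frechet_derivative (y \<alpha>) (at t within J) 1" for t
  have y0': "(y \<alpha> has_vector_derivative y0' t) (at t within J)" if "t \<in> J" for t
    unfolding y0'_def by (rule has_derivative_imp_has_vector_derivative[OF C_k_on_SucD[OF Suc.prems(3) that]])
  have slice: "continuous_on ?I (\<lambda>s. u s t)" if "continuous_on (?I \<times> J) (\<lambda>(s, t). u s t)" "t \<in> J"
    for u :: "real \<Rightarrow> real \<Rightarrow> 'a" and t
  proof -
    have "continuous_on ?I (\<lambda>s. (s, t))" by (intro continuous_intros)
    from continuous_on_compose2[OF that(1) this] that(2) show ?thesis by auto
  qed
  \<comment> \<open>Candidate for the t-derivative: the solution of the differentiated equation that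
    starts at the derivative of the initial values.\<close>
  have "\<exists>z. z \<alpha> = y0' t \<and> (\<forall>s\<in>?I. (z has_vector_derivative D s t (z s) + c s t) (at s within ?I))" if
    "t \<in> J" for t
  proof -
    have "continuous_on (?I \<times> UNIV) (\<lambda>x. (\<Sum>i\<in>Basis. (snd x \<bullet> i) *\<^sub>R D (fst x) t i) + c (fst x) t)"
    proof (intro continuous_intros)
      fix i :: 'a
      show "continuous_on (?I \<times> (UNIV::'a set)) (\<lambda>x. D (fst x) t i)"
        by (rule continuous_on_compose2[OF slice[OF C_k_param_imp_continuous[OF Dk] that] continuous_on_fst[OF continuous_on_id]]) auto
    next
      show "continuous_on (?I \<times> (UNIV::'a set)) (\<lambda>x. c (fst x) t)"
        by (rule continuous_on_compose2[OF slice[OF C_k_param_imp_continuous[OF ck] that] continuous_on_fst[OF continuous_on_id]]) auto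
    qed
    then have hc: "continuous_on (?I \<times> UNIV) (\<lambda>(s, u). D s t u + c s t)"
      by (simp add: case_prod_unfold linear_sum_Basis[OF D(1), symmetric])
    have hl: "norm ((D s t u + c s t) - (D s t v + c s t)) \<le> L * norm (u - v)" for s u v
      using D(2)[of s t "u - v"] by (simp add: linear_diff[OF D(1)])
    from picard[OF ab hc hl L, of "y0' t"] show ?thesis by metis
  qed
  then obtain z where z: "\<And>t. t \<in> J \<Longrightarrow> z t \<alpha> = y0' t"
    "\<And>t s. t \<in> J \<Longrightarrow> s \<in> ?I \<Longrightarrow> (z t has_vector_derivative D s t (z t s) + c s t) (at s within ?I)"
    by metis
  have "C_k_param k ?I J (\<lambda>s t. z t s)"
  proof (rule Suc.IH[OF Dk ck])
    have "C_k_on k J y0'" using Suc.prems(3) by (simp add: y0'_def[abs_def])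
    then show "C_k_on k J (\<lambda>t. z t \<alpha>)"
      by (subst C_k_on_cong[where g = y0']) (simp_all add: z)
  qed (use z in auto)
  moreover have "(y s has_vector_derivative z t s) (at t within J)" if s: "s \<in> ?I" and t: "t \<in> J" for s t
  proof (rule parameter_derivative[OF t Suc.prems(4), where D = "\<lambda>s. D s t" and c =
    "\<lambda>s. c s t" and L = L, OF _ _ _ _ D L(1) _ s])
    show "(y \<alpha> has_vector_derivative z t \<alpha>) (at t within J)" using y0'[OF t] z(1)[OF t] by simp
    show "(z t has_vector_derivative D s t (z t s) + c s t) (at s within ?I)" if "s \<in> ?I" for s
      by (rule z(2)[OF t that])
    fix \<epsilon> :: real assume \<epsilon>: "0 < \<epsilon>"
    \<comment> \<open>Again y is frozen at parameter t, so that only coefficients vary and P is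
      differentiable in \<tau>. What remains is D s \<tau> w - D s t w, small against w.\<close>
    define P where "P s \<tau> = (\<Sum>i\<in>Basis. (y s t \<bullet> i) *\<^sub>R D s \<tau> i) + b s \<tau>" for s \<tau>
    define P' where "P' s \<tau> = (\<Sum>i\<in>Basis. (y s t \<bullet> i) *\<^sub>R d i s \<tau>) + b' s \<tau>" for s \<tau>
    have PD: "(P s has_vector_derivative P' s \<tau>) (at \<tau> within J)" if "s \<in> ?I" "\<tau> \<in> J" for s \<tau>
      unfolding P_def[abs_def] P'_def using that
      by (intro has_vector_derivative_add has_vector_derivative_sum b'
          bounded_linear.has_vector_derivative[OF bounded_linear_scaleR_right] d)
    have yc: "continuous_on (?I \<times> J) (\<lambda>x. y (fst x) t)"
      by (rule continuous_on_compose2[OF slice[OF C_k_param_imp_continuous[OF yk] t] continuous_on_fst[OF continuous_on_id]]) auto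
    have "continuous_on (?I \<times> J) (\<lambda>x. (\<Sum>i\<in>Basis. (y (fst x) t \<bullet> i) *\<^sub>R d i (fst x) (snd x)) + b' (fst x) (snd x))"
      using C_k_param_imp_continuous[OF d(2)] C_k_param_imp_continuous[OF b'(2)]
      by (intro continuous_intros yc) (auto simp: case_prod_unfold)
    then have P'c: "continuous_on (?I \<times> J) (\<lambda>(s, \<tau>). P' s \<tau>)" by (simp add: P'_def case_prod_unfold)
    obtain \<delta>1 where \<delta>1: "0 < \<delta>1" "\<And>\<tau> s. \<tau> \<in> J \<Longrightarrow> \<bar>\<tau> - t\<bar> < \<delta>1 \<Longrightarrow> s \<in> ?I \<Longrightarrow>
        norm (P s \<tau> - P s t - (\<tau> - t) *\<^sub>R P' s t) \<le> \<epsilon> * \<bar>\<tau> - t\<bar>"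
      using uniform_parameter_differentiability[OF P'c compact_Icc J(1) t \<epsilon> PD] by blast
    \<comment> \<open>A bound for the operator norm of D s \<tau> - D s t that is visibly continuous
      and vanishes at \<tau> = t.\<close>
    define Dv where "Dv s \<tau> = (\<Sum>i\<in>Basis. norm (D s \<tau> i - D s t i))" for s \<tau>
    have "continuous_on (?I \<times> J) (\<lambda>x. D (fst x) t i)" for i
      by (rule continuous_on_compose2[OF slice[OF C_k_param_imp_continuous[OF Dk] t] continuous_on_fst[OF continuous_on_id]]) auto
    then have "continuous_on (?I \<times> J) (\<lambda>x. Dv (fst x) (snd x))"
      unfolding Dv_def using C_k_param_imp_continuous[OF Dk]
      by (intro continuous_intros) (auto simp: case_prod_unfold)
    then have Dvc: "continuous_on (?I \<times> J) (\<lambda>(s, \<tau>). Dv s \<tau>)" by (simp add: case_prod_unfold)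
    obtain \<delta>2 where \<delta>2: "0 < \<delta>2" "\<And>\<tau> s. \<tau> \<in> J \<Longrightarrow> \<bar>\<tau> - t\<bar> < \<delta>2 \<Longrightarrow> s \<in> ?I \<Longrightarrow> norm (Dv s \<tau> - Dv s t) \<le> \<epsilon>"
      using uniform_parameter_continuity[OF Dvc compact_Icc t \<epsilon>] by blast
    show "\<exists>\<delta>>0. \<forall>\<tau>\<in>J. \<bar>\<tau> - t\<bar> < \<delta> \<longrightarrow> (\<forall>s\<in>?I.
        norm ((D s \<tau> (y s \<tau>) + b s \<tau>) - (D s t (y s t) + b s t) - D s t (y s \<tau> - y s t) - (\<tau> - t) *\<^sub>R c s t)
          \<le> \<epsilon> * (\<bar>\<tau> - t\<bar> + norm (y s \<tau> - y s t)))"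
    proof (intro exI[of _ "min \<delta>1 \<delta>2"] conjI ballI impI)
      fix \<tau> s assume \<tau>: "\<tau> \<in> J" "\<bar>\<tau> - t\<bar> < min \<delta>1 \<delta>2" and s: "s \<in> ?I"
      define w where "w = y s \<tau> - y s t"
      have P: "P s \<tau> = D s \<tau> (y s t) + b s \<tau>" for \<tau>
        by (simp add: P_def linear_sum_Basis[OF D(1), symmetric])
      have "norm (D s \<tau> w - D s t w) = norm (\<Sum>i\<in>Basis. (w \<bullet> i) *\<^sub>R (D s \<tau> i - D s t i))"
        by (subst (1 2) linear_sum_Basis[OF D(1)]) (simp add: sum_subtractf scaleR_diff_right)
      also have "\<dots> \<le> (\<Sum>i\<in>Basis. norm w * norm (D s \<tau> i - D s t i))"
        by (rule sum_norm_le) (auto intro!: mult_right_mono Basis_le_norm)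
      also have "\<dots> = norm w * Dv s \<tau>" by (simp add: Dv_def sum_distrib_left)
      also have "\<dots> \<le> norm w * \<epsilon>"
        using \<delta>2(2)[of \<tau> s] \<tau> s by (intro mult_left_mono) (auto simp: Dv_def)
      finally have 1: "norm (D s \<tau> w - D s t w) \<le> \<epsilon> * norm w" by (simp add: mult.commute)
      have 2: "norm (P s \<tau> - P s t - (\<tau> - t) *\<^sub>R P' s t) \<le> \<epsilon> * \<bar>\<tau> - t\<bar>" using \<delta>1(2) \<tau> s by auto
      have eq: "(D s \<tau> (y s \<tau>) + b s \<tau>) - (D s t (y s t) + b s t) - D s t (y s \<tau> - y s t) - (\<tau> - t) *\<^sub>R c s t
          = (P s \<tau> - P s t - (\<tau> - t) *\<^sub>R P' s t) + (D s \<tau> w - D s t w)"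
        by (simp add: P P'_def c_def w_def linear_diff[OF D(1)])
      show "norm ((D s \<tau> (y s \<tau>) + b s \<tau>) - (D s t (y s t) + b s t) - D s t (y s \<tau> - y s t) - (\<tau> - t) *\<^sub>R c s t)
          \<le> \<epsilon> * (\<bar>\<tau> - t\<bar> + norm (y s \<tau> - y s t))"
        unfolding eq distrib_left using norm_triangle_mono[OF 2 1] unfolding w_def .
    qed (use \<delta>1 \<delta>2 in auto)
  qed auto
  ultimately show ?case using C_k_param_imp_continuous[OF yk] by (auto intro!: exI[of _ "\<lambda>s t. z t s"])
qed

section \<open>Smooth dependence of solutions of nonlinear equations on the parameter\<close>

lemma C_k_param_compose:
  fixes u :: "real \<Rightarrow> real \<Rightarrow> 'a::euclidean_space" and g :: "'a \<Rightarrow> 'b::real_normed_vector"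
  shows "smooth_on UNIV g \<Longrightarrow> C_k_param k I J u \<Longrightarrow> C_k_param k I J (\<lambda>s t. g (u s t))"
proof (induction k arbitrary: g)
  case 0
  then show ?case
    using continuous_on_compose2[of UNIV g "I \<times> J" "\<lambda>(s, t). u s t"]
    by (auto simp: case_prod_unfold smooth_on_continuous)
next
  case (Suc k)
  then obtain u' where
    u': "\<forall>s\<in>I. \<forall>t\<in>J. (u s has_vector_derivative u' s t) (at t within J)" "C_k_param k I J u'"
    by auto
  define D where "D s t = frechet_derivative g (at (u s t))" for s t
  have gd: "(g has_derivative D s t) (at (u s t))" for s t
    using smooth_on_has_derivative[OF Suc.prems(1)] by (simp add: D_def)
  have "C_k_param k I J (\<lambda>s t. D s t v)" for v
    unfolding D_def using Suc.prems(1) C_k_param_Suc_imp[OF Suc.prems(2)]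
    by (intro Suc.IH[where g = "\<lambda>x. frechet_derivative g (at x) v"] smooth_on_deriv) simp_all
  then have "C_k_param k I J (\<lambda>s t. D s t (u' s t))"
    by (rule C_k_param_apply[OF has_derivative_linear[OF gd] _ u'(2)])
  moreover have "((\<lambda>t. g (u s t)) has_vector_derivative D s t (u' s t)) (at t within J)" if "s \<in> I"
    "t \<in> J" for s t
    by (rule vector_derivative_diff_chain_within[OF _ has_derivative_at_withinI[OF gd], unfolded o_def])
      (use u' that in auto)
  moreover have "continuous_on (I \<times> J) (\<lambda>(s, t). g (u s t))"
    using continuous_on_compose2[OF smooth_on_continuous[OF Suc.prems(1)] C_k_param_imp_continuous[OF Suc.prems(2)]]
    by (auto simp: case_prod_unfold)
  ultimately show ?case unfolding C_k_param.simps(2)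
    by (intro conjI exI[of _ "\<lambda>s t. D s t (u' s t)"] ballI)
qed

lemma bounded_derivative_imp_lipschitz:
  fixes g :: "'a::euclidean_space \<Rightarrow> 'b::real_normed_vector"
  assumes "smooth_on UNIV g" "\<And>x v. norm (frechet_derivative g (at x) v) \<le> L * norm v"
  shows "norm (g u - g v) \<le> L * norm (u - v)"
proof (rule differentiable_bound[where S = UNIV and f' = "\<lambda>x. frechet_derivative g (at x)"])
  show "(g has_derivative frechet_derivative g (at x)) (at x within UNIV)" for x
    using smooth_on_has_derivative[OF assms(1)] by simp
  show "onorm (frechet_derivative g (at x)) \<le> L" for x by (rule onorm_le[OF assms(2)])
qed auto

text \<open>The derivative is uniformly continuous on a compact neighbourhood of C, and the mean
  value inequality turns this into a remainder estimate with one \<delta> for all base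
  points.\<close>

lemma uniform_differentiability_on_compact:
  fixes g :: "'a::euclidean_space \<Rightarrow> 'b::real_normed_vector"
  assumes g: "smooth_on UNIV g" and "compact C" "0 < \<epsilon>"
  obtains \<delta> where "0 < \<delta>" "\<And>p q. p \<in> C \<Longrightarrow> norm (q - p) < \<delta> \<Longrightarrow>
    norm (g q - g p - frechet_derivative g (at p) (q - p)) \<le> \<epsilon> * norm (q - p)"
proof -
  define D where "D x = frechet_derivative g (at x)" for x
  have D: "(g has_derivative D x) (at x)" for x
    using smooth_on_has_derivative[OF g] by (simp add: D_def)
  \<comment> \<open>The closed unit neighbourhood of C: the segment from p to q may leave C, but
    stays in C' because \<delta>' \<le> 1.\<close>
  define C' where "C' = {x + y | x y. x \<in> C \<and> y \<in> cball 0 1}"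
  have "compact C'" unfolding C'_def by (rule compact_sums) (use assms in auto)
  \<comment> \<open>Each of the n basis directions contributes \<epsilon> / n to the bound for the
    operator norm.\<close>
  define n where "n = real DIM('a)"
  have n: "0 < n" by (simp add: n_def)
  have "\<exists>\<delta>>0. \<forall>x\<in>C'. \<forall>y\<in>C'. dist y x < \<delta> \<longrightarrow> dist (D y i) (D x i) < \<epsilon> / n" for i
  proof -
    have "continuous_on C' (\<lambda>x. D x i)"
      using smooth_on_continuous[OF smooth_on_deriv[OF g, of i]]
        by (auto simp: D_def intro: continuous_on_subset)
    then have "uniformly_continuous_on C' (\<lambda>x. D x i)"
      using \<open>compact C'\<close> by (rule compact_uniformly_continuous)
    then show ?thesis using \<open>0 < \<epsilon>\<close> n unfolding uniformly_continuous_on_def by simp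
  qed
  then have "\<forall>i. \<exists>\<delta>>0. \<forall>x\<in>C'. \<forall>y\<in>C'. dist y x < \<delta> \<longrightarrow> dist (D y i) (D x i) < \<epsilon> / n" by blast
  then obtain \<delta> where "\<forall>i. 0 < \<delta> i \<and> (\<forall>x\<in>C'. \<forall>y\<in>C'. dist y x < \<delta> i \<longrightarrow> dist (D y i) (D x i) < \<epsilon> / n)"
    by (rule choice[THEN exE]) blast
  then have \<delta>: "\<And>i. 0 < \<delta> i" "\<And>i x y. x \<in> C' \<Longrightarrow> y \<in> C' \<Longrightarrow> dist y x < \<delta> i \<Longrightarrow> dist (D y i) (D x i) < \<epsilon> / n"
    by blast+
  define \<delta>' where "\<delta>' = min 1 (Min (\<delta> ` (Basis :: 'a set)))"
  have \<delta>': "0 < \<delta>'" "\<And>i. i \<in> Basis \<Longrightarrow> \<delta>' \<le> \<delta> i" "\<delta>' \<le> 1"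
    using \<delta>(1) by (auto simp: \<delta>'_def min.coboundedI2)
  show thesis
  proof (rule that[OF \<delta>'(1)])
    fix p q assume p: "p \<in> C" and q: "norm (q - p) < \<delta>'"
    have "norm (g q - g p - D p (q - p)) \<le> norm (q - p) * \<epsilon>"
    proof (rule differentiable_bound_linearization[where S = "ball p \<delta>'"])
      show "p + r *\<^sub>R (q - p) \<in> ball p \<delta>'" if "r \<in> {0..1}" for r
      proof -
        have "\<bar>r\<bar> * norm (q - p) \<le> 1 * norm (q - p)" using that by (intro mult_right_mono) auto
        then show ?thesis using q by (simp add: dist_norm)
      qed
      show "(g has_derivative D x) (at x within ball p \<delta>')" for x
        using D by (rule has_derivative_at_withinI)
      show "onorm (D x - D p) \<le> \<epsilon>" if x: "x \<in> ball p \<delta>'" for x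
      proof (rule onorm_le)
        fix v
        have C': "p \<in> C'" "x \<in> C'"
        proof -
          have "p = p + 0" "x = p + (x - p)" by auto
          moreover have "(0::'a) \<in> cball 0 1" "x - p \<in> cball 0 1"
            using x \<delta>'(3) by (auto simp: dist_norm norm_minus_commute)
          ultimately show "p \<in> C'" "x \<in> C'" unfolding C'_def using p by blast+
        qed
        have "linear (\<lambda>v. D x v - D p v)"
          by (intro linear_compose_sub has_derivative_linear[OF D])
        from linear_sum_Basis[OF this, of v]
        have "norm ((D x - D p) v) = norm (\<Sum>i\<in>Basis. (v \<bullet> i) *\<^sub>R (D x i - D p i))" by simp
        also have "\<dots> \<le> (\<Sum>i\<in>(Basis::'a set). norm v * (\<epsilon> / n))"
        proof (rule sum_norm_le)
          fix i :: 'a assume i: "i \<in> Basis"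
          have "dist (D x i) (D p i) < \<epsilon> / n"
            using \<delta>(2)[OF C'] \<delta>'(2)[OF i] x by (auto simp: dist_commute)
          then have "\<bar>v \<bullet> i\<bar> * norm (D x i - D p i) \<le> norm v * (\<epsilon> / n)"
            using Basis_le_norm[OF i, of v] by (intro mult_mono) (auto simp: dist_norm)
          then show "norm ((v \<bullet> i) *\<^sub>R (D x i - D p i)) \<le> norm v * (\<epsilon> / n)" by simp
        qed
        also have "\<dots> = \<epsilon> * norm v" using n by (simp add: n_def)
        finally show "norm ((D x - D p) v) \<le> \<epsilon> * norm v" .
      qed
    qed (use \<delta>' in auto)
    then show "norm (g q - g p - frechet_derivative g (at p) (q - p)) \<le> \<epsilon> * norm (q - p)"
      by (simp add: D_def mult.commute)
  qed
qed

text \<open>The t-derivative of x is the solution y of the variational equation, whose coefficients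
  are D = g'(x). This makes x bootstrap: if x is C^k in t, so is D, hence so is y by
  \<open>linear_ode_C_k_param\<close>, and x is C^(k+1). The interval is short enough for
  \<open>picard\<close> to solve the variational equation in one go.\<close>

lemma flow_smooth:
  fixes g :: "'a::euclidean_space \<Rightarrow> 'a" and x :: "real \<Rightarrow> real \<Rightarrow> 'a"
  assumes J: "convex J" "thick J" and ab: "\<alpha> \<le> \<beta>"
    and g: "smooth_on UNIV g" and gL: "\<And>x v. norm (frechet_derivative g (at x) v) \<le> L * norm v"
    and L: "0 \<le> L" "L * (\<beta> - \<alpha>) \<le> 1 / 2"
    and init: "smooth_on J (x \<alpha>)"
    and sol: "\<And>s t. s \<in> {\<alpha>..\<beta>} \<Longrightarrow> t \<in> J \<Longrightarrow> ((\<lambda>s. x s t) has_vector_derivative g (x s t)) (at s within {\<alpha>..\<beta>})"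
  shows "smooth_on J (x \<beta>)"
proof -
  let ?I = "{\<alpha>..\<beta>}"
  have lip: "norm (g u - g v) \<le> L * norm (u - v)" for u v
    by (rule bounded_derivative_imp_lipschitz[OF g gL])
  define D where "D s t = frechet_derivative g (at (x s t))" for s t
  have Dlin: "linear (D s t)" for s t
    using smooth_on_has_derivative[OF g] has_derivative_linear by (auto simp: D_def)
  have DL: "norm (D s t v) \<le> L * norm v" for s t v using gL by (simp add: D_def)
  have xs: "continuous_on ?I (\<lambda>s. x s t)" if "t \<in> J" for t
    by (rule has_vector_derivative_imp_continuous_on[OF sol[OF _ that]])
  define G where "G = exp ((L + 1) * (\<beta> - \<alpha>)) * (1 + (\<beta> - \<alpha>))"
  have G: "0 < G" using ab by (auto simp: G_def intro!: mult_pos_pos)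
  have close: "norm (x s \<tau> - x s t) \<le> G * norm (x \<alpha> \<tau> - x \<alpha> t)" if "s \<in> ?I" "\<tau> \<in> J" "t \<in> J" for s \<tau> t
  proof -
    have "norm (x s \<tau> - x s t) \<le> exp ((L + 1) * (\<beta> - \<alpha>)) * (1 + (\<beta> - \<alpha>)) * (norm (x \<alpha> \<tau> - x \<alpha> t) + 0)"
      by (rule gronwall[OF _ _ L(1) _ that(1), where w' = "\<lambda>s. g (x s \<tau>) - g (x s t)"])
        (use that lip in \<open>auto intro!: has_vector_derivative_diff sol\<close>)
    then show ?thesis by (simp add: G_def)
  qed
  have unif: "\<exists>\<delta>>0. \<forall>\<tau>\<in>J. \<bar>\<tau> - t\<bar> < \<delta> \<longrightarrow> (\<forall>s\<in>?I. norm (x s \<tau> - x s t) \<le> \<epsilon>)" if t: "t \<in> J" and "0 < \<epsilon>"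
    for t \<epsilon>
  proof -
    have "0 < \<epsilon> / G" using G \<open>0 < \<epsilon>\<close> by simp
    then obtain \<delta> where \<delta>: "0 < \<delta>" "\<And>\<tau>. \<tau> \<in> J \<Longrightarrow> dist \<tau> t < \<delta> \<Longrightarrow> dist (x \<alpha> \<tau>) (x \<alpha> t) < \<epsilon> / G"
      using smooth_on_continuous[OF init] t unfolding continuous_on_iff by meson
    show ?thesis
    proof (intro exI[of _ \<delta>] conjI ballI impI)
      fix \<tau> s assume *: "\<tau> \<in> J" "\<bar>\<tau> - t\<bar> < \<delta>" "s \<in> ?I"
      have "norm (x s \<tau> - x s t) \<le> G * norm (x \<alpha> \<tau> - x \<alpha> t)" by (rule close) (use * t in auto)
      also have "\<dots> \<le> G * (\<epsilon> / G)" using \<delta>(2)[of \<tau>] * G by (intro mult_left_mono) (auto simp: dist_norm)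
      finally show "norm (x s \<tau> - x s t) \<le> \<epsilon>" using G by simp
    qed (rule \<delta>(1))
  qed
  have x0: "C_k_param 0 ?I J x" using continuous_on_parameterI[OF xs unif] by simp
  have "\<exists>y. y \<alpha> = frechet_derivative (x \<alpha>) (at t within J) 1 \<and>
      (\<forall>s\<in>?I. (y has_vector_derivative D s t (y s)) (at s within ?I))" if t: "t \<in> J" for t
  proof -
    have "continuous_on (?I \<times> (UNIV::'a set)) (\<lambda>p. frechet_derivative g (at (x (fst p) t)) i)" for i
      by (rule continuous_on_compose2[OF smooth_on_continuous[OF smooth_on_deriv[OF g]]
            continuous_on_compose2[OF xs[OF t] continuous_on_fst[OF continuous_on_id]]]) auto
    then have "continuous_on (?I \<times> UNIV) (\<lambda>p. \<Sum>i\<in>Basis. (snd p \<bullet> i) *\<^sub>R D (fst p) t i)"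
      unfolding D_def by (intro continuous_intros) auto
    then have hc: "continuous_on (?I \<times> UNIV) (\<lambda>(s, u). D s t u)"
      by (simp add: case_prod_unfold linear_sum_Basis[OF Dlin, symmetric])
    have hl: "norm (D s t u - D s t v) \<le> L * norm (u - v)" for s u v
      using DL[of s t "u - v"] by (simp add: linear_diff[OF Dlin])
    from picard[OF ab hc hl L] show ?thesis by metis
  qed
  then obtain y where y0: "\<And>t. t \<in> J \<Longrightarrow> y t \<alpha> = frechet_derivative (x \<alpha>) (at t within J) 1"
    and y: "\<And>t s. t \<in> J \<Longrightarrow> s \<in> ?I \<Longrightarrow> (y t has_vector_derivative D s t (y t s)) (at s within ?I)"
    by metis
  have deriv: "(x s has_vector_derivative y t s) (at t within J)" if s: "s \<in> ?I" and t: "t \<in> J" for s t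
  proof (rule parameter_derivative[OF t sol, where D = "\<lambda>s. D s t" and c =
    "\<lambda>s. 0" and L = L, OF _ _ _ _ Dlin DL L(1) _ s])
    have *: "(x \<alpha> has_derivative frechet_derivative (x \<alpha>) (at t within J)) (at t within J)"
      using init t C_k_on_SucD[of 0 J "x \<alpha>" t] by (simp add: smooth_on_def del: C_k_on.simps)
    then show "(x \<alpha> has_vector_derivative y t \<alpha>) (at t within J)"
      unfolding y0[OF t] by (rule has_derivative_imp_has_vector_derivative)
    show "(y t has_vector_derivative D s t (y t s) + 0) (at s within ?I)" if "s \<in> ?I" for s
      using y[OF t that] by simp
    fix \<epsilon> :: real assume \<epsilon>: "0 < \<epsilon>"
    \<comment> \<open>The linearisation of g is uniform near the compact trajectory at parameter t,
      and by \<open>unif\<close> nearby trajectories stay in that neighbourhood during the whole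
      time interval.\<close>
    have "compact ((\<lambda>s. x s t) ` ?I)" by (rule compact_continuous_image[OF xs[OF t] compact_Icc])
    from uniform_differentiability_on_compact[OF g this \<epsilon>] obtain \<delta>1 where \<delta>1: "0 < \<delta>1"
      "\<And>s q. s \<in> ?I \<Longrightarrow> norm (q - x s t) < \<delta>1 \<Longrightarrow>
         norm (g q - g (x s t) - D s t (q - x s t)) \<le> \<epsilon> * norm (q - x s t)"
      by (metis D_def imageI)
    obtain \<delta>2 where \<delta>2: "0 < \<delta>2" "\<And>\<tau> s. \<tau> \<in> J \<Longrightarrow> \<bar>\<tau> - t\<bar> < \<delta>2 \<Longrightarrow> s \<in> ?I \<Longrightarrow> norm (x s \<tau> - x s t) \<le> \<delta>1 / 2"
      using unif[OF t, of "\<delta>1 / 2"] \<delta>1(1) by auto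
    show "\<exists>\<delta>>0. \<forall>\<tau>\<in>J. \<bar>\<tau> - t\<bar> < \<delta> \<longrightarrow> (\<forall>s\<in>?I.
        norm (g (x s \<tau>) - g (x s t) - D s t (x s \<tau> - x s t) - (\<tau> - t) *\<^sub>R 0) \<le> \<epsilon> * (\<bar>\<tau> - t\<bar> + norm (x s \<tau> - x s t)))"
    proof (intro exI[of _ \<delta>2] conjI ballI impI)
      fix \<tau> s assume *: "\<tau> \<in> J" "\<bar>\<tau> - t\<bar> < \<delta>2" "s \<in> ?I"
      have "norm (g (x s \<tau>) - g (x s t) - D s t (x s \<tau> - x s t)) \<le> \<epsilon> * norm (x s \<tau> - x s t)"
        using \<delta>1 \<delta>2(2)[OF *] * by (intro \<delta>1(2)) auto
      also have "\<dots> \<le> \<epsilon> * (\<bar>\<tau> - t\<bar> + norm (x s \<tau> - x s t))" using \<epsilon> by (intro mult_left_mono) auto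
      finally show "norm (g (x s \<tau>) - g (x s t) - D s t (x s \<tau> - x s t) - (\<tau> - t) *\<^sub>R 0) \<le> \<epsilon> * (\<bar>\<tau> - t\<bar> + norm (x s \<tau> - x s t))"
        by simp
    qed (rule \<delta>2(1))
  qed auto
  have "C_k_param k ?I J x" for k
  proof (induction k)
    case 0
    show ?case by (rule x0)
  next
    case (Suc k)
    have "C_k_param k ?I J (\<lambda>s t. y t s)"
    proof (rule linear_ode_C_k_param[OF J ab Dlin DL L, where b = "\<lambda>s t. 0"])
      show "C_k_param k ?I J (\<lambda>s t. D s t v)" for v
        unfolding D_def by (rule C_k_param_compose[OF smooth_on_deriv[OF g] Suc]) simp
      show "C_k_param k ?I J (\<lambda>s t. 0)" by (rule C_k_param_zero)
      have "C_k_on (Suc k) J (x \<alpha>)" using init by (simp add: smooth_on_def del: C_k_on.simps)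
      then show "C_k_on k J (\<lambda>t. y t \<alpha>)"
        by (subst C_k_on_cong[where g =
          "\<lambda>t. frechet_derivative (x \<alpha>) (at t within J) 1"]) (simp_all add: y0)
    qed (use y in auto)
    then show ?case unfolding C_k_param.simps(2)
      by (intro conjI exI[of _ "\<lambda>s t. y t s"] ballI deriv C_k_param_imp_continuous[OF Suc])
  qed
  then show ?thesis unfolding smooth_on_def using C_k_param_slice[OF J(2), of \<beta> "{\<alpha>..\<beta>}"] ab by auto
qed

section \<open>Flows in charts\<close>

text \<open>The infimum of the counterexamples satisfies P by \<open>base\<close> or
  \<open>lim\<close>, and \<open>step\<close> then pushes it up, a contradiction. This takes the
  place of finite subdivisions of the interval in the later continuation arguments.\<close>

lemma real_induction:
  fixes P :: "real \<Rightarrow> bool"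
  assumes base: "P \<alpha>"
    and step: "\<And>s. \<alpha> \<le> s \<Longrightarrow> s < \<beta> \<Longrightarrow> P s \<Longrightarrow> \<exists>\<epsilon>>0. \<forall>r. s < r \<and> r < s + \<epsilon> \<and> r \<le> \<beta> \<longrightarrow> P r"
    and lim: "\<And>s. \<alpha> < s \<Longrightarrow> s \<le> \<beta> \<Longrightarrow> (\<And>r. \<alpha> \<le> r \<Longrightarrow> r < s \<Longrightarrow> P r) \<Longrightarrow> P s"
    and s: "s \<in> {\<alpha>..\<beta>}"
  shows "P s"
proof (rule ccontr)
  assume "\<not> P s"
  define B where "B = {r \<in> {\<alpha>..\<beta>}. \<not> P r}"
  define m where "m = Inf B"
  have B: "s \<in> B" "bdd_below B" using s \<open>\<not> P s\<close> by (auto simp: B_def intro: bdd_belowI[of _ \<alpha>])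
  have m: "\<alpha> \<le> m" "m \<le> s" using B by (auto simp: m_def B_def intro: cInf_greatest cInf_lower)
  have below: "P r" if "\<alpha> \<le> r" "r < m" for r
    using cInf_lower[OF _ B(2), of r] that m s by (force simp: m_def B_def)
  have "P m"
    using base lim[of m] below m s by (cases "m = \<alpha>") auto
  moreover have "m < \<beta>" using \<open>P m\<close> \<open>\<not> P s\<close> m s by (cases "m = s") auto
  ultimately obtain \<epsilon> where \<epsilon>: "\<epsilon> > 0" "\<And>r. m < r \<Longrightarrow> r < m + \<epsilon> \<Longrightarrow> r \<le> \<beta> \<Longrightarrow> P r"
    using step[of m] m by blast
  obtain b where "b \<in> B" "b < m + \<epsilon>"
    using cInf_lessD[of B "m + \<epsilon>"] B \<epsilon> by (auto simp: m_def)
  moreover have "m \<le> b" using cInf_lower[OF \<open>b \<in> B\<close> B(2)] by (simp add: m_def)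
  ultimately show False using \<epsilon>(2)[of b] \<open>P m\<close> by (cases "m = b") (auto simp: B_def)
qed

lemma thick_Int_open:
  assumes "thick S" "open T" shows "thick (S \<inter> T)"
  unfolding thick_def
proof (intro ballI allI impI)
  fix x i and e :: real assume x: "x \<in> S \<inter> T" and i: "i \<in> (Basis :: 'a set)" and e: "0 < e"
  then obtain r where r: "r > 0" "ball x r \<subseteq> T" using assms(2) by (meson IntD2 openE)
  have "0 < min r e" using r e by simp
  with assms(1) x i obtain d where d: "0 < \<bar>d\<bar>" "\<bar>d\<bar> < min r e" "x + d *\<^sub>R i \<in> S"
    unfolding thick_def by blast
  then have "x + d *\<^sub>R i \<in> ball x r" using i by (simp add: dist_norm)
  then show "\<exists>d. 0 < \<bar>d\<bar> \<and> \<bar>d\<bar> < e \<and> x + d *\<^sub>R i \<in> S \<inter> T" using d r by auto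
qed

text \<open>All orders are assumed at once near each point, so the hypothesis passes to directional
  derivatives on the same neighbourhoods.\<close>

lemma smooth_on_local:
  fixes f :: "'a::euclidean_space \<Rightarrow> 'b::real_normed_vector"
  assumes "open S" "\<And>x. x \<in> S \<Longrightarrow> \<exists>U. open U \<and> x \<in> U \<and> smooth_on U f"
  shows "smooth_on S f"
proof -
  have "C_k_on k S f" if "\<And>x. x \<in> S \<Longrightarrow> \<exists>U. open U \<and> x \<in> U \<and> smooth_on U f" for k and f :: "'a \<Rightarrow> 'b"
    using that
  proof (induction k arbitrary: f)
    case 0
    have "continuous (at x within S) f" if x: "x \<in> S" for x
    proof -
      obtain U where U: "open U" "x \<in> U" "smooth_on U f" using 0[OF x] by blast
      have "isCont f x"
        using smooth_on_continuous[OF U(3)] U(2) by (simp add: continuous_on_eq_continuous_at[OF U(1)])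
      then show ?thesis by (rule continuous_at_imp_continuous_at_within)
    qed
    then show ?case by (simp add: continuous_on_eq_continuous_within)
  next
    case (Suc k)
    show ?case
    proof (rule C_k_on_SucI[OF thick_open[OF assms(1)]])
      fix x assume "x \<in> S"
      from Suc.prems[OF this] obtain U where U: "open U" "x \<in> U" "smooth_on U f" by blast
      show "(f has_derivative frechet_derivative f (at x)) (at x within S)"
        by (rule has_derivative_at_withinI[OF smooth_on_has_derivative[OF U(3,1,2)]])
    next
      fix v
      show "C_k_on k S (\<lambda>x. frechet_derivative f (at x) v)"
      proof (rule Suc.IH)
        fix x assume "x \<in> S"
        from Suc.prems[OF this] obtain U where "open U" "x \<in> U" "smooth_on U f" by blast
        then show "\<exists>U. open U \<and> x \<in> U \<and> smooth_on U (\<lambda>x. frechet_derivative f (at x) v)"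
          using smooth_on_deriv by blast
      qed
    qed
  qed
  then show ?thesis using assms(2) by (simp add: smooth_on_def)
qed

text \<open>Multiplication by a bump function gives compact support and hence a bounded derivative:
  the global Lipschitz bound under which \<open>picard\<close> and \<open>flow_smooth\<close> work.
  Solutions that stay in the small ball solve the original equation.\<close>

lemma cutoff:
  fixes f :: "'a::euclidean_space \<Rightarrow> 'b::real_normed_vector"
  assumes f: "smooth_on S f" and "open S" "x \<in> S"
  obtains \<rho> L g where "0 < \<rho>" "ball x \<rho> \<subseteq> S" "smooth_on UNIV g" "\<And>y. y \<in> ball x \<rho> \<Longrightarrow> g y = f y"
    "0 \<le> L" "\<And>y v. norm (frechet_derivative g (at y) v) \<le> L * norm v"
proof -
  obtain r0 where "0 < r0" "ball x r0 \<subseteq> S" using assms by (meson openE)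
  \<comment> \<open>Leaves room for three radii: g = f within r, g = 0 from 2r on, and the closed
    ball of radius 3r still lies in S.\<close>
  define r where "r = r0 / 4"
  have r: "0 < r" "cball x (3 * r) \<subseteq> S"
    using \<open>0 < r0\<close> \<open>ball x r0 \<subseteq> S\<close> by (auto simp: r_def intro!: subsetD[OF \<open>ball x r0 \<subseteq> S\<close>])
  define g where "g y = (if y \<in> S then bump x r y *\<^sub>R f y else 0)" for y
  have g0: "g y = 0" if "2 * r \<le> dist y x" for y
    using bump_eq_0[OF r(1) that] by (simp add: g_def)
  \<comment> \<open>S and U are open and cover the space, and g is smooth on each of them.\<close>
  define U where "U = - cball x (2 * r)"
  have U: "open U" unfolding U_def by (rule open_Compl[OF closed_cball])
  have gU: "g y = 0" if "y \<in> U" for y using that by (intro g0) (auto simp: U_def dist_commute)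
  have "smooth_on S (\<lambda>y. bump x r y *\<^sub>R f y)"
    using smooth_on_subset[OF smooth_on_bump[OF r(1)]] thick_open[OF \<open>open S\<close>]
    by (intro smooth_on_scaleR f) auto
  then have gS: "smooth_on S g" by (subst smooth_on_cong[where g =
    "\<lambda>y. bump x r y *\<^sub>R f y"]) (auto simp: g_def)
  have "smooth_on U (\<lambda>y. 0::'b)" by (rule smooth_on_const[OF thick_open[OF U]])
  then have sU: "smooth_on U g" by (subst smooth_on_cong[where g = "\<lambda>y. 0"]) (simp_all add: gU)
  have g: "smooth_on UNIV g"
  proof (rule smooth_on_local[OF open_UNIV])
    fix y
    have "y \<in> S \<or> y \<in> U" using r by (auto simp: U_def subset_eq dist_commute)
    then show "\<exists>U. open U \<and> y \<in> U \<and> smooth_on U g" using gS sU U \<open>open S\<close> by blast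
  qed
  have D: "(g has_derivative frechet_derivative g (at y)) (at y)" for y
    by (rule smooth_on_has_derivative[OF g open_UNIV UNIV_I])
  have "\<exists>B>0. \<forall>y\<in>cball x (3 * r). norm (frechet_derivative g (at y) i) \<le> B" for i
  proof -
    have "continuous_on (cball x (3 * r)) (\<lambda>y. frechet_derivative g (at y) i)"
      by (rule continuous_on_subset[OF smooth_on_continuous[OF smooth_on_deriv[OF g open_UNIV]]]) simp
    then have "bounded ((\<lambda>y. frechet_derivative g (at y) i) ` cball x (3 * r))"
      by (intro compact_imp_bounded compact_continuous_image) auto
    then show ?thesis unfolding bounded_pos by auto
  qed
  then have "\<forall>i. \<exists>B. B > 0 \<and> (\<forall>y\<in>cball x (3 * r). norm (frechet_derivative g (at y) i) \<le> B)" by blast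
  from choice[OF this] obtain B where B: "\<And>i. 0 < B i"
    "\<And>i y. y \<in> cball x (3 * r) \<Longrightarrow> norm (frechet_derivative g (at y) i) \<le> B i" by blast
  define L where "L = (\<Sum>i\<in>(Basis::'a set). B i)"
  have "0 \<le> L" unfolding L_def using B(1) by (intro sum_nonneg) (simp add: less_imp_le)
  have "norm (frechet_derivative g (at y) v) \<le> L * norm v" for y v
  proof (cases "y \<in> U")
    case True
    have "(g has_derivative (\<lambda>v. 0)) (at y)"
      by (rule has_derivative_transform_within_open[OF _ U True, where f = "\<lambda>y. 0"]) (simp_all add: gU)
    then have "frechet_derivative g (at y) = (\<lambda>v. 0)" using frechet_derivative_at by metis
    then show ?thesis using \<open>0 \<le> L\<close> by simp
  next
    case False
    then have y: "y \<in> cball x (3 * r)" using r by (auto simp: U_def)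
    have "norm (frechet_derivative g (at y) v) = norm (\<Sum>i\<in>Basis. (v \<bullet> i) *\<^sub>R frechet_derivative g (at y) i)"
      by (subst linear_sum_Basis[OF has_derivative_linear[OF D]]) simp
    also have "\<dots> \<le> (\<Sum>i\<in>(Basis::'a set). norm v * B i)"
    proof (rule sum_norm_le)
      fix i :: 'a assume "i \<in> Basis"
      then have "\<bar>v \<bullet> i\<bar> * norm (frechet_derivative g (at y) i) \<le> norm v * B i"
        using B(2)[OF y] Basis_le_norm by (intro mult_mono) auto
      then show "norm ((v \<bullet> i) *\<^sub>R frechet_derivative g (at y) i) \<le> norm v * B i" by simp
    qed
    also have "\<dots> = L * norm v" by (simp add: L_def sum_distrib_left mult.commute)
    finally show ?thesis .
  qed
  moreover have "g y = f y" if "y \<in> ball x r" for y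
    using that bump_eq_1[OF r(1), of y x] r by (auto simp: g_def dist_commute subset_eq)
  moreover have "ball x r \<subseteq> S" using r by auto
  ultimately show thesis using that[of r g L] r(1) g \<open>0 \<le> L\<close> by blast
qed

lemma has_vector_derivative_within_Un:
  assumes "(f has_vector_derivative f') (at x within S)" "(f has_vector_derivative f') (at x within T)"
  shows "(f has_vector_derivative f') (at x within S \<union> T)"
  using assms unfolding has_vector_derivative_def has_derivative_within
  by (auto simp: at_within_union intro: filterlim_sup)

text \<open>The flow of a vector field on a set known only through charts; the set will be TM, where
  the type of pairs does not carry the bundle topology. \<open>limit_unique\<close> takes the place
  of the Hausdorff property, and \<open>field_related\<close> says that the functions
  \<open>F c\<close> are the expressions of one vector field.\<close>

locale chart_flow =
  fixes A :: "'i set" and ch :: "'i \<Rightarrow> ('n, 'f::euclidean_space) chart" and F :: "'i \<Rightarrow> 'f \<Rightarrow> 'f"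
  assumes inj: "c \<in> A \<Longrightarrow> inj_on (coord (ch c)) (dom_of (ch c))"
    and image_open: "c \<in> A \<Longrightarrow> open (coord (ch c) ` dom_of (ch c))"
    and overlap_open: "c \<in> A \<Longrightarrow> d \<in> A \<Longrightarrow> open (coord (ch c) ` (dom_of (ch c) \<inter> dom_of (ch d)))"
    and transition_smooth: "c \<in> A \<Longrightarrow> d \<in> A \<Longrightarrow>
      smooth_on (coord (ch c) ` (dom_of (ch c) \<inter> dom_of (ch d))) (transition (ch c) (ch d))"
    and limit_unique: "\<And>z :: nat \<Rightarrow> 'n. c \<in> A \<Longrightarrow> d \<in> A \<Longrightarrow> p \<in> dom_of (ch c) \<Longrightarrow> q \<in> dom_of (ch d) \<Longrightarrow>
      (\<And>n. z n \<in> dom_of (ch c) \<inter> dom_of (ch d)) \<Longrightarrow>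
      (\<lambda>n. coord (ch c) (z n)) \<longlonglongrightarrow> coord (ch c) p \<Longrightarrow>
      (\<lambda>n. coord (ch d) (z n)) \<longlonglongrightarrow> coord (ch d) q \<Longrightarrow> p = q"
    and field_smooth: "c \<in> A \<Longrightarrow> smooth_on (coord (ch c) ` dom_of (ch c)) (F c)"
    and field_related: "c \<in> A \<Longrightarrow> d \<in> A \<Longrightarrow> p \<in> dom_of (ch c) \<Longrightarrow> p \<in> dom_of (ch d) \<Longrightarrow>
      frechet_derivative (transition (ch c) (ch d)) (at (coord (ch c) p)) (F c (coord (ch c) p))
        = F d (coord (ch d) p)"
begin

abbreviation (input) D where "D c \<equiv> dom_of (ch c)"
abbreviation (input) k where "k c \<equiv> coord (ch c)"
abbreviation (input) kinv where "kinv c \<equiv> chart_inv (ch c)"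

text \<open>As the points carry no topology, continuity is expressed by staying in a chart domain at
  nearby times. Derivatives are taken within I, hence one-sided at its ends, which allows gluing at
  a common end point.\<close>

definition flow_line :: "real set \<Rightarrow> (real \<Rightarrow> 'n) \<Rightarrow> bool" where
  "flow_line I V \<longleftrightarrow> (\<forall>s\<in>I. (\<exists>c\<in>A. V s \<in> D c) \<and> (\<forall>c\<in>A. V s \<in> D c \<longrightarrow>
     (\<forall>\<^sub>F r in at s within I. V r \<in> D c) \<and>
     ((\<lambda>r. k c (V r)) has_vector_derivative F c (k c (V s))) (at s within I)))"

lemma kinv_k: "c \<in> A \<Longrightarrow> p \<in> D c \<Longrightarrow> kinv c (k c p) = p"
  by (rule inv_into_f_f[OF inj])

lemma k_kinv: "x \<in> k c ` D c \<Longrightarrow> k c (kinv c x) = x"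
  by (rule f_inv_into_f)

lemma kinv_in: "x \<in> k c ` D c \<Longrightarrow> kinv c x \<in> D c"
  by (rule inv_into_into)

lemma transition_k: "c \<in> A \<Longrightarrow> p \<in> D c \<Longrightarrow> transition (ch c) (ch d) (k c p) = k d p"
  by (simp add: transition_def kinv_k)

lemma in_overlapD: "c \<in> A \<Longrightarrow> p \<in> D c \<Longrightarrow> k c p \<in> k c ` (D c \<inter> D d) \<Longrightarrow> p \<in> D d"
  using inj[of c] by (auto simp: inj_on_def)

lemma transition_has_derivative:
  assumes "c \<in> A" "d \<in> A" "p \<in> D c" "p \<in> D d"
  shows "(transition (ch c) (ch d) has_derivative frechet_derivative (transition (ch c) (ch d)) (at (k c p))) (at (k c p))"
  by (rule smooth_on_has_derivative[OF transition_smooth overlap_open]) (use assms in auto)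

text \<open>Continuity in the chart c and openness of the overlap keep V in the domain of d; the
  chain rule for the transition map and \<open>field_related\<close> then carry over the
  equation.\<close>

lemma flow_line_change_chart:
  assumes c: "c \<in> A" "V s \<in> D c" and ev: "\<forall>\<^sub>F r in at s within I. V r \<in> D c"
    and der: "((\<lambda>r. k c (V r)) has_vector_derivative F c (k c (V s))) (at s within I)"
    and d: "d \<in> A" "V s \<in> D d" and s: "s \<in> I"
  shows "\<forall>\<^sub>F r in at s within I. V r \<in> D d"
    and "((\<lambda>r. k d (V r)) has_vector_derivative F d (k d (V s))) (at s within I)"
proof -
  have "((\<lambda>r. k c (V r)) \<longlongrightarrow> k c (V s)) (at s within I)"
    using has_vector_derivative_continuous[OF der] by (simp add: continuous_within)
  then have "\<forall>\<^sub>F r in at s within I. k c (V r) \<in> k c ` (D c \<inter> D d)"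
    by (rule topological_tendstoD[OF _ overlap_open]) (use c d in auto)
  with ev have ev2: "\<forall>\<^sub>F r in at s within I. V r \<in> D c \<and> V r \<in> D d"
    by eventually_elim (use in_overlapD c in blast)
  then show "\<forall>\<^sub>F r in at s within I. V r \<in> D d" by eventually_elim simp
  define \<phi> where "\<phi> = transition (ch c) (ch d)"
  have "(\<phi> has_derivative frechet_derivative \<phi> (at (k c (V s)))) (at (k c (V s)))"
    unfolding \<phi>_def by (rule transition_has_derivative[OF c(1) d(1) c(2) d(2)])
  then have "((\<lambda>r. \<phi> (k c (V r))) has_vector_derivative frechet_derivative \<phi> (at (k c (V s))) (F c (k c (V s)))) (at s within I)"
    using vector_derivative_diff_chain_within[OF der has_derivative_at_withinI, unfolded o_def] by blast
  then have "((\<lambda>r. \<phi> (k c (V r))) has_vector_derivative F d (k d (V s))) (at s within I)"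
    unfolding \<phi>_def field_related[OF c(1) d(1) c(2) d(2)] .
  then show "((\<lambda>r. k d (V r)) has_vector_derivative F d (k d (V s))) (at s within I)"
    unfolding has_vector_derivative_def
  proof (rule has_derivative_transform_eventually)
    from ev2 show "\<forall>\<^sub>F r in at s within I. \<phi> (k c (V r)) = k d (V r)"
      by eventually_elim (simp add: \<phi>_def transition_k c)
    show "\<phi> (k c (V s)) = k d (V s)" by (simp add: \<phi>_def transition_k c)
  qed (rule s)
qed

lemma flow_lineI:
  assumes "\<And>s. s \<in> I \<Longrightarrow> \<exists>c\<in>A. V s \<in> D c \<and> (\<forall>\<^sub>F r in at s within I. V r \<in> D c) \<and>
     ((\<lambda>r. k c (V r)) has_vector_derivative F c (k c (V s))) (at s within I)"
  shows "flow_line I V"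
  unfolding flow_line_def
proof (intro ballI conjI impI)
  fix s assume s: "s \<in> I"
  then obtain c where c: "c \<in> A" "V s \<in> D c" "\<forall>\<^sub>F r in at s within I. V r \<in> D c"
    "((\<lambda>r. k c (V r)) has_vector_derivative F c (k c (V s))) (at s within I)"
    using assms by blast
  then show "\<exists>c\<in>A. V s \<in> D c" by blast
  fix d assume d: "d \<in> A" "V s \<in> D d"
  show "\<forall>\<^sub>F r in at s within I. V r \<in> D d"
    "((\<lambda>r. k d (V r)) has_vector_derivative F d (k d (V s))) (at s within I)"
    using flow_line_change_chart[where V = V, OF c d s] by blast+
qed

lemma flow_lineD:
  assumes "flow_line I V" "s \<in> I"
  shows "\<exists>c\<in>A. V s \<in> D c"
    and "c \<in> A \<Longrightarrow> V s \<in> D c \<Longrightarrow> \<forall>\<^sub>F r in at s within I. V r \<in> D c"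
    and "c \<in> A \<Longrightarrow> V s \<in> D c \<Longrightarrow> ((\<lambda>r. k c (V r)) has_vector_derivative F c (k c (V s))) (at s within I)"
  using assms by (auto simp: flow_line_def)

lemma flow_line_subset: "flow_line I V \<Longrightarrow> J \<subseteq> I \<Longrightarrow> flow_line J V"
  unfolding flow_line_def
  by (meson at_le filter_leD has_vector_derivative_within_subset subsetD)

lemma flow_line_in_chart:
  assumes "c \<in> A" and y: "\<And>s. s \<in> I \<Longrightarrow> y s \<in> k c ` D c"
    "\<And>s. s \<in> I \<Longrightarrow> (y has_vector_derivative F c (y s)) (at s within I)"
  shows "flow_line I (\<lambda>s. kinv c (y s))"
proof (rule flow_lineI)
  fix s assume s: "s \<in> I"
  have "((\<lambda>r. k c (kinv c (y r))) has_vector_derivative F c (y s)) (at s within I)"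
    by (rule has_vector_derivative_transform[OF s _ y(2)[OF s]]) (simp add: k_kinv y)
  moreover have "\<forall>\<^sub>F r in at s within I. kinv c (y r) \<in> D c"
    by (auto simp: eventually_at_filter kinv_in y)
  ultimately show "\<exists>c'\<in>A. kinv c (y s) \<in> D c' \<and> (\<forall>\<^sub>F r in at s within I. kinv c (y r) \<in> D c') \<and>
     ((\<lambda>r. k c' (kinv c (y r))) has_vector_derivative F c' (k c' (kinv c (y s)))) (at s within I)"
    using assms(1) s by (intro bexI[of _ c]) (auto simp: kinv_in k_kinv y)
qed

text \<open>At the junction both one-sided derivatives are the value of the field at the same point,
  so they combine to a derivative within the union.\<close>

lemma flow_line_join:
  assumes V: "flow_line {\<alpha>..\<beta>} V" and W: "flow_line {\<beta>..\<gamma>} W" and "V \<beta> = W \<beta>" "\<alpha> \<le> \<beta>" "\<beta> \<le> \<gamma>"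
  shows "flow_line {\<alpha>..\<gamma>} (\<lambda>s. if s \<le> \<beta> then V s else W s)"
proof -
  define Z where "Z s = (if s \<le> \<beta> then V s else W s)" for s
  have ZV: "Z s = V s" if "s \<in> {\<alpha>..\<beta>}" for s using that by (auto simp: Z_def)
  have ZW: "Z s = W s" if "s \<in> {\<beta>..\<gamma>}" for s using that assms(3) by (auto simp: Z_def)
  have I: "{\<alpha>..\<gamma>} = {\<alpha>..\<beta>} \<union> {\<beta>..\<gamma>}" using assms by auto
  have half: "(\<forall>\<^sub>F r in at s within I. Z r \<in> D c) \<and>
     ((\<lambda>r. k c (Z r)) has_vector_derivative F c (k c (Z s))) (at s within I)"
    if U: "flow_line I U" "s \<in> I" "\<And>r. r \<in> I \<Longrightarrow> Z r = U r" "c \<in> A" "Z s \<in> D c" for U I s c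
  proof
    have Us: "U s \<in> D c" using U by simp
    have "\<forall>\<^sub>F r in at s within I. r \<in> I" by (simp add: eventually_at_filter)
    with flow_lineD(2)[OF U(1,2,4) Us] show "\<forall>\<^sub>F r in at s within I. Z r \<in> D c"
      by eventually_elim (simp add: U(3))
    show "((\<lambda>r. k c (Z r)) has_vector_derivative F c (k c (Z s))) (at s within I)"
      unfolding U(3)[OF U(2)]
      by (rule has_vector_derivative_transform[OF U(2) _ flow_lineD(3)[OF U(1,2,4) Us]]) (simp add: U(3))
  qed
  have "flow_line {\<alpha>..\<gamma>} Z"
  proof (rule flow_lineI)
    fix s assume s: "s \<in> {\<alpha>..\<gamma>}"
    consider "s < \<beta>" | "s = \<beta>" | "\<beta> < s" by linarith
    then show "\<exists>c\<in>A. Z s \<in> D c \<and> (\<forall>\<^sub>F r in at s within {\<alpha>..\<gamma>}. Z r \<in> D c) \<and>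
       ((\<lambda>r. k c (Z r)) has_vector_derivative F c (k c (Z s))) (at s within {\<alpha>..\<gamma>})"
    proof cases
      case 1
      have at: "at s within {\<alpha>..\<gamma>} = at s within {\<alpha>..\<beta>}"
        by (rule at_within_nhd[of _ "{..<\<beta>}"]) (use 1 assms in auto)
      obtain c where c: "c \<in> A" "V s \<in> D c" using flow_lineD(1)[OF V, of s] s 1 by auto
      have Zs: "Z s \<in> D c" using c 1 by (simp add: Z_def)
      have "s \<in> {\<alpha>..\<beta>}" using s 1 by auto
      from half[OF V this ZV c(1) Zs] Zs c(1) show ?thesis unfolding at by blast
    next
      case 3
      have at: "at s within {\<alpha>..\<gamma>} = at s within {\<beta>..\<gamma>}"
        by (rule at_within_nhd[of _ "{\<beta><..}"]) (use 3 assms in auto)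
      obtain c where c: "c \<in> A" "W s \<in> D c" using flow_lineD(1)[OF W, of s] s 3 by auto
      have Zs: "Z s \<in> D c" using c 3 by (simp add: Z_def)
      have "s \<in> {\<beta>..\<gamma>}" using s 3 by auto
      from half[OF W this ZW c(1) Zs] Zs c(1) show ?thesis unfolding at by blast
    next
      case 2
      obtain c where c: "c \<in> A" "V s \<in> D c" using flow_lineD(1)[OF V, of s] s 2 assms by auto
      have Zs: "Z s \<in> D c" using c 2 by (simp add: Z_def)
      have s1: "s \<in> {\<alpha>..\<beta>}" and s2: "s \<in> {\<beta>..\<gamma>}" using 2 assms by auto
      note h = half[OF V s1 ZV c(1) Zs] half[OF W s2 ZW c(1) Zs]
      have "\<forall>\<^sub>F r in at s within {\<alpha>..\<gamma>}. Z r \<in> D c"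
        unfolding I at_within_union eventually_sup using h by blast
      moreover have "((\<lambda>r. k c (Z r)) has_vector_derivative F c (k c (Z s))) (at s within {\<alpha>..\<gamma>})"
        unfolding I using h by (intro has_vector_derivative_within_Un) blast+
      ultimately show ?thesis using c(1) Zs by blast
    qed
  qed
  then show ?thesis by (simp add: Z_def[abs_def])
qed

text \<open>Shortly after s both curves solve one globally Lipschitz equation in a chart, that of
  the cut-off field. Gronwall with equal initial values and error 0 forces equality there.\<close>

lemma flow_line_unique_step:
  assumes V: "flow_line {\<alpha>..\<beta>} V" and W: "flow_line {\<alpha>..\<beta>} W"
    and s: "\<alpha> \<le> s" "s < \<beta>" "V s = W s"
  shows "\<exists>\<epsilon>>0. \<forall>r. s < r \<and> r < s + \<epsilon> \<and> r \<le> \<beta> \<longrightarrow> V r = W r"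
proof -
  have sI: "s \<in> {\<alpha>..\<beta>}" using s by auto
  obtain c where c: "c \<in> A" "V s \<in> D c" using flow_lineD(1)[OF V sI] by blast
  then have cW: "W s \<in> D c" using s by simp
  obtain \<rho> L g where g: "0 < \<rho>" "ball (k c (V s)) \<rho> \<subseteq> k c ` D c" "smooth_on UNIV g"
    "\<And>y. y \<in> ball (k c (V s)) \<rho> \<Longrightarrow> g y = F c y"
    "0 \<le> L" "\<And>y v. norm (frechet_derivative g (at y) v) \<le> L * norm v"
    using that by (rule cutoff[OF field_smooth[OF c(1)] image_open[OF c(1)] imageI[OF c(2)]])
  have near: "\<forall>\<^sub>F r in at s within {\<alpha>..\<beta>}. U r \<in> D c \<and> k c (U r) \<in> ball (k c (V s)) \<rho>"
    if U: "flow_line {\<alpha>..\<beta>} U" "U s = V s" for U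
  proof -
    have Us: "U s \<in> D c" using U c by simp
    have "((\<lambda>r. k c (U r)) \<longlongrightarrow> k c (U s)) (at s within {\<alpha>..\<beta>})"
      using has_vector_derivative_continuous[OF flow_lineD(3)[OF U(1) sI c(1) Us]]
        by (simp add: continuous_within)
    then have "\<forall>\<^sub>F r in at s within {\<alpha>..\<beta>}. k c (U r) \<in> ball (k c (V s)) \<rho>"
      by (rule topological_tendstoD) (use g U in auto)
    with flow_lineD(2)[OF U(1) sI c(1) Us] show ?thesis by eventually_elim simp
  qed
  have "\<forall>\<^sub>F r in at s within {\<alpha>..\<beta>}. (V r \<in> D c \<and> k c (V r) \<in> ball (k c (V s)) \<rho>) \<and>
     (W r \<in> D c \<and> k c (W r) \<in> ball (k c (V s)) \<rho>)"
    by (rule eventually_conj[OF near[OF V refl] near[OF W s(3)[symmetric]]])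
  then obtain \<epsilon> where \<epsilon>: "0 < \<epsilon>" "\<And>r. r \<in> {\<alpha>..\<beta>} \<Longrightarrow> r \<noteq> s \<Longrightarrow> dist r s < \<epsilon> \<Longrightarrow>
     (V r \<in> D c \<and> k c (V r) \<in> ball (k c (V s)) \<rho>) \<and> (W r \<in> D c \<and> k c (W r) \<in> ball (k c (V s)) \<rho>)"
    unfolding eventually_at by blast
  have \<epsilon>': "(V r \<in> D c \<and> k c (V r) \<in> ball (k c (V s)) \<rho>) \<and> (W r \<in> D c \<and> k c (W r) \<in> ball (k c (V s)) \<rho>)"
    if "r \<in> {\<alpha>..\<beta>}" "dist r s < \<epsilon>" for r
    using \<epsilon>(2)[of r] that c cW s(3) g(1) by (cases "r = s") auto
  show ?thesis
  proof (intro exI[of _ \<epsilon>] conjI allI impI)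
    fix r assume r: "s < r \<and> r < s + \<epsilon> \<and> r \<le> \<beta>"
    let ?J = "{s..r}"
    have sub: "?J \<subseteq> {\<alpha>..\<beta>}" using r s by auto
    have J: "q \<in> {\<alpha>..\<beta>}" "dist q s < \<epsilon>" if "q \<in> ?J" for q
      using that r s by (auto simp: dist_real_def)
    have "norm (k c (V r) - k c (W r)) \<le> exp ((L + 1) * (r - s)) * (1 + (r - s)) * (norm (k c (V s) - k c (W s)) + 0)"
    proof (rule gronwall[where w = "\<lambda>r. k c (V r) - k c (W r)" and w' =
      "\<lambda>q. g (k c (V q)) - g (k c (W q))"])
      fix q assume q: "q \<in> ?J"
      note * = \<epsilon>'[OF J[OF q]]
      have "((\<lambda>r. k c (V r)) has_vector_derivative g (k c (V q))) (at q within ?J)"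
        "((\<lambda>r. k c (W r)) has_vector_derivative g (k c (W q))) (at q within ?J)"
        using flow_lineD(3)[OF V J(1)[OF q] c(1)] flow_lineD(3)[OF W J(1)[OF q] c(1)] * g(4)
          has_vector_derivative_within_subset[OF _ sub] by auto
      then show "((\<lambda>r. k c (V r) - k c (W r)) has_vector_derivative g (k c (V q)) - g (k c (W q))) (at q within ?J)"
        by (rule has_vector_derivative_diff)
      show "norm (g (k c (V q)) - g (k c (W q))) \<le> L * norm (k c (V q) - k c (W q)) + 0"
        using bounded_derivative_imp_lipschitz[OF g(3,6)] by simp
    qed (use g r in auto)
    then have eq: "k c (V r) = k c (W r)" using s(3) by simp
    have "V r \<in> D c" "W r \<in> D c" using \<epsilon>'[OF J[of r]] r by auto
    then show "V r = W r" using eq inj[OF c(1)] by (auto simp: inj_on_def)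
  qed (rule \<epsilon>(1))
qed

text \<open>The preceding lemma continues agreement to the right. At a limit time the two points
  might lie in different charts without meeting; \<open>limit_unique\<close> excludes this.\<close>

lemma flow_line_unique:
  assumes V: "flow_line {\<alpha>..\<beta>} V" and W: "flow_line {\<alpha>..\<beta>} W" and "V \<alpha> = W \<alpha>"
    and "s \<in> {\<alpha>..\<beta>}"
  shows "V s = W s"
proof (rule real_induction[where P =
  "\<lambda>s. V s = W s", OF assms(3) flow_line_unique_step[OF V W] _ assms(4)])
  fix s assume s: "\<alpha> < s" "s \<le> \<beta>" and eq: "\<And>r. \<alpha> \<le> r \<Longrightarrow> r < s \<Longrightarrow> V r = W r"
  have sI: "s \<in> {\<alpha>..\<beta>}" using s by auto
  obtain c where c: "c \<in> A" "V s \<in> D c" using flow_lineD(1)[OF V sI] by blast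
  obtain d where d: "d \<in> A" "W s \<in> D d" using flow_lineD(1)[OF W sI] by blast
  have "\<forall>\<^sub>F r in at s within {\<alpha>..\<beta>}. V r \<in> D c \<and> W r \<in> D d"
    using flow_lineD(2)[OF V sI c] flow_lineD(2)[OF W sI d] by (simp add: eventually_conj)
  then obtain \<epsilon> where \<epsilon>: "0 < \<epsilon>" "\<And>r. r \<in> {\<alpha>..\<beta>} \<Longrightarrow> r \<noteq> s \<Longrightarrow> dist r s < \<epsilon> \<Longrightarrow> V r \<in> D c \<and> W r \<in> D d"
    unfolding eventually_at by blast
  \<comment> \<open>Keeps the sequence r in [\<alpha>, s) and so close to s that both charts
    apply.\<close>
  define \<eta> where "\<eta> = min (\<epsilon> / 2) (s - \<alpha>)"
  define r where "r n = s - \<eta> * inverse (real (Suc n))" for n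
  have \<eta>: "0 < \<eta>" using s \<epsilon> by (simp add: \<eta>_def)
  have r: "\<alpha> \<le> r n" "r n < s" "dist (r n) s < \<epsilon>" for n
  proof -
    have i: "0 < inverse (real (Suc n))" "inverse (real (Suc n)) \<le> 1" by (auto simp: field_simps)
    then have "0 < \<eta> * inverse (real (Suc n))" "\<eta> * inverse (real (Suc n)) \<le> \<eta>"
      using \<eta> by (auto intro: mult_pos_pos mult_left_le)
    then show "\<alpha> \<le> r n" "r n < s" "dist (r n) s < \<epsilon>"
      using \<epsilon>(1) unfolding r_def \<eta>_def dist_real_def by auto
  qed
  have "(\<lambda>n. s - \<eta> * inverse (real (Suc n))) \<longlonglongrightarrow> s - \<eta> * 0"
    by (intro tendsto_intros LIMSEQ_inverse_real_of_nat)
  then have "r \<longlonglongrightarrow> s" by (simp add: r_def[abs_def])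
  then have lim: "filterlim r (at s within {\<alpha>..\<beta>}) sequentially"
    unfolding filterlim_at using r s
      by (auto intro!: always_eventually less_imp_le order.trans[OF less_imp_le[OF r(2)]] simp: less_imp_neq)
  have zc: "(\<lambda>n. k c (V (r n))) \<longlonglongrightarrow> k c (V s)"
    using has_vector_derivative_continuous[OF flow_lineD(3)[OF V sI c]] filterlim_compose[OF _ lim]
    by (auto simp: continuous_within)
  have zd: "(\<lambda>n. k d (W (r n))) \<longlonglongrightarrow> k d (W s)"
    using has_vector_derivative_continuous[OF flow_lineD(3)[OF W sI d]] filterlim_compose[OF _ lim]
    by (auto simp: continuous_within)
  have VW: "V (r n) = W (r n)" for n by (rule eq[OF r(1,2)])
  have *: "V (r n) \<in> D c \<and> W (r n) \<in> D d" for n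
    using r[of n] s by (intro \<epsilon>(2)) auto
  show "V s = W s"
  proof (rule limit_unique[OF c(1) d(1) c(2) d(2), of "\<lambda>n. V (r n)"])
    show "V (r n) \<in> D c \<inter> D d" for n using * VW by simp
    show "(\<lambda>n. k d (V (r n))) \<longlonglongrightarrow> k d (W s)" using zd VW by simp
  qed (rule zc)
qed

text \<open>The flow from time \<open>\<alpha>\<close> to time \<open>s\<close> near \<open>x0\<close>, read in the charts \<open>c\<close> and \<open>d\<close>. Smoothness is
  recorded only along curves: this is what \<open>flow_smooth\<close> provides, and all that paths need.\<close>

definition local_flow :: "'i \<Rightarrow> 'f \<Rightarrow> real \<Rightarrow> 'i \<Rightarrow> real \<Rightarrow> real \<Rightarrow> ('f \<Rightarrow> 'f) \<Rightarrow> bool" where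
  "local_flow c x0 \<alpha> d s \<delta> \<Phi> \<longleftrightarrow> 0 < \<delta> \<and> isCont \<Phi> x0 \<and>
     (\<forall>x\<in>ball x0 \<delta>. x \<in> k c ` D c \<and> \<Phi> x \<in> k d ` D d \<and>
        (\<exists>W. flow_line {\<alpha>..s} W \<and> W \<alpha> = kinv c x \<and> W s = kinv d (\<Phi> x))) \<and>
     (\<forall>J l. convex J \<longrightarrow> thick J \<longrightarrow> smooth_on J l \<longrightarrow> l ` J \<subseteq> ball x0 \<delta> \<longrightarrow>
        smooth_on (J :: real set) (\<lambda>t. \<Phi> (l t)))"

lemma local_flowD:
  assumes "local_flow c x0 \<alpha> d s \<delta> \<Phi>" "x \<in> ball x0 \<delta>"
  shows "x \<in> k c ` D c" "\<Phi> x \<in> k d ` D d"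
    "\<exists>W. flow_line {\<alpha>..s} W \<and> W \<alpha> = kinv c x \<and> W s = kinv d (\<Phi> x)"
  using assms unfolding local_flow_def by blast+

text \<open>By continuity of \<Phi> at x0 a smaller ball is mapped into the overlap of e and d,
  where \<Phi> can be followed by the transition map.\<close>

lemma local_flow_change_chart:
  assumes lf: "local_flow c x0 \<alpha> e s \<delta> \<Phi>" and e: "e \<in> A" and d: "d \<in> A"
    and p: "p \<in> D e" "p \<in> D d" "\<Phi> x0 = k e p"
  shows "\<exists>\<delta> \<Phi>. local_flow c x0 \<alpha> d s \<delta> \<Phi>"
proof -
  let ?O = "k e ` (D e \<inter> D d)" and ?\<phi> = "transition (ch e) (ch d)"
  have lf': "0 < \<delta>" "isCont \<Phi> x0" using lf by (auto simp: local_flow_def)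
  have O: "open ?O" by (rule overlap_open[OF e d])
  have "\<forall>\<^sub>F x in nhds x0. \<Phi> x \<in> ?O"
    using lf'(2) O p unfolding continuous_within tendsto_at_iff_tendsto_nhds
      by (intro topological_tendstoD) auto
  then obtain \<delta>1 where \<delta>1: "0 < \<delta>1" "\<And>x. dist x x0 < \<delta>1 \<Longrightarrow> \<Phi> x \<in> ?O"
    unfolding eventually_nhds_metric by blast
  define \<delta>' where "\<delta>' = min \<delta> \<delta>1"
  have in_O: "\<Phi> x \<in> ?O" if "x \<in> ball x0 \<delta>'" for x
    using that by (intro \<delta>1) (auto simp: \<delta>'_def dist_commute)
  have "local_flow c x0 \<alpha> d s \<delta>' (\<lambda>x. ?\<phi> (\<Phi> x))"
    unfolding local_flow_def
  proof (intro conjI ballI allI impI)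
    show "0 < \<delta>'" using lf'(1) \<delta>1(1) by (simp add: \<delta>'_def)
    have "isCont ?\<phi> (k e p)"
      by (rule has_derivative_continuous[OF transition_has_derivative[OF e d p(1,2)]])
    then show "isCont (\<lambda>x. ?\<phi> (\<Phi> x)) x0" using isCont_o2[OF lf'(2)] p(3) by simp
    fix x assume x: "x \<in> ball x0 \<delta>'"
    then have x\<delta>: "x \<in> ball x0 \<delta>" by (simp add: \<delta>'_def)
    then show "x \<in> k c ` D c" using lf by (auto simp: local_flow_def)
    obtain q where q: "q \<in> D e" "q \<in> D d" "\<Phi> x = k e q" using in_O[OF x] by blast
    obtain W where W: "flow_line {\<alpha>..s} W" "W \<alpha> = kinv c x" "W s = kinv e (\<Phi> x)"
      using lf x\<delta> unfolding local_flow_def by blast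
    show "?\<phi> (\<Phi> x) \<in> k d ` D d" using q by (auto simp: transition_k e)
    show "\<exists>W. flow_line {\<alpha>..s} W \<and> W \<alpha> = kinv c x \<and> W s = kinv d (?\<phi> (\<Phi> x))"
      using W q by (intro exI[of _ W]) (simp add: transition_k kinv_k e d)
  next
    fix J :: "real set" and l :: "real \<Rightarrow> 'f"
    assume J: "convex J" "thick J" and l: "smooth_on J l" "l ` J \<subseteq> ball x0 \<delta>'"
    have "l ` J \<subseteq> ball x0 \<delta>" using l(2) by (auto simp: \<delta>'_def)
    then have "smooth_on J (\<lambda>t. \<Phi> (l t))" using lf J l(1) unfolding local_flow_def by blast
    then show "smooth_on J (\<lambda>t. ?\<phi> (\<Phi> (l t)))"
      using in_O l(2) by (intro smooth_on_compose[OF J(2) _ _ transition_smooth[OF e d]]) auto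
  qed
  then show ?thesis by blast
qed

lemma local_flow_initial:
  assumes c: "c \<in> A" "p \<in> D c" and d: "d \<in> A" "p \<in> D d"
  shows "\<exists>\<delta> \<Phi>. local_flow c (k c p) \<alpha> d \<alpha> \<delta> \<Phi>"
proof -
  obtain \<delta> where \<delta>: "0 < \<delta>" "ball (k c p) \<delta> \<subseteq> k c ` D c"
    using image_open[OF c(1)] c(2) by (meson imageI openE)
  have "local_flow c (k c p) \<alpha> c \<alpha> \<delta> (\<lambda>x. x)"
    unfolding local_flow_def
  proof (intro conjI ballI allI impI)
    fix x assume x: "x \<in> ball (k c p) \<delta>"
    have "flow_line {\<alpha>..\<alpha>} (\<lambda>s. kinv c x)"
      using c x \<delta> by (intro flow_line_in_chart[where y = "\<lambda>s. x"])
        (auto simp: has_vector_derivative_def has_derivative_within_singleton_iff bounded_linear_scaleR_left)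
    then show "\<exists>W. flow_line {\<alpha>..\<alpha>} W \<and> W \<alpha> = kinv c x \<and> W \<alpha> = kinv c x" by blast
  qed (use \<delta> in auto)
  from local_flow_change_chart[OF this c(1) d(1) c(2) d(2)] show ?thesis by simp
qed

text \<open>\<epsilon> depends on s0 and works for all pairs s \<le> s' close to it: real induction
  uses s = s0 for the step forward and s' = s0 for the passage to the limit. The local flow up to s
  is followed by the flow of the cut-off field in a single chart e.\<close>

lemma local_flow_step:
  assumes V: "flow_line {\<alpha>..\<beta>} V" and c: "c \<in> A" "V \<alpha> \<in> D c" and s0: "s0 \<in> {\<alpha>..\<beta>}"
  shows "\<exists>\<epsilon>>0. \<forall>s s'. s \<in> {\<alpha>..\<beta>} \<longrightarrow> s' \<in> {\<alpha>..\<beta>} \<longrightarrow> s \<le> s' \<longrightarrow> \<bar>s - s0\<bar> < \<epsilon> \<longrightarrow> \<bar>s' - s0\<bar> < \<epsilon> \<longrightarrow>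
     (\<forall>d\<in>A. V s \<in> D d \<longrightarrow> (\<exists>\<delta> \<Phi>. local_flow c (k c (V \<alpha>)) \<alpha> d s \<delta> \<Phi>)) \<longrightarrow>
     (\<forall>d\<in>A. V s' \<in> D d \<longrightarrow> (\<exists>\<delta> \<Phi>. local_flow c (k c (V \<alpha>)) \<alpha> d s' \<delta> \<Phi>))"
proof -
  let ?x0 = "k c (V \<alpha>)"
  obtain e where e: "e \<in> A" "V s0 \<in> D e" using flow_lineD(1)[OF V s0] by blast
  define xs where "xs = k e (V s0)"
  have xs: "xs \<in> k e ` D e" using e(2) by (simp add: xs_def)
  obtain \<rho> L g where g: "0 < \<rho>" "ball xs \<rho> \<subseteq> k e ` D e" "smooth_on UNIV g"
    "\<And>y. y \<in> ball xs \<rho> \<Longrightarrow> g y = F e y"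
    "0 \<le> L" "\<And>y v. norm (frechet_derivative g (at y) v) \<le> L * norm v"
    using that by (rule cutoff[OF field_smooth[OF e(1)] image_open[OF e(1)] xs])
  have lip: "norm (g u - g v) \<le> L * norm (u - v)" for u v
    by (rule bounded_derivative_imp_lipschitz[OF g(3,6)])
  have "((\<lambda>r. k e (V r)) \<longlongrightarrow> xs) (at s0 within {\<alpha>..\<beta>})"
    using has_vector_derivative_continuous[OF flow_lineD(3)[OF V s0 e]]
      by (simp add: continuous_within xs_def)
  then have "\<forall>\<^sub>F r in at s0 within {\<alpha>..\<beta>}. k e (V r) \<in> ball xs (\<rho> / 2)"
    by (rule topological_tendstoD) (use g in auto)
  with flow_lineD(2)[OF V s0 e]
  have "\<forall>\<^sub>F r in at s0 within {\<alpha>..\<beta>}. V r \<in> D e \<and> k e (V r) \<in> ball xs (\<rho> / 2)"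
    by eventually_elim simp
  then obtain \<epsilon>1 where \<epsilon>1: "0 < \<epsilon>1" "\<And>r. r \<in> {\<alpha>..\<beta>} \<Longrightarrow> r \<noteq> s0 \<Longrightarrow> dist r s0 < \<epsilon>1 \<Longrightarrow>
     V r \<in> D e \<and> k e (V r) \<in> ball xs (\<rho> / 2)"
    unfolding eventually_at by blast
  \<comment> \<open>Two times within \<epsilon> of s0 differ by at most 1 / (2(L + 1)), which gives
    L(s' - s) \<le> 1/2; the other bound keeps V in the middle of the ball.\<close>
  define \<epsilon> where "\<epsilon> = min \<epsilon>1 (1 / (4 * (L + 1)))"
  have \<epsilon>: "0 < \<epsilon>" "\<epsilon> \<le> \<epsilon>1" using \<epsilon>1 g(5) by (auto simp: \<epsilon>_def)
  have Ve: "V r \<in> D e \<and> k e (V r) \<in> ball xs (\<rho> / 2)" if "r \<in> {\<alpha>..\<beta>}" "\<bar>r - s0\<bar> < \<epsilon>" for r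
    using \<epsilon>1(2)[of r] that e(2) g(1) \<epsilon> by (cases "r = s0") (auto simp: dist_real_def xs_def)
  show ?thesis
  proof (rule exI[of _ \<epsilon>], intro conjI allI impI ballI)
    fix s s' d
    assume s: "s \<in> {\<alpha>..\<beta>}" and s': "s' \<in> {\<alpha>..\<beta>}" and ss: "s \<le> s'" "\<bar>s - s0\<bar> < \<epsilon>" "\<bar>s' - s0\<bar> < \<epsilon>"
      and IH: "\<forall>d\<in>A. V s \<in> D d \<longrightarrow> (\<exists>\<delta> \<Phi>. local_flow c ?x0 \<alpha> d s \<delta> \<Phi>)"
      and d: "d \<in> A" "V s' \<in> D d"
    let ?I = "{s..s'}"
    have sub: "?I \<subseteq> {\<alpha>..\<beta>}" using s s' by auto
    have VI: "V r \<in> D e \<and> k e (V r) \<in> ball xs (\<rho> / 2)" if "r \<in> ?I" for r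
      using that ss sub by (intro Ve) auto
    have small: "L * (s' - s) \<le> 1 / 2"
    proof -
      have "s' - s \<le> 2 * (1 / (4 * (L + 1)))" using ss unfolding \<epsilon>_def by linarith
      then have "L * (s' - s) \<le> L * (2 * (1 / (4 * (L + 1))))" using g(5) by (intro mult_left_mono)
      also have "\<dots> \<le> 1 / 2" using g(5) by (simp add: field_simps)
      finally show ?thesis .
    qed
    have "V s \<in> D e" using VI[of s] ss by simp
    with IH e(1) obtain \<delta> \<Phi> where lf: "local_flow c ?x0 \<alpha> e s \<delta> \<Phi>" by blast
    have hc: "continuous_on (?I \<times> UNIV) (\<lambda>(s, u). g u)"
      using continuous_on_compose2[OF smooth_on_continuous[OF g(3)] continuous_on_snd[OF continuous_on_id]]
      by (auto simp: case_prod_unfold)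
    \<comment> \<open>The cut-off field is globally Lipschitz, so solutions exist from every z
      during the whole time from s to s'.\<close>
    have "\<forall>z. \<exists>y. y s = z \<and> (\<forall>r\<in>?I. (y has_vector_derivative g (y r)) (at r within ?I))"
    proof
      fix z
      show "\<exists>y. y s = z \<and> (\<forall>r\<in>?I. (y has_vector_derivative g (y r)) (at r within ?I))"
      proof (rule picard[of s s' "\<lambda>_. g" L z, OF ss(1) hc lip g(5) small])
        fix y assume "y s = z" "\<And>r. r \<in> ?I \<Longrightarrow> (y has_vector_derivative g (y r)) (at r within ?I)"
        then show "\<exists>y. y s = z \<and> (\<forall>r\<in>?I. (y has_vector_derivative g (y r)) (at r within ?I))" by blast
      qed
    qed
    from choice[OF this] obtain Y where Y: "\<And>z. Y z s = z"
      "\<And>z r. r \<in> ?I \<Longrightarrow> (Y z has_vector_derivative g (Y z r)) (at r within ?I)" by blast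
    define G where "G = exp ((L + 1) * (s' - s)) * (1 + (s' - s))"
    have G: "0 < G" using ss by (auto simp: G_def intro!: mult_pos_pos)
    have close: "norm (u r - v r) \<le> G * norm (u s - v s)"
      if "r \<in> ?I" "\<And>r. r \<in> ?I \<Longrightarrow> (u has_vector_derivative g (u r)) (at r within ?I)"
        "\<And>r. r \<in> ?I \<Longrightarrow> (v has_vector_derivative g (v r)) (at r within ?I)" for u v r
    proof -
      have "norm (u r - v r) \<le> exp ((L + 1) * (s' - s)) * (1 + (s' - s)) * (norm (u s - v s) + 0)"
        by (rule gronwall[OF has_vector_derivative_diff[OF that(2,3)] _ g(5) _ that(1)]) (use lip in auto)
      then show ?thesis by (simp add: G_def)
    qed
    have Vsol: "((\<lambda>r. k e (V r)) has_vector_derivative g (k e (V r))) (at r within ?I)" if r: "r \<in> ?I"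
      for r
    proof -
      have "k e (V r) \<in> ball xs \<rho>" using VI[OF r] g(1) by auto
      then have "g (k e (V r)) = F e (k e (V r))" by (rule g(4))
      moreover have "r \<in> {\<alpha>..\<beta>}" using r sub by blast
      ultimately show ?thesis
        using flow_lineD(3)[OF V _ e(1), of r] VI[OF r] has_vector_derivative_within_subset[OF _ sub]
          by simp
    qed
    have \<Phi>: "0 < \<delta>" "isCont \<Phi> ?x0" using lf by (auto simp: local_flow_def)
    \<comment> \<open>The value at x0 is the end of some flow line from V \<alpha>, and by
      uniqueness this line is V.\<close>
    have \<Phi>0: "\<Phi> ?x0 = k e (V s)"
    proof -
      have "?x0 \<in> ball ?x0 \<delta>" using \<Phi> by simp
      then obtain W where W: "flow_line {\<alpha>..s} W" "W \<alpha> = kinv c ?x0" "W s = kinv e (\<Phi> ?x0)"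
        "\<Phi> ?x0 \<in> k e ` D e"
        using lf unfolding local_flow_def by blast
      have "V s = W s"
      proof (rule flow_line_unique[OF _ W(1)])
        show "flow_line {\<alpha>..s} V" using V s by (auto intro: flow_line_subset)
        show "V \<alpha> = W \<alpha>" using W(2) c by (simp add: kinv_k)
      qed (use s in auto)
      then show ?thesis using W(3,4) by (simp add: k_kinv)
    qed
    \<comment> \<open>An initial deviation below \<eta> grows to less than G \<eta> = \<rho> / 2. As
      V stays within \<rho> / 2 of the centre, the solution remains in the ball where g agrees with
      the field.\<close>
    define \<eta> where "\<eta> = \<rho> / (2 * G)"
    have \<eta>: "0 < \<eta>" using g(1) G by (simp add: \<eta>_def)
    obtain \<delta>1 where \<delta>1: "0 < \<delta>1" "\<And>x. dist x ?x0 < \<delta>1 \<Longrightarrow> dist (\<Phi> x) (k e (V s)) < \<eta>"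
      using \<Phi>(2) \<eta> unfolding continuous_at_eps_delta \<Phi>0 by blast
    define \<delta>' where "\<delta>' = min \<delta> \<delta>1"
    have inball: "Y (\<Phi> x) r \<in> ball xs \<rho>" if x: "x \<in> ball ?x0 \<delta>'" and r: "r \<in> ?I" for x r
    proof -
      have "norm (Y (\<Phi> x) r - k e (V r)) \<le> G * norm (Y (\<Phi> x) s - k e (V s))"
        by (rule close[OF r Y(2) Vsol])
      also have "\<dots> < G * \<eta>" using \<delta>1(2)[of x] x G
        by (auto simp: Y(1) \<delta>'_def dist_commute dist_norm norm_minus_commute)
      also have "\<dots> = \<rho> / 2" using G by (simp add: \<eta>_def)
      finally have "dist (k e (V r)) (Y (\<Phi> x) r) < \<rho> / 2" by (simp add: dist_norm norm_minus_commute)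
      moreover have "dist xs (k e (V r)) < \<rho> / 2" using VI[OF r] by simp
      ultimately show ?thesis using dist_triangle[of xs "Y (\<Phi> x) r" "k e (V r)"] by simp
    qed
    have "local_flow c ?x0 \<alpha> e s' \<delta>' (\<lambda>x. Y (\<Phi> x) s')"
      unfolding local_flow_def
    proof (intro conjI ballI allI impI)
      show "0 < \<delta>'" using \<Phi> \<delta>1 by (simp add: \<delta>'_def)
      show "isCont (\<lambda>x. Y (\<Phi> x) s') ?x0"
        unfolding continuous_at_eps_delta
      proof (intro allI impI)
        fix \<epsilon>' :: real assume "0 < \<epsilon>'"
        then have "0 < \<epsilon>' / G" using G by simp
        then obtain \<delta>2 where \<delta>2: "0 < \<delta>2" "\<And>x. dist x ?x0 < \<delta>2 \<Longrightarrow> dist (\<Phi> x) (\<Phi> ?x0) < \<epsilon>' / G"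
          using \<Phi>(2) unfolding continuous_at_eps_delta by blast
        show "\<exists>\<delta>>0. \<forall>x. dist x ?x0 < \<delta> \<longrightarrow> dist (Y (\<Phi> x) s') (Y (\<Phi> ?x0) s') < \<epsilon>'"
        proof (intro exI[of _ \<delta>2] conjI allI impI \<delta>2(1))
          fix x assume "dist x ?x0 < \<delta>2"
          then have "dist (\<Phi> x) (\<Phi> ?x0) < \<epsilon>' / G" by (rule \<delta>2(2))
          then have "G * dist (\<Phi> x) (\<Phi> ?x0) < \<epsilon>'" using G by (simp add: field_simps)
          moreover have "norm (Y (\<Phi> x) s' - Y (\<Phi> ?x0) s') \<le> G * norm (Y (\<Phi> x) s - Y (\<Phi> ?x0) s)"
            by (rule close[OF _ Y(2) Y(2)]) (use ss in auto)
          ultimately show "dist (Y (\<Phi> x) s') (Y (\<Phi> ?x0) s') < \<epsilon>'" by (simp add: Y(1) dist_norm)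
        qed
      qed
      fix x assume x: "x \<in> ball ?x0 \<delta>'"
      then have x\<delta>: "x \<in> ball ?x0 \<delta>" by (simp add: \<delta>'_def)
      then show "x \<in> k c ` D c" using lf by (auto simp: local_flow_def)
      show "Y (\<Phi> x) s' \<in> k e ` D e" using inball[OF x, of s'] ss g(2) by auto
      obtain W where W: "flow_line {\<alpha>..s} W" "W \<alpha> = kinv c x" "W s = kinv e (\<Phi> x)"
        using lf x\<delta> unfolding local_flow_def by blast
      have Z: "flow_line ?I (\<lambda>r. kinv e (Y (\<Phi> x) r))"
      proof (rule flow_line_in_chart[OF e(1)])
        fix r assume r: "r \<in> ?I"
        show "Y (\<Phi> x) r \<in> k e ` D e" using inball[OF x r] g(2) by blast
        show "(Y (\<Phi> x) has_vector_derivative F e (Y (\<Phi> x) r)) (at r within ?I)"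
          using Y(2)[OF r, of "\<Phi> x"] g(4)[OF inball[OF x r]] by simp
      qed
      have "flow_line {\<alpha>..s'} (\<lambda>r. if r \<le> s then W r else kinv e (Y (\<Phi> x) r))"
        by (rule flow_line_join[OF W(1) Z]) (use W(3) Y(1) s ss in auto)
      moreover have "(if s' \<le> s then W s' else kinv e (Y (\<Phi> x) s')) = kinv e (Y (\<Phi> x) s')"
        using ss(1) W(3) Y(1) by (cases "s' = s") auto
      ultimately show "\<exists>W. flow_line {\<alpha>..s'} W \<and> W \<alpha> = kinv c x \<and> W s' = kinv e (Y (\<Phi> x) s')"
        using W(2) s by (intro exI[of _ "\<lambda>r. if r \<le> s then W r else kinv e (Y (\<Phi> x) r)"]) auto
    next
      fix J :: "real set" and l :: "real \<Rightarrow> 'f"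
      assume J: "convex J" "thick J" and l: "smooth_on J l" "l ` J \<subseteq> ball ?x0 \<delta>'"
      have "l ` J \<subseteq> ball ?x0 \<delta>" using l(2) by (auto simp: \<delta>'_def)
      then have sm: "smooth_on J (\<lambda>t. \<Phi> (l t))" using lf J l(1) unfolding local_flow_def by blast
      show "smooth_on J (\<lambda>t. Y (\<Phi> (l t)) s')"
        by (rule flow_smooth[OF J ss(1) g(3,6,5) small, of "\<lambda>s t. Y (\<Phi> (l t)) s"]) (use sm Y in auto)
    qed
    then show "\<exists>\<delta> \<Phi>. local_flow c ?x0 \<alpha> d s' \<delta> \<Phi>"
    proof -
      have s'I: "s' \<in> ?I" using ss by auto
      have "norm (Y (\<Phi> ?x0) s' - k e (V s')) \<le> G * norm (Y (\<Phi> ?x0) s - k e (V s))"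
        by (rule close[OF s'I Y(2) Vsol])
      then have "Y (\<Phi> ?x0) s' = k e (V s')" by (simp add: Y(1) \<Phi>0)
      then show ?thesis
        using local_flow_change_chart[OF \<open>local_flow c ?x0 \<alpha> e s' \<delta>' (\<lambda>x. Y (\<Phi> x) s')\<close> e(1) d(1) _ d(2)] VI[OF s'I] by blast
    qed
  qed (rule \<epsilon>(1))
qed

lemma local_flow_exists:
  assumes V: "flow_line {\<alpha>..\<beta>} V" and c: "c \<in> A" "V \<alpha> \<in> D c" and d: "d \<in> A" "V \<beta> \<in> D d" and "\<alpha> \<le> \<beta>"
  obtains \<delta> \<Phi> where "local_flow c (k c (V \<alpha>)) \<alpha> d \<beta> \<delta> \<Phi>"
proof -
  define P where "P s \<longleftrightarrow> (\<forall>d\<in>A. V s \<in> D d \<longrightarrow> (\<exists>\<delta> \<Phi>. local_flow c (k c (V \<alpha>)) \<alpha> d s \<delta> \<Phi>))" for s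
  have "P \<beta>"
  proof (rule real_induction[where P = P])
    show "P \<alpha>" using local_flow_initial[OF c] by (simp add: P_def)
  next
    fix s assume s: "\<alpha> \<le> s" "s < \<beta>" "P s"
    then have sI: "s \<in> {\<alpha>..\<beta>}" by auto
    obtain \<epsilon> where \<epsilon>: "0 < \<epsilon>"
      "\<And>q r. q \<in> {\<alpha>..\<beta>} \<Longrightarrow> r \<in> {\<alpha>..\<beta>} \<Longrightarrow> q \<le> r \<Longrightarrow> \<bar>q - s\<bar> < \<epsilon> \<Longrightarrow> \<bar>r - s\<bar> < \<epsilon> \<Longrightarrow> P q \<Longrightarrow> P r"
      using local_flow_step[OF V c sI] unfolding P_def by blast
    show "\<exists>\<epsilon>>0. \<forall>r. s < r \<and> r < s + \<epsilon> \<and> r \<le> \<beta> \<longrightarrow> P r"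
    proof (intro exI[of _ \<epsilon>] conjI allI impI \<epsilon>(1))
      fix r assume "s < r \<and> r < s + \<epsilon> \<and> r \<le> \<beta>"
      then show "P r" using s sI \<epsilon>(1) by (intro \<epsilon>(2)[of s r]) auto
    qed
  next
    fix s assume s: "\<alpha> < s" "s \<le> \<beta>" and below: "\<And>r. \<alpha> \<le> r \<Longrightarrow> r < s \<Longrightarrow> P r"
    then have sI: "s \<in> {\<alpha>..\<beta>}" by auto
    obtain \<epsilon> where \<epsilon>: "0 < \<epsilon>"
      "\<And>q r. q \<in> {\<alpha>..\<beta>} \<Longrightarrow> r \<in> {\<alpha>..\<beta>} \<Longrightarrow> q \<le> r \<Longrightarrow> \<bar>q - s\<bar> < \<epsilon> \<Longrightarrow> \<bar>r - s\<bar> < \<epsilon> \<Longrightarrow> P q \<Longrightarrow> P r"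
      using local_flow_step[OF V c sI] unfolding P_def by blast
    define q where "q = max \<alpha> (s - \<epsilon> / 2)"
    have q: "\<alpha> \<le> q" "q < s" "\<bar>q - s\<bar> < \<epsilon>" using s \<epsilon>(1) by (auto simp: q_def)
    show "P s" using q s sI \<epsilon>(1) below[OF q(1,2)] by (intro \<epsilon>(2)[of q s]) auto
  qed (use assms in auto)
  then show thesis using that d unfolding P_def by blast
qed

section \<open>The time-one flow: domain and end points\<close>

definition flow_dom :: "'n set" where
  "flow_dom = {p. \<exists>V. flow_line {0..1} V \<and> V 0 = p}"

definition flow_end :: "'n \<Rightarrow> 'n" where
  "flow_end p = (SOME V. flow_line {0..1} V \<and> V 0 = p) 1"

lemma flow_end_eq:
  assumes "flow_line {0..1} V" shows "flow_end (V 0) = V 1"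
proof -
  have "\<exists>W. flow_line {0..1} W \<and> W 0 = V 0" using assms by blast
  then have W: "flow_line {0..1} (SOME W. flow_line {0..1} W \<and> W 0 = V 0) \<and>
      (SOME W. flow_line {0..1} W \<and> W 0 = V 0) 0 = V 0"
    by (rule someI_ex)
  show ?thesis unfolding flow_end_def
    by (rule flow_line_unique[OF _ assms]) (use W in auto)
qed

text \<open>The local flow along the whole flow line of p provides flow lines up to time 1 for all
  points of a coordinate ball.\<close>

lemma flow_dom_open:
  assumes "p \<in> flow_dom" "c \<in> A" "p \<in> D c"
  obtains \<delta> where "0 < \<delta>" "\<And>q. q \<in> D c \<Longrightarrow> dist (k c q) (k c p) < \<delta> \<Longrightarrow> q \<in> flow_dom"
proof -
  obtain V where V: "flow_line {0..1} V" "V 0 = p" using assms(1) by (auto simp: flow_dom_def)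
  obtain d where d: "d \<in> A" "V 1 \<in> D d" using flow_lineD(1)[OF V(1), of 1] by auto
  obtain \<delta> \<Phi> where lf: "local_flow c (k c p) 0 d 1 \<delta> \<Phi>"
    using local_flow_exists[OF V(1) assms(2) _ d] V(2) assms(3) by auto
  show thesis
  proof (rule that)
    show "0 < \<delta>" using lf by (simp add: local_flow_def)
    fix q assume q: "q \<in> D c" "dist (k c q) (k c p) < \<delta>"
    then have "k c q \<in> ball (k c p) \<delta>" by (simp add: dist_commute)
    from local_flowD(3)[OF lf this] obtain W where "flow_line {0..1} W" "W 0 = kinv c (k c q)" by blast
    then show "q \<in> flow_dom" using q assms(2) by (auto simp: flow_dom_def kinv_k)
  qed
qed

text \<open>By uniqueness the flow line chosen in \<open>flow_end\<close> may be replaced by the one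
  that a local flow around l t provides. Near t the curve is therefore \<Phi> after l in
  coordinates.\<close>

lemma flow_end_smooth:
  assumes I: "convex I" "thick I" and l: "smooth_curve_on (ch ` A) I l" and dom: "l ` I \<subseteq> flow_dom"
  shows "smooth_curve_on (ch ` A) I (\<lambda>t. flow_end (l t))"
proof -
  have exV: "\<exists>V. flow_line {0..1} V \<and> V 0 = l t" if "t \<in> I" for t
    using dom that unfolding flow_dom_def by blast
  have cover: "flow_end (l t) \<in> (\<Union>c\<in>ch ` A. dom_of c)" if t: "t \<in> I" for t
  proof -
    obtain V where V: "flow_line {0..1} V" "V 0 = l t" using exV[OF t] by blast
    then show ?thesis using flow_lineD(1)[OF V(1), of 1] flow_end_eq[OF V(1)] by auto
  qed
  have "\<exists>\<epsilon>>0. (\<lambda>t. flow_end (l t)) ` (I \<inter> ball t \<epsilon>) \<subseteq> D d \<and> smooth_on (I \<inter> ball t \<epsilon>) (\<lambda>r. k d (flow_end (l r)))"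
    if t: "t \<in> I" and d: "d \<in> A" "flow_end (l t) \<in> D d" for t d
  proof -
    obtain V where V: "flow_line {0..1} V" "V 0 = l t" using exV[OF t] by blast
    have V1: "V 1 \<in> D d" using d(2) flow_end_eq[OF V(1)] V(2) by simp
    obtain c where c: "c \<in> A" "l t \<in> D c" using flow_lineD(1)[OF V(1), of 0] V(2) by auto
    obtain \<delta> \<Phi> where lf: "local_flow c (k c (l t)) 0 d 1 \<delta> \<Phi>"
      using local_flow_exists[OF V(1) c(1) _ d(1) V1] V(2) c by auto
    obtain \<epsilon>1 where \<epsilon>1: "0 < \<epsilon>1" "l ` (I \<inter> ball t \<epsilon>1) \<subseteq> D c" "smooth_on (I \<inter> ball t \<epsilon>1) (\<lambda>r. k c (l r))"
      using l t c unfolding smooth_curve_on_def by blast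
    have "0 < \<delta>" using lf by (simp add: local_flow_def)
    then obtain \<epsilon>2 where \<epsilon>2: "0 < \<epsilon>2"
      "\<And>r. r \<in> I \<inter> ball t \<epsilon>1 \<Longrightarrow> dist r t < \<epsilon>2 \<Longrightarrow> dist (k c (l r)) (k c (l t)) < \<delta>"
    proof -
      have "t \<in> I \<inter> ball t \<epsilon>1" using t \<epsilon>1(1) by simp
      then have "\<exists>\<epsilon>2>0. \<forall>r\<in>I \<inter> ball t \<epsilon>1. dist r t < \<epsilon>2 \<longrightarrow> dist (k c (l r)) (k c (l t)) < \<delta>"
        using smooth_on_continuous[OF \<epsilon>1(3)] \<open>0 < \<delta>\<close> unfolding continuous_on_iff by blast
      with that show ?thesis by blast
    qed
    define \<epsilon> where "\<epsilon> = min \<epsilon>1 \<epsilon>2"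
    let ?J = "I \<inter> ball t \<epsilon>"
    have J: "convex ?J" "thick ?J" using I by (auto intro: convex_Int thick_Int_open)
    have lJ: "l r \<in> D c" "k c (l r) \<in> ball (k c (l t)) \<delta>" if "r \<in> ?J" for r
      using that \<epsilon>1(2) \<epsilon>2(2)[of r] by (auto simp: \<epsilon>_def dist_commute)
    have end_eq: "flow_end (l r) = kinv d (\<Phi> (k c (l r))) \<and> \<Phi> (k c (l r)) \<in> k d ` D d" if r: "r \<in> ?J"
      for r
    proof -
      obtain W where W: "flow_line {0..1} W" "W 0 = kinv c (k c (l r))" "W 1 = kinv d (\<Phi> (k c (l r)))"
        "\<Phi> (k c (l r)) \<in> k d ` D d"
        using local_flowD(2,3)[OF lf lJ(2)[OF r]] by blast
      moreover have "W 0 = l r" using W(2) lJ[OF r] c by (simp add: kinv_k)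
      ultimately show ?thesis using flow_end_eq[OF W(1)] by simp
    qed
    have "smooth_on ?J (\<lambda>r. k c (l r))"
      by (rule smooth_on_subset[OF \<epsilon>1(3) J(2)]) (auto simp: \<epsilon>_def)
    moreover have "(\<lambda>r. k c (l r)) ` ?J \<subseteq> ball (k c (l t)) \<delta>" using lJ(2) by blast
    ultimately have "smooth_on ?J (\<lambda>r. \<Phi> (k c (l r)))"
      using lf J unfolding local_flow_def by blast
    then have "smooth_on ?J (\<lambda>r. k d (flow_end (l r)))"
      by (rule smooth_on_cong[THEN iffD1, rotated]) (simp add: end_eq k_kinv)
    moreover have "(\<lambda>t. flow_end (l t)) ` ?J \<subseteq> D d" using end_eq kinv_in by auto
    moreover have "0 < \<epsilon>" using \<epsilon>1 \<epsilon>2 by (simp add: \<epsilon>_def)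
    ultimately show ?thesis by blast
  qed
  then show ?thesis using cover unfolding smooth_curve_on_def by blast
qed

end

section \<open>The tangent bundle\<close>

text \<open>For the inverses R one has R y - R x = - R y (L y - L x) R x. This gives continuity of R
  and then the derivative - R L' R, which contains R but none of its derivatives, so that smoothness
  bootstraps. Vectors \<xi> are kept fixed instead of working in a space of operators.\<close>

lemma smooth_on_inv_linear:
  fixes L :: "'a::euclidean_space \<Rightarrow> 'e::euclidean_space \<Rightarrow> 'e"
  assumes S: "open S" and lin: "\<And>x. x \<in> S \<Longrightarrow> linear (L x)" and inj: "\<And>x. x \<in> S \<Longrightarrow> inj (L x)"
    and sm: "\<And>v. smooth_on S (\<lambda>x. L x v)"
  shows "smooth_on S (\<lambda>x. inv (L x) \<xi>)"
proof -
  define R where "R x = inv (L x)" for x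
  have surj: "surj (L x)" if "x \<in> S" for x
    using linear_injective_imp_surjective[OF lin inj] that by blast
  have LR: "L x (R x v) = v" if "x \<in> S" for x v
    unfolding R_def by (rule surj_f_inv_f[OF surj[OF that]])
  have RL: "R x (L x v) = v" if "x \<in> S" for x v
    unfolding R_def by (rule inv_f_f[OF inj[OF that]])
  have Rlin: "linear (R x)" if x: "x \<in> S" for x
  proof (rule linearI)
    show "R x (a + b) = R x a + R x b" for a b
      using RL[OF x, of "R x a + R x b"] LR[OF x] linear_add[OF lin[OF x]] by metis
    show "R x (r *\<^sub>R b) = r *\<^sub>R R x b" for r b
      using RL[OF x, of "r *\<^sub>R R x b"] LR[OF x] linear_scale[OF lin[OF x]] by metis
  qed
  have Ldiff: "L y v - L x v = (\<Sum>i\<in>Basis. (v \<bullet> i) *\<^sub>R (L y i - L x i))" if "x \<in> S" "y \<in> S" for x y v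
    by (subst (1 2) linear_sum_Basis[OF lin]) (use that in \<open>simp_all add: sum_subtractf scaleR_diff_right\<close>)
  have Lder: "((\<lambda>y. L y v) has_derivative frechet_derivative (\<lambda>y. L y v) (at x)) (at x)" if "x \<in> S"
    for x v
    by (rule smooth_on_has_derivative[OF sm S that])
  have identity: "R y \<xi> = R x \<xi> - (\<Sum>j\<in>Basis. ((L y (R x \<xi>) - L x (R x \<xi>)) \<bullet> j) *\<^sub>R R y j)"
    if x: "x \<in> S" and y: "y \<in> S" for x y \<xi>
  proof -
    have "R y \<xi> - R x \<xi> = R y \<xi> - R y (L y (R x \<xi>))" using RL[OF y] by simp
    also have "\<dots> = - R y (L y (R x \<xi>) - L x (R x \<xi>))"
      using LR[OF x] by (simp add: linear_diff[OF Rlin[OF y]])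
    also have "\<dots> = - (\<Sum>j\<in>Basis. ((L y (R x \<xi>) - L x (R x \<xi>)) \<bullet> j) *\<^sub>R R y j)"
      by (subst linear_sum_Basis[OF Rlin[OF y]]) simp
    finally show ?thesis by (simp add: algebra_simps)
  qed
  have cont: "isCont (\<lambda>y. R y \<xi>) x" if x: "x \<in> S" for x \<xi>
  proof -
    \<comment> \<open>An injective linear map is bounded below by some a > 0. While the deviation q
      y of L y is under a / 2, the map L y is bounded below by a / 2, which controls R y uniformly
      near x.\<close>
    obtain a where a: "0 < a" "\<And>v. a * norm v \<le> norm (L x v)"
      using linear_inj_bounded_below_pos[OF lin[OF x] inj[OF x]] by blast
    define q where "q y = (\<Sum>i\<in>Basis. norm (L y i - L x i))" for y
    have Lc: "isCont (\<lambda>y. L y v) x" for v by (rule has_derivative_continuous[OF Lder[OF x]])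
    have "isCont q x" unfolding q_def by (intro continuous_intros Lc)
    then have "(q \<longlongrightarrow> 0) (at x)" by (simp add: isCont_def q_def)
    then have "\<forall>\<^sub>F y in at x. q y < a / 2" using a(1) by (intro order_tendstoD(2)) auto
    moreover have "\<forall>\<^sub>F y in at x. y \<in> S" using eventually_at_topological S x by blast
    ultimately have ev: "\<forall>\<^sub>F y in at x. norm (R y \<xi> - R x \<xi>) \<le> 2 / a * norm (L y (R x \<xi>) - L x (R x \<xi>))"
    proof eventually_elim
      fix y assume q: "q y < a / 2" and y: "y \<in> S"
      have low: "a / 2 * norm v \<le> norm (L y v)" for v
      proof -
        have "norm (L y v - L x v) \<le> (\<Sum>i\<in>(Basis::'e set). norm v * norm (L y i - L x i))"
          by (subst Ldiff[OF x y], rule sum_norm_le) (auto intro!: mult_right_mono Basis_le_norm)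
        also have "\<dots> = q y * norm v" by (simp add: q_def sum_distrib_left mult.commute)
        also have "\<dots> \<le> a / 2 * norm v" using q by (intro mult_right_mono) auto
        finally have 1: "norm (L y v - L x v) \<le> a / 2 * norm v" .
        have "norm (L x v) - norm (L y v) \<le> norm (L y v - L x v)"
          using norm_triangle_ineq2[of "L x v" "L y v"] by (simp add: norm_minus_commute)
        then show ?thesis using 1 a(2)[of v] by (simp add: field_simps)
      qed
      have "L y (R y \<xi> - R x \<xi>) = - (L y (R x \<xi>) - L x (R x \<xi>))"
        using LR[OF x] LR[OF y] by (simp add: linear_diff[OF lin[OF y]])
      then have "a / 2 * norm (R y \<xi> - R x \<xi>) \<le> norm (L y (R x \<xi>) - L x (R x \<xi>))"
        using low[of "R y \<xi> - R x \<xi>"] by (metis norm_minus_cancel)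
      then show "norm (R y \<xi> - R x \<xi>) \<le> 2 / a * norm (L y (R x \<xi>) - L x (R x \<xi>))"
        using a(1) by (simp add: field_simps)
    qed
    have "((\<lambda>y. 2 / a * norm (L y (R x \<xi>) - L x (R x \<xi>))) \<longlongrightarrow> 2 / a * norm (L x (R x \<xi>) - L x (R x \<xi>))) (at x)"
      using Lc by (intro tendsto_intros) (simp add: isCont_def)
    then have "((\<lambda>y. R y \<xi> - R x \<xi>) \<longlongrightarrow> 0) (at x)"
      by (intro Lim_null_comparison[OF ev]) simp
    then show ?thesis unfolding isCont_def by (rule LIM_zero_cancel)
  qed
  \<comment> \<open>As f vanishes at x, continuity of r is enough for the product to be
    differentiable there. This permits differentiating \<open>identity\<close> while R is only known
    to be continuous.\<close>
  have product: "((\<lambda>y. f y *\<^sub>R r y) has_derivative (\<lambda>z. f' z *\<^sub>R r x)) (at x)"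
    if f: "(f has_derivative f') (at x)" "f x = 0" and r: "isCont r x" for f ::
      "'a \<Rightarrow> real" and f' x and r :: "'a \<Rightarrow> 'e"
  proof -
    have d: "((\<lambda>y. f y *\<^sub>R r x) has_derivative (\<lambda>z. f' z *\<^sub>R r x)) (at x)"
      by (rule has_derivative_scaleR_left[OF f(1)])
    have "((\<lambda>y. f y *\<^sub>R (r y - r x)) has_derivative (\<lambda>z. 0)) (at x)"
    proof -
      obtain K where K: "0 < K" "\<And>z. norm (f' z) \<le> norm z * K"
        using bounded_linear.pos_bounded[OF has_derivative_bounded_linear[OF f(1)]] by blast
      show ?thesis
        unfolding has_derivative_at_alt
      proof (intro conjI allI impI)
        fix e :: real assume e: "0 < e"
        obtain d1 where d1: "0 < d1"
          "\<And>y. norm (y - x) < d1 \<Longrightarrow> norm (f y - f x - f' (y - x)) \<le> 1 * norm (y - x)"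
          using f(1) unfolding has_derivative_at_alt by (metis zero_less_one)
        have "0 < e / (K + 1)" using e K by simp
        then obtain d2 where d2: "0 < d2" "\<And>y. dist y x < d2 \<Longrightarrow> dist (r y) (r x) < e / (K + 1)"
          using r unfolding continuous_at_eps_delta by blast
        show "\<exists>d>0. \<forall>y. norm (y - x) < d \<longrightarrow>
            norm (f y *\<^sub>R (r y - r x) - f x *\<^sub>R (r x - r x) - 0) \<le> e * norm (y - x)"
        proof (intro exI[of _ "min d1 d2"] conjI allI impI)
          fix y assume y: "norm (y - x) < min d1 d2"
          have "\<bar>f y\<bar> \<le> norm (f y - f x - f' (y - x)) + norm (f' (y - x))"
            using norm_triangle_ineq[of "f y - f x - f' (y - x)" "f' (y - x)"] f(2) by simp
          also have "\<dots> \<le> norm (y - x) + norm (y - x) * K" using d1(2)[of y] K(2) y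
            by (intro add_mono) auto
          finally have 1: "\<bar>f y\<bar> \<le> norm (y - x) * (K + 1)" by (simp add: algebra_simps)
          have 2: "norm (r y - r x) \<le> e / (K + 1)" using d2(2)[of y] y by (simp add: dist_norm)
          have "norm (f y *\<^sub>R (r y - r x)) \<le> norm (y - x) * (K + 1) * (e / (K + 1))"
            unfolding norm_scaleR using 1 2 K by (intro mult_mono) auto
          also have "\<dots> = e * norm (y - x)" using K by simp
          finally show "norm (f y *\<^sub>R (r y - r x) - f x *\<^sub>R (r x - r x) - 0) \<le> e * norm (y - x)" by simp
        qed (use d1 d2 in auto)
      qed (rule bounded_linear_zero)
    qed
    from has_derivative_add[OF d this] show ?thesis by (simp add: algebra_simps)
  qed
  have "C_k_on k S (\<lambda>x. R x \<xi>)" for k \<xi>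
  proof (induction k arbitrary: \<xi>)
    case 0
    show ?case using cont by (simp add: continuous_at_imp_continuous_on)
  next
    case (Suc k)
    \<comment> \<open>E x z is the derivative of L in direction z, applied to the vector R x
      \<xi>.\<close>
    define E where "E x z = (\<Sum>i\<in>Basis. (R x \<xi> \<bullet> i) *\<^sub>R frechet_derivative (\<lambda>y. L y i) (at x) z)" for x z
    have thS: "thick S" by (rule thick_open[OF S])
    show ?case
    proof (rule C_k_on_SucI[OF thS])
      fix x assume x: "x \<in> S"
      have "((\<lambda>y. \<Sum>i\<in>Basis. (R x \<xi> \<bullet> i) *\<^sub>R L y i) has_derivative E x) (at x)"
        unfolding E_def by (intro has_derivative_sum has_derivative_scaleR_right Lder x)
      then have "((\<lambda>y. L y (R x \<xi>)) has_derivative E x) (at x)"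
        by (rule has_derivative_transform_within_open[OF _ S x])
          (simp add: linear_sum_Basis[OF lin, of _ "R x \<xi>", symmetric])
      then have "((\<lambda>y. L y (R x \<xi>) - L x (R x \<xi>)) has_derivative (\<lambda>z. E x z - 0)) (at x)"
        by (intro has_derivative_diff has_derivative_const)
      then have "((\<lambda>y. (L y (R x \<xi>) - L x (R x \<xi>)) \<bullet> j) has_derivative (\<lambda>z. E x z \<bullet> j)) (at x)" for j
        using has_derivative_inner_left by fastforce
      then have "((\<lambda>y. ((L y (R x \<xi>) - L x (R x \<xi>)) \<bullet> j) *\<^sub>R R y j) has_derivative (\<lambda>z. (E x z \<bullet> j) *\<^sub>R R x j)) (at x)" for j
        by (rule product[OF _ _ cont[OF x]]) simp
      then have "((\<lambda>y. R x \<xi> - (\<Sum>j\<in>Basis. ((L y (R x \<xi>) - L x (R x \<xi>)) \<bullet> j) *\<^sub>R R y j)) has_derivative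
          (\<lambda>z. 0 - (\<Sum>j\<in>Basis. (E x z \<bullet> j) *\<^sub>R R x j))) (at x)"
        by (intro has_derivative_diff has_derivative_const has_derivative_sum)
      then have "((\<lambda>y. R y \<xi>) has_derivative (\<lambda>z. 0 - (\<Sum>j\<in>Basis. (E x z \<bullet> j) *\<^sub>R R x j))) (at x)"
        by (rule has_derivative_transform_within_open[OF _ S x]) (rule identity[OF x, symmetric])
      then show "((\<lambda>y. R y \<xi>) has_derivative (\<lambda>z. - (\<Sum>j\<in>Basis. (E x z \<bullet> j) *\<^sub>R R x j))) (at x within S)"
        by (simp add: has_derivative_at_withinI)
    next
      fix z
      have "C_k_on k S (\<lambda>x. frechet_derivative (\<lambda>y. L y i) (at x) z)" for i
        using smooth_on_deriv[OF sm S] by (simp add: smooth_on_def)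
      then have "C_k_on k S (\<lambda>x. E x z)"
        unfolding E_def by (intro C_k_on_sum C_k_on_scaleR C_k_on_inner_left Suc thS)
      then have "C_k_on k S (\<lambda>x. \<Sum>j\<in>Basis. (E x z \<bullet> j) *\<^sub>R R x j)"
        by (intro C_k_on_sum C_k_on_scaleR C_k_on_inner_left Suc thS)
      then show "C_k_on k S (\<lambda>x. - (\<Sum>j\<in>Basis. (E x z \<bullet> j) *\<^sub>R R x j))"
        by (intro C_k_on_linear[OF thS, where h = uminus] bounded_linear_minus bounded_linear_ident)
    qed
  qed
  then show ?thesis by (simp add: smooth_on_def R_def)
qed

text \<open>Both mixed derivatives are the limit of the second difference quotient, which is symmetric.\<close>

lemma second_difference:
  fixes f :: "'a::euclidean_space \<Rightarrow> 'b::real_normed_vector"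
  assumes f: "smooth_on S f" and S: "open S" "x \<in> S" and e: "0 < e"
  shows "\<exists>d>0. \<forall>h. 0 < h \<and> h < d \<longrightarrow>
    norm ((f (x + h *\<^sub>R u + h *\<^sub>R v) - f (x + h *\<^sub>R u)) - (f (x + h *\<^sub>R v) - f x)
      - (h * h) *\<^sub>R frechet_derivative (\<lambda>y. frechet_derivative f (at y) u) (at x) v) \<le> e * (h * h)"
proof -
  define P where "P y = frechet_derivative f (at y) u" for y
  define P' where "P' = frechet_derivative P (at x)"
  have P': "(P has_derivative P') (at x)"
    unfolding P'_def P_def[abs_def] by (rule smooth_on_has_derivative[OF smooth_on_deriv[OF f S(1)] S])
  \<comment> \<open>The points s u + h v and s u, at which P is linearised around x, have norms
    adding up to at most h(2|u| + |v|); 1 is added for positivity.\<close>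
  define C where "C = 2 * norm u + norm v + 1"
  have C: "0 < C" by (simp add: C_def add_nonneg_pos)
  have "0 < e / C" using e C by simp
  then obtain d1 where d1: "0 < d1"
    "\<And>y. norm (y - x) < d1 \<Longrightarrow> norm (P y - P x - P' (y - x)) \<le> e / C * norm (y - x)"
    using P' unfolding has_derivative_at_alt by blast
  obtain d2 where d2: "0 < d2" "ball x d2 \<subseteq> S" using S by (meson openE)
  define d where "d = min d1 d2 / C"
  show ?thesis
  proof (intro exI[of _ d] conjI allI impI)
    show "0 < d" using d1 d2 C by (simp add: d_def)
    fix h assume h: "0 < h \<and> h < d"
    have hC: "h * C < min d1 d2" using h C by (simp add: d_def field_simps)
    have small: "norm (s *\<^sub>R u + r *\<^sub>R v) \<le> h * (norm u + norm v)" if "s \<in> {0..h}" "r \<in> {0..h}" for s r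
    proof -
      have "norm (s *\<^sub>R u + r *\<^sub>R v) \<le> s * norm u + r * norm v"
        using norm_triangle_ineq[of "s *\<^sub>R u" "r *\<^sub>R v"] that by simp
      also have "\<dots> \<le> h * norm u + h * norm v" using that by (intro add_mono mult_right_mono) auto
      finally show ?thesis by (simp add: algebra_simps)
    qed
    have "h * (norm u + norm v) \<le> h * C" using h by (intro mult_left_mono) (auto simp: C_def)
    then have near: "norm (s *\<^sub>R u + r *\<^sub>R v) < min d1 d2" if "s \<in> {0..h}" "r \<in> {0..h}" for s r
      using small[OF that] hC by linarith
    \<comment> \<open>The second difference is the increment of \<psi> from 0 to h. The summand with
      coefficient 0 gives both terms the form covered by \<open>fd\<close>.\<close>
    define \<psi> where "\<psi> s = f (x + s *\<^sub>R u + h *\<^sub>R v) - f (x + s *\<^sub>R u + 0 *\<^sub>R v)" for s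
    have fd: "((\<lambda>s. f (x + s *\<^sub>R u + r *\<^sub>R v)) has_vector_derivative P (x + s *\<^sub>R u + r *\<^sub>R v)) (at s within {0..h})"
      if "s \<in> {0..h}" "r \<in> {0..h}" for s r
    proof -
      have "x + s *\<^sub>R u + r *\<^sub>R v \<in> S"
        using near[OF that] d2(2)
          by (intro subsetD[OF d2(2)]) (simp add: dist_norm algebra_simps norm_minus_commute)
      then have D: "(f has_derivative frechet_derivative f (at (x + s *\<^sub>R u + r *\<^sub>R v))) (at (x + s *\<^sub>R u + r *\<^sub>R v))"
        by (rule smooth_on_has_derivative[OF f S(1)])
      have "((\<lambda>s. x + s *\<^sub>R u + r *\<^sub>R v) has_vector_derivative u) (at s within {0..h})"
        by (auto intro!: derivative_eq_intros)
      from vector_derivative_diff_chain_within[OF this has_derivative_at_withinI[OF D]] show ?thesis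
        by (simp add: o_def P_def)
    qed
    have "norm (\<psi> h - \<psi> 0 - (h - 0) *\<^sub>R (h *\<^sub>R P' v)) \<le> norm (h - 0) * (e * h)"
    proof -
      \<comment> \<open>Subtracting the expected linear part leaves a function whose derivative is
        bounded by e h, so the mean value inequality gives e h^2.\<close>
      define \<zeta> where "\<zeta> s = \<psi> s - s *\<^sub>R (h *\<^sub>R P' v)" for s
      have "norm (\<zeta> h - \<zeta> 0) \<le> (e * h) * norm (h - 0)"
      proof (rule differentiable_bound[where S = "{0..h}" and f' = "\<lambda>s z. z *\<^sub>R
            ((P (x + s *\<^sub>R u + h *\<^sub>R v) - P (x + s *\<^sub>R u + 0 *\<^sub>R v)) - h *\<^sub>R P' v)"])
        fix s assume s: "s \<in> {0..h}"
        have "((\<lambda>s. s *\<^sub>R (h *\<^sub>R P' v)) has_vector_derivative h *\<^sub>R P' v) (at s within {0..h})"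
          by (auto intro!: derivative_eq_intros)
        then have "(\<zeta> has_vector_derivative ((P (x + s *\<^sub>R u + h *\<^sub>R v) - P (x + s *\<^sub>R u + 0 *\<^sub>R v)) - h *\<^sub>R P' v)) (at s within {0..h})"
          unfolding \<zeta>_def \<psi>_def using s h by (intro has_vector_derivative_diff fd) auto
        then show "(\<zeta> has_derivative (\<lambda>z. z *\<^sub>R
            ((P (x + s *\<^sub>R u + h *\<^sub>R v) - P (x + s *\<^sub>R u + 0 *\<^sub>R v)) - h *\<^sub>R P' v))) (at s within {0..h})"
          by (simp add: has_vector_derivative_def)
        have est: "norm (P (x + s *\<^sub>R u + r *\<^sub>R v) - P x - P' (s *\<^sub>R u + r *\<^sub>R v)) \<le> e / C * norm (s *\<^sub>R u + r *\<^sub>R v)"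
          if "r \<in> {0..h}" for r
          using d1(2)[of "x + s *\<^sub>R u + r *\<^sub>R v"] near[OF s that] by (simp add: add.assoc)
        have lin: "P' (s *\<^sub>R u + h *\<^sub>R v) - P' (s *\<^sub>R u + 0 *\<^sub>R v) = h *\<^sub>R P' v"
          using has_derivative_linear[OF P'] by (simp add: linear_add linear_scale)
        have h0: "h \<in> {0..h}" "0 \<in> {0..h}" using h by auto
        have "norm ((P (x + s *\<^sub>R u + h *\<^sub>R v) - P (x + s *\<^sub>R u + 0 *\<^sub>R v)) - h *\<^sub>R P' v)
            = norm ((P (x + s *\<^sub>R u + h *\<^sub>R v) - P x - P' (s *\<^sub>R u + h *\<^sub>R v))
              - (P (x + s *\<^sub>R u + 0 *\<^sub>R v) - P x - P' (s *\<^sub>R u + 0 *\<^sub>R v)))"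
          unfolding lin[symmetric] by (simp add: algebra_simps)
        also have "\<dots> \<le> e / C * norm (s *\<^sub>R u + h *\<^sub>R v) + e / C * norm (s *\<^sub>R u + 0 *\<^sub>R v)"
          by (rule order_trans[OF norm_triangle_ineq4 add_mono[OF est[OF h0(1)] est[OF h0(2)]]])
        also have "\<dots> \<le> e / C * (h * (norm u + norm v)) + e / C * (h * norm u)"
        proof (intro add_mono mult_left_mono)
          show "norm (s *\<^sub>R u + h *\<^sub>R v) \<le> h * (norm u + norm v)" by (rule small[OF s h0(1)])
          show "norm (s *\<^sub>R u + 0 *\<^sub>R v) \<le> h * norm u" using s by (simp add: mult_right_mono)
        qed (use e C in auto)
        also have "\<dots> = e / C * (h * (2 * norm u + norm v))" by (simp add: algebra_simps)
        also have "\<dots> \<le> e / C * (h * C)"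
          using e C h by (intro mult_left_mono) (auto simp: C_def)
        also have "\<dots> = e * h" using C by simp
        finally have b: "norm ((P (x + s *\<^sub>R u + h *\<^sub>R v) - P (x + s *\<^sub>R u + 0 *\<^sub>R v)) - h *\<^sub>R P' v) \<le> e * h" .
        show "onorm (\<lambda>z. z *\<^sub>R ((P (x + s *\<^sub>R u + h *\<^sub>R v) - P (x + s *\<^sub>R u + 0 *\<^sub>R v)) - h *\<^sub>R P' v)) \<le> e * h"
        proof (rule onorm_le)
          fix z :: real
          show "norm (z *\<^sub>R ((P (x + s *\<^sub>R u + h *\<^sub>R v) - P (x + s *\<^sub>R u + 0 *\<^sub>R v)) - h *\<^sub>R P' v)) \<le> e * h * norm z"
            unfolding norm_scaleR real_norm_def using mult_right_mono[OF b, of "\<bar>z\<bar>"]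
              by (simp add: mult.commute)
        qed
      qed (use h in auto)
      then show ?thesis by (simp add: \<zeta>_def algebra_simps)
    qed
    then show "norm ((f (x + h *\<^sub>R u + h *\<^sub>R v) - f (x + h *\<^sub>R u)) - (f (x + h *\<^sub>R v) - f x)
      - (h * h) *\<^sub>R frechet_derivative (\<lambda>y. frechet_derivative f (at y) u) (at x) v) \<le> e * (h * h)"
      using h by (simp add: \<psi>_def P'_def P_def[abs_def] mult_ac)
  qed
qed

lemma second_derivative_symmetric:
  fixes f :: "'a::euclidean_space \<Rightarrow> 'b::real_normed_vector"
  assumes f: "smooth_on S f" and S: "open S" "x \<in> S"
  shows "frechet_derivative (\<lambda>y. frechet_derivative f (at y) u) (at x) v
       = frechet_derivative (\<lambda>y. frechet_derivative f (at y) v) (at x) u" (is "?a = ?b")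
proof (rule ccontr)
  assume "?a \<noteq> ?b"
  \<comment> \<open>A quarter of the discrepancy: the two approximation errors together account for
    at most half of it.\<close>
  define e where "e = norm (?a - ?b) / 4"
  have e: "0 < e" using \<open>?a \<noteq> ?b\<close> by (simp add: e_def)
  obtain d1 where d1: "0 < d1" "\<And>h. 0 < h \<Longrightarrow> h < d1 \<Longrightarrow>
    norm ((f (x + h *\<^sub>R u + h *\<^sub>R v) - f (x + h *\<^sub>R u)) - (f (x + h *\<^sub>R v) - f x) - (h * h) *\<^sub>R ?a) \<le> e * (h * h)"
    using second_difference[OF f S e, of u v] by blast
  obtain d2 where d2: "0 < d2" "\<And>h. 0 < h \<Longrightarrow> h < d2 \<Longrightarrow>
    norm ((f (x + h *\<^sub>R v + h *\<^sub>R u) - f (x + h *\<^sub>R v)) - (f (x + h *\<^sub>R u) - f x) - (h * h) *\<^sub>R ?b) \<le> e * (h * h)"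
    using second_difference[OF f S e, of v u] by blast
  define h where "h = min d1 d2 / 2"
  have h: "0 < h" "h < d1" "h < d2" using d1(1) d2(1) by (auto simp: h_def)
  define q where "q = (f (x + h *\<^sub>R u + h *\<^sub>R v) - f (x + h *\<^sub>R u)) - (f (x + h *\<^sub>R v) - f x)"
  have q2: "(f (x + h *\<^sub>R v + h *\<^sub>R u) - f (x + h *\<^sub>R v)) - (f (x + h *\<^sub>R u) - f x) = q"
    by (simp add: q_def algebra_simps)
  have "norm (q - (h * h) *\<^sub>R ?a) \<le> e * (h * h)" using d1(2)[OF h(1,2)] by (simp add: q_def)
  moreover have "norm (q - (h * h) *\<^sub>R ?b) \<le> e * (h * h)" using d2(2)[OF h(1,3)] q2 by simp
  ultimately have "norm ((q - (h * h) *\<^sub>R ?b) - (q - (h * h) *\<^sub>R ?a)) \<le> e * (h * h) + e * (h * h)"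
    by (intro order_trans[OF norm_triangle_ineq4 add_mono])
  also have "(q - (h * h) *\<^sub>R ?b) - (q - (h * h) *\<^sub>R ?a) = (h * h) *\<^sub>R (?a - ?b)"
    by (simp add: scaleR_diff_right)
  finally have "(h * h) * norm (?a - ?b) \<le> (h * h) * (2 * e)"
    unfolding norm_scaleR
      by (simp only: abs_mult_self_eq abs_mult) (simp only: mult_ac mult_2 distrib_left)
  then have "norm (?a - ?b) \<le> 2 * e" using h(1) by simp
  then show False using e by (simp add: e_def)
qed

section \<open>Tangent vectors and the charts of the tangent bundle\<close>

context smooth_manifold
begin

lemma coord_inj: "c \<in> A \<Longrightarrow> inj_on (coord c) (dom_of c)"
  by (rule inj_on_inverseI[where g = "chart_inv c"]) (rule homeomorphism_apply1[OF chart_homeomorphism])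

lemma inv_coord: "c \<in> A \<Longrightarrow> p \<in> dom_of c \<Longrightarrow> chart_inv c (coord c p) = p"
  by (rule inv_into_f_f[OF coord_inj])

lemma overlap_open: "c \<in> A \<Longrightarrow> d \<in> A \<Longrightarrow> open (coord c ` (dom_of c \<inter> dom_of d))"
proof -
  assume c: "c \<in> A" and d: "d \<in> A"
  have "coord c ` (dom_of c \<inter> dom_of d) = coord c ` dom_of c \<inter> chart_inv c -` dom_of d"
  proof (intro set_eqI iffI)
    fix x assume "x \<in> coord c ` (dom_of c \<inter> dom_of d)"
    then obtain p where p: "p \<in> dom_of c" "p \<in> dom_of d" "x = coord c p" by blast
    then show "x \<in> coord c ` dom_of c \<inter> chart_inv c -` dom_of d"
      unfolding p(3) by (simp add: inv_coord[OF c p(1)])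
  next
    fix x assume "x \<in> coord c ` dom_of c \<inter> chart_inv c -` dom_of d"
    then obtain p where p: "p \<in> dom_of c" "x = coord c p" "chart_inv c x \<in> dom_of d" by blast
    then have "p \<in> dom_of d" by (simp add: inv_coord[OF c p(1)])
    then show "x \<in> coord c ` (dom_of c \<inter> dom_of d)" using p by blast
  qed
  moreover have "continuous_on (coord c ` dom_of c) (chart_inv c)"
    using chart_homeomorphism[OF c] by (simp add: homeomorphism_def)
  ultimately show ?thesis
    using continuous_open_preimage[OF _ chart_image_open[OF c] chart_open[OF d]] by simp
qed

lemma transition_coord: "c \<in> A \<Longrightarrow> p \<in> dom_of c \<Longrightarrow> transition c d (coord c p) = coord d p"
  by (simp add: transition_def inv_coord)

lemma transition_derivative:
  assumes "c \<in> A" "d \<in> A" "p \<in> dom_of c" "p \<in> dom_of d"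
  shows "(transition c d has_derivative frechet_derivative (transition c d) (at (coord c p))) (at (coord c p))"
  by (rule smooth_on_has_derivative[OF transition_smooth overlap_open]) (use assms in auto)

lemma transition_linear:
  assumes "c \<in> A" "d \<in> A" "p \<in> dom_of c" "p \<in> dom_of d"
  shows "linear (frechet_derivative (transition c d) (at (coord c p)))"
  by (rule has_derivative_linear[OF transition_derivative[OF assms]])

text \<open>Chain rule for passing from c to e through d, which is valid on the open set of points
  common to the three charts.\<close>

lemma transition_cocycle:
  assumes c: "c \<in> A" "p \<in> dom_of c" and d: "d \<in> A" "p \<in> dom_of d" and e: "e \<in> A" "p \<in> dom_of e"
  shows "frechet_derivative (transition d e) (at (coord d p)) (frechet_derivative (transition c d) (at (coord c p)) u)
       = frechet_derivative (transition c e) (at (coord c p)) u"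
proof -
  let ?S = "coord c ` (dom_of c \<inter> dom_of d) \<inter> coord c ` (dom_of c \<inter> dom_of e)"
  have S: "open ?S" by (intro open_Int overlap_open c d e)
  have pS: "coord c p \<in> ?S" using c d e by blast
  have "(transition d e has_derivative frechet_derivative (transition d e) (at (coord d p))) (at (transition c d (coord c p)))"
    using transition_derivative[OF d(1) e(1) d(2) e(2)] by (simp add: transition_coord c)
  from diff_chain_at[OF transition_derivative[OF c(1) d(1) c(2) d(2)] this]
  have "((\<lambda>x. transition d e (transition c d x)) has_derivative
      (\<lambda>u. frechet_derivative (transition d e) (at (coord d p)) (frechet_derivative (transition c d) (at (coord c p)) u)))
      (at (coord c p))" by (simp add: o_def)
  then have "(transition c e has_derivative
      (\<lambda>u. frechet_derivative (transition d e) (at (coord d p)) (frechet_derivative (transition c d) (at (coord c p)) u)))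
      (at (coord c p))"
  proof (rule has_derivative_transform_within_open[OF _ S pS])
    fix x assume "x \<in> ?S"
    then obtain q where "q \<in> dom_of c" "q \<in> dom_of d" "x = coord c q" by blast
    then show "transition d e (transition c d x) = transition c e x"
      by (simp add: transition_coord c d)
  qed
  from fun_cong[OF has_derivative_unique[OF this transition_derivative[OF c(1) e(1) c(2) e(2)]], of u]
  show ?thesis .
qed

lemma transition_self_derivative:
  assumes c: "c \<in> A" "p \<in> dom_of c"
  shows "frechet_derivative (transition c c) (at (coord c p)) u = u"
proof -
  have "(transition c c has_derivative (\<lambda>u. u)) (at (coord c p))"
    by (rule has_derivative_transform_within_open[OF has_derivative_ident chart_image_open[OF c(1)]])
      (use c transition_coord[OF c(1), of _ c] in auto)
  from fun_cong[OF has_derivative_unique[OF this transition_derivative[OF c(1) c(1) c(2) c(2)]], of u]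
  show ?thesis by simp
qed

lemma coord_tvec_tangent:
  assumes c: "c \<in> A" "p \<in> dom_of c" shows "coord_tvec A c p u \<in> tangent_space A p"
proof -
  have "coord_tvec A c p u e = frechet_derivative (transition d e) (at (coord d p)) (coord_tvec A c p u d)"
    if "d \<in> A" "e \<in> A" "p \<in> dom_of d \<inter> dom_of e" for d e
    using that transition_cocycle[OF c that(1) _ that(2), of u] by (simp add: coord_tvec_def)
  moreover have "coord_tvec A c p u d = 0" if "\<not> (d \<in> A \<and> p \<in> dom_of d)" for d
    unfolding coord_tvec_def using that by (rule if_not_P)
  ultimately show ?thesis unfolding tangent_space_def by blast
qed

lemma coord_tvec_self: "c \<in> A \<Longrightarrow> p \<in> dom_of c \<Longrightarrow> coord_tvec A c p u c = u"
  by (simp add: coord_tvec_def transition_self_derivative)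

lemma coord_tvec_component:
  assumes c: "c \<in> A" "p \<in> dom_of c" and v: "v \<in> tangent_space A p"
  shows "coord_tvec A c p (v c) = v"
proof
  fix d
  show "coord_tvec A c p (v c) d = v d"
  proof (cases "d \<in> A \<and> p \<in> dom_of d")
    case True
    then have "v d = frechet_derivative (transition c d) (at (coord c p)) (v c)"
      using v c unfolding tangent_space_def by blast
    then show ?thesis using True by (simp add: coord_tvec_def)
  next
    case False
    then have "v d = 0" using v unfolding tangent_space_def by blast
    then show ?thesis unfolding coord_tvec_def using False by auto
  qed
qed

lemma coord_tvec_change:
  assumes c: "c \<in> A" "p \<in> dom_of c" and d: "d \<in> A" "p \<in> dom_of d"
  shows "coord_tvec A d p (frechet_derivative (transition c d) (at (coord c p)) u) = coord_tvec A c p u"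
proof -
  have "coord_tvec A c p u d = frechet_derivative (transition c d) (at (coord c p)) u"
    by (simp add: coord_tvec_def d)
  then show ?thesis using coord_tvec_component[OF d coord_tvec_tangent[OF c, of u]] by metis
qed

lemma tangent_component:
  assumes v: "v \<in> tangent_space A p" and c: "c \<in> A" "p \<in> dom_of c" and d: "d \<in> A" "p \<in> dom_of d"
  shows "v d = frechet_derivative (transition c d) (at (coord c p)) (v c)"
proof -
  from bspec[OF bspec[OF conjunct1[OF v[unfolded tangent_space_def mem_Collect_eq]] c(1)] d(1)] c(2) d(2)
  show ?thesis by (rule mp[OF _ IntI])
qed

lemma tangent_space_scale: "v \<in> tangent_space A p \<Longrightarrow> (\<lambda>c. r *\<^sub>R v c) \<in> tangent_space A p"
proof -
  assume v: "v \<in> tangent_space A p"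
  have "r *\<^sub>R v d = frechet_derivative (transition c d) (at (coord c p)) (r *\<^sub>R v c)"
    if "c \<in> A" "d \<in> A" "p \<in> dom_of c" "p \<in> dom_of d" for c d
    using linear_scale[OF transition_linear[OF that]] tangent_component[OF v that(1,3,2,4)] by simp
  moreover have "r *\<^sub>R v c = 0" if "\<not> (c \<in> A \<and> p \<in> dom_of c)" for c
  proof -
    have "v c = 0" using v that unfolding tangent_space_def by blast
    then show ?thesis by simp
  qed
  ultimately show ?thesis unfolding tangent_space_def by blast
qed

abbreviation (input) bc where "bc \<equiv> bundle_chart A"

lemma bundle_dom: "dom_of (bc c) = {z. snd z \<in> tangent_space A (fst z) \<and> fst z \<in> dom_of c}"
proof -
  have "z \<in> tangent_bundle A \<longleftrightarrow> snd z \<in> tangent_space A (fst z)" for z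
    by (cases z) (simp add: tangent_bundle_def)
  then show ?thesis by (simp add: bundle_chart_def)
qed

lemma bundle_coord: "coord (bc c) z = (coord c (fst z), snd z c)"
  by (simp add: bundle_chart_def)

lemma bundle_inj: "c \<in> A \<Longrightarrow> inj_on (coord (bc c)) (dom_of (bc c))"
proof (rule inj_onI)
  fix y z assume c: "c \<in> A" and *: "y \<in> dom_of (bc c)" "z \<in> dom_of (bc c)"
    "coord (bc c) y = coord (bc c) z"
  then have t: "snd y \<in> tangent_space A (fst y)" "fst y \<in> dom_of c" "snd z \<in> tangent_space A (fst z)"
    "fst z \<in> dom_of c"
    "coord c (fst y) = coord c (fst z)" "snd y c = snd z c"
    by (simp_all add: bundle_dom bundle_coord)
  then have f: "fst y = fst z" using inj_onD[OF coord_inj[OF c]] by blast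
  moreover have "snd y = snd z"
  proof -
    have "snd y = coord_tvec A c (fst y) (snd y c)"
      by (rule coord_tvec_component[OF c t(2,1), symmetric])
    also have "\<dots> = coord_tvec A c (fst z) (snd z c)" unfolding f t(6) ..
    also have "\<dots> = snd z" by (rule coord_tvec_component[OF c t(4,3)])
    finally show ?thesis .
  qed
  ultimately show "y = z" by (rule prod_eqI)
qed

lemma bundle_image:
  assumes c: "c \<in> A"
  shows "coord (bc c) ` (dom_of (bc c) \<inter> dom_of (bc d)) = coord c ` (dom_of c \<inter> dom_of d) \<times> UNIV"
proof
  show "coord (bc c) ` (dom_of (bc c) \<inter> dom_of (bc d)) \<subseteq> coord c ` (dom_of c \<inter> dom_of d) \<times> UNIV"
  proof
    fix y assume "y \<in> coord (bc c) ` (dom_of (bc c) \<inter> dom_of (bc d))"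
    then obtain z where "z \<in> dom_of (bc c)" "z \<in> dom_of (bc d)" "y = coord (bc c) z" by blast
    then show "y \<in> coord c ` (dom_of c \<inter> dom_of d) \<times> UNIV"
      unfolding bundle_dom bundle_coord by simp
  qed
  show "coord c ` (dom_of c \<inter> dom_of d) \<times> UNIV \<subseteq> coord (bc c) ` (dom_of (bc c) \<inter> dom_of (bc d))"
  proof
    fix y assume "y \<in> coord c ` (dom_of c \<inter> dom_of d) \<times> (UNIV :: 'e set)"
    then obtain p u where p: "p \<in> dom_of c" "p \<in> dom_of d" "y = (coord c p, u)" by blast
    have "y = coord (bc c) (p, coord_tvec A c p u)"
      using c p by (simp add: bundle_coord coord_tvec_self)
    moreover have "(p, coord_tvec A c p u) \<in> dom_of (bc c) \<inter> dom_of (bc d)"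
      using c p by (simp add: bundle_dom coord_tvec_tangent)
    ultimately show "y \<in> coord (bc c) ` (dom_of (bc c) \<inter> dom_of (bc d))" by blast
  qed
qed

lemma bundle_image_dom: "c \<in> A \<Longrightarrow> coord (bc c) ` dom_of (bc c) = coord c ` dom_of c \<times> UNIV"
  using bundle_image[of c c] by simp

lemma bundle_transition:
  assumes c: "c \<in> A" "p \<in> dom_of c" and d: "d \<in> A" "p \<in> dom_of d"
  shows "transition (bc c) (bc d) (coord c p, u) = (coord d p, frechet_derivative (transition c d) (at (coord c p)) u)"
proof -
  let ?z = "(p, coord_tvec A c p u)"
  have z: "?z \<in> dom_of (bc c)" "coord (bc c) ?z = (coord c p, u)"
    using c by (simp_all add: bundle_dom bundle_coord coord_tvec_tangent coord_tvec_self)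
  then have "chart_inv (bc c) (coord c p, u) = ?z" using inv_into_f_f[OF bundle_inj[OF c(1)] z(1)]
    by simp
  then show ?thesis by (simp add: transition_def bundle_coord) (simp add: coord_tvec_def d transition_def)
qed

lemma bundle_transition_smooth:
  assumes c: "c \<in> A" and d: "d \<in> A"
  shows "smooth_on (coord (bc c) ` (dom_of (bc c) \<inter> dom_of (bc d))) (transition (bc c) (bc d))"
proof -
  let ?O = "coord c ` (dom_of c \<inter> dom_of d)"
  let ?S = "?O \<times> (UNIV :: 'e set)"
  have O: "open ?O" by (rule overlap_open[OF c d])
  have th: "thick ?S" using O by (intro thick_open open_Times) auto
  have fst: "smooth_on ?S fst"
    using smooth_on_linear[OF th bounded_linear_fst smooth_on_id[OF th]] by simp
  have snd: "smooth_on ?S (\<lambda>z. snd z \<bullet> i)" for i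
    using smooth_on_linear[OF th bounded_linear_snd smooth_on_id[OF th]]
    by (intro smooth_on_inner th smooth_on_const) simp
  have comp: "smooth_on ?S (\<lambda>z. h (fst z))" if "smooth_on ?O h" for h :: "'e \<Rightarrow> 'e"
    by (rule smooth_on_compose[OF th _ fst that]) auto
  have sm: "smooth_on ?S (\<lambda>z. (transition c d (fst z),
      \<Sum>i\<in>Basis. (snd z \<bullet> i) *\<^sub>R frechet_derivative (transition c d) (at (fst z)) i))"
    using smooth_on_deriv[OF transition_smooth[OF c d] O]
    by (intro smooth_on_Pair smooth_on_sum smooth_on_scaleR th snd comp transition_smooth c d) auto
  show ?thesis
    unfolding bundle_image[OF c]
  proof (rule smooth_on_cong[THEN iffD1, OF _ sm])
    fix z assume "z \<in> ?S"
    then obtain p u where z: "p \<in> dom_of c" "p \<in> dom_of d" "z = (coord c p, u)" by (cases z) auto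
    show "(transition c d (fst z), \<Sum>i\<in>Basis. (snd z \<bullet> i) *\<^sub>R frechet_derivative (transition c d) (at (fst z)) i)
        = transition (bc c) (bc d) z"
      using z c d linear_sum_Basis[OF transition_linear[OF c d z(1,2)], of u]
      by (simp add: bundle_transition transition_coord)
  qed
qed

text \<open>Differentiating the map that sends (x, u) to (\<phi> x, D\<phi>(x) u) produces a second
  derivative of \<phi> in the fibre component. This term has to be matched by the transformation law
  of the Christoffel symbols.\<close>

lemma bundle_transition_derivative:
  assumes c: "c \<in> A" "p \<in> dom_of c" and d: "d \<in> A" "p \<in> dom_of d"
  shows "frechet_derivative (transition (bc c) (bc d)) (at (coord c p, u)) (z, a) =
    (frechet_derivative (transition c d) (at (coord c p)) z,
     frechet_derivative (transition c d) (at (coord c p)) a +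
     frechet_derivative (\<lambda>x. frechet_derivative (transition c d) (at x) u) (at (coord c p)) z)"
proof -
  let ?O = "coord c ` (dom_of c \<inter> dom_of d)" and ?\<phi> = "transition c d" and ?x = "coord c p"
  let ?D = "\<lambda>x. frechet_derivative ?\<phi> (at x)"
  let ?H = "\<lambda>i. frechet_derivative (\<lambda>x. ?D x i) (at ?x)"
  have O: "open ?O" "?x \<in> ?O" using overlap_open[OF c(1) d(1)] c d by blast+
  have H: "((\<lambda>x. ?D x i) has_derivative ?H i) (at ?x)" for i
    by (rule smooth_on_has_derivative[OF smooth_on_deriv[OF transition_smooth[OF c(1) d(1)] O(1)] O])
  have lin: "linear (?D x)" if "x \<in> ?O" for x using that transition_linear[OF c(1) d(1)] by blast
  have "((\<lambda>x. \<Sum>i\<in>Basis. (u \<bullet> i) *\<^sub>R ?D x i) has_derivative (\<lambda>z. \<Sum>i\<in>Basis. (u \<bullet> i) *\<^sub>R ?H i z)) (at ?x)"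
    by (intro has_derivative_sum has_derivative_scaleR_right H)
  then have "((\<lambda>x. ?D x u) has_derivative (\<lambda>z. \<Sum>i\<in>Basis. (u \<bullet> i) *\<^sub>R ?H i z)) (at ?x)"
    by (rule has_derivative_transform_within_open[OF _ O]) (rule linear_sum_Basis[OF lin, symmetric])
  \<comment> \<open>The derivative of D x u in x is resolved into basis directions, the form in
    which the product rule below delivers it.\<close>
  then have Hu: "?H u = (\<lambda>z. \<Sum>i\<in>Basis. (u \<bullet> i) *\<^sub>R ?H i z)"
    by (rule has_derivative_unique[OF H])
  have f: "(fst has_derivative fst) (at (?x, u))" "(snd has_derivative snd) (at (?x, u))"
    by (simp_all add: bounded_linear_imp_has_derivative bounded_linear_fst bounded_linear_snd)
  have cf: "((\<lambda>y. h (fst y)) has_derivative (\<lambda>y. h' (fst y))) (at (?x, u))"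
    if "(h has_derivative h') (at ?x)" for h h' :: "'e \<Rightarrow> 'e"
    using diff_chain_at[OF f(1), of h h'] that by (simp add: o_def)
  have "((\<lambda>y. (?\<phi> (fst y), \<Sum>i\<in>Basis. (snd y \<bullet> i) *\<^sub>R ?D (fst y) i)) has_derivative
      (\<lambda>y. (?D ?x (fst y), \<Sum>i\<in>Basis. (snd (?x, u) \<bullet> i) *\<^sub>R ?H i (fst y) + (snd y \<bullet> i) *\<^sub>R ?D (fst (?x, u)) i)))
      (at (?x, u))"
    by (intro has_derivative_Pair has_derivative_sum has_derivative_scaleR cf H
        transition_derivative c d has_derivative_inner_left f)
  moreover have "open (?O \<times> (UNIV :: 'e set))" by (intro open_Times O) simp
  ultimately have "(transition (bc c) (bc d) has_derivative
      (\<lambda>y. (?D ?x (fst y), \<Sum>i\<in>Basis. (snd (?x, u) \<bullet> i) *\<^sub>R ?H i (fst y) + (snd y \<bullet> i) *\<^sub>R ?D (fst (?x, u)) i)))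
      (at (?x, u))"
  proof (rule has_derivative_transform_within_open)
    fix y assume "y \<in> ?O \<times> (UNIV :: 'e set)"
    then obtain q v where y: "q \<in> dom_of c" "q \<in> dom_of d" "y = (coord c q, v)" by (cases y) auto
    show "(?\<phi> (fst y), \<Sum>i\<in>Basis. (snd y \<bullet> i) *\<^sub>R ?D (fst y) i) = transition (bc c) (bc d) y"
      using y c d linear_sum_Basis[OF transition_linear[OF c(1) d(1) y(1,2)], of v]
      by (simp add: bundle_transition transition_coord)
  qed (use O in auto)
  then have "frechet_derivative (transition (bc c) (bc d)) (at (?x, u)) =
      (\<lambda>y. (?D ?x (fst y), \<Sum>i\<in>Basis. (snd (?x, u) \<bullet> i) *\<^sub>R ?H i (fst y) + (snd y \<bullet> i) *\<^sub>R ?D (fst (?x, u)) i))"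
    by (rule frechet_derivative_at[symmetric])
  then show ?thesis
    using linear_sum_Basis[OF lin[OF O(2)], of a]
    by (simp add: Hu sum.distrib add.commute)
qed

text \<open>The base points converge in M, which is Hausdorff, so their limits agree. Both limits
  then lie in one bundle chart, where continuity of the transition map compares the fibre
  components.\<close>

lemma bundle_limit_unique:
  fixes z :: "nat \<Rightarrow> 'm \<times> ('m, 'e) tvec"
  assumes c: "c \<in> A" "p \<in> dom_of (bc c)" and d: "d \<in> A" "q \<in> dom_of (bc d)"
    and z: "\<And>n. z n \<in> dom_of (bc c) \<inter> dom_of (bc d)"
    and zc: "(\<lambda>n. coord (bc c) (z n)) \<longlonglongrightarrow> coord (bc c) p"
    and zd: "(\<lambda>n. coord (bc d) (z n)) \<longlonglongrightarrow> coord (bc d) q"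
  shows "p = q"
proof -
  have base: "(\<lambda>n. fst (z n)) \<longlonglongrightarrow> fst p"
    if c: "c \<in> A" "p \<in> dom_of (bc c)" and z: "\<And>n. z n \<in> dom_of (bc c)"
      and zc: "(\<lambda>n. coord (bc c) (z n)) \<longlonglongrightarrow> coord (bc c) p" for c p
  proof -
    have "continuous_on (coord c ` dom_of c) (chart_inv c)"
      using chart_homeomorphism[OF c(1)] by (simp add: homeomorphism_def)
    moreover have "(\<lambda>n. coord c (fst (z n))) \<longlonglongrightarrow> coord c (fst p)"
      using tendsto_fst[OF zc] by (simp add: bundle_coord)
    ultimately have "(\<lambda>n. chart_inv c (coord c (fst (z n)))) \<longlonglongrightarrow> chart_inv c (coord c (fst p))"
      by (rule continuous_on_tendsto_compose) (use c z in \<open>auto simp: bundle_dom\<close>)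
    then show ?thesis using c z by (simp add: inv_coord bundle_dom)
  qed
  have pq: "fst p = fst q"
    using base[OF c _ zc] base[OF d _ zd] z LIMSEQ_unique by blast
  have q: "q \<in> dom_of (bc c)" using c d pq by (simp add: bundle_dom)
  let ?t = "transition (bc d) (bc c)"
  have "isCont ?t (coord (bc d) q)"
  proof -
    have "coord (bc d) q \<in> coord (bc d) ` (dom_of (bc d) \<inter> dom_of (bc c))" using q d by blast
    moreover have "open (coord (bc d) ` (dom_of (bc d) \<inter> dom_of (bc c)))"
      unfolding bundle_image[OF d(1)] by (intro open_Times overlap_open d c open_UNIV)
    ultimately show ?thesis
      using smooth_on_continuous[OF bundle_transition_smooth[OF d(1) c(1)]] continuous_on_eq_continuous_at by blast
  qed
  from isCont_tendsto_compose[OF this zd]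
  have "(\<lambda>n. ?t (coord (bc d) (z n))) \<longlonglongrightarrow> ?t (coord (bc d) q)" .
  moreover have "?t (coord (bc d) y) = coord (bc c) y" if "y \<in> dom_of (bc d)" for y
    using that inv_into_f_f[OF bundle_inj[OF d(1)]] by (simp add: transition_def)
  ultimately have "(\<lambda>n. coord (bc c) (z n)) \<longlonglongrightarrow> coord (bc c) q" using z d by simp
  from LIMSEQ_unique[OF zc this] show ?thesis
    using bundle_inj[OF c(1)] c(2) q by (simp add: inj_on_def)
qed

end

section \<open>The Riemannian connection and the geodesic spray\<close>

lemma bilinear_form_sum:
  fixes B :: "'a::euclidean_space \<Rightarrow> 'a \<Rightarrow> real"
  assumes "\<And>w. linear (\<lambda>u. B u w)" "\<And>u. linear (\<lambda>w. B u w)"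
  shows "B a b = (\<Sum>i\<in>Basis. \<Sum>j\<in>Basis. ((a \<bullet> i) * (b \<bullet> j)) * B i j)"
proof -
  have "B a b = (\<Sum>i\<in>Basis. (a \<bullet> i) *\<^sub>R B i b)" by (rule linear_sum_Basis[OF assms(1)])
  also have "\<dots> = (\<Sum>i\<in>Basis. (a \<bullet> i) *\<^sub>R (\<Sum>j\<in>Basis. (b \<bullet> j) *\<^sub>R B i j))"
    by (intro sum.cong refl arg_cong2[where f = scaleR] linear_sum_Basis[OF assms(2)])
  finally show ?thesis by (simp add: sum_distrib_left mult.assoc)
qed

context smooth_manifold
begin

lemma coord_tvec_linear:
  assumes c: "c \<in> A" "p \<in> dom_of c"
  shows "coord_tvec A c p (u + v) = (\<lambda>d. coord_tvec A c p u d + coord_tvec A c p v d)"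
    and "coord_tvec A c p (r *\<^sub>R u) = (\<lambda>d. r *\<^sub>R coord_tvec A c p u d)"
  unfolding coord_tvec_def fun_eq_iff
  using linear_add[OF transition_linear[OF c(1) _ c(2)]] linear_scale[OF transition_linear[OF c(1) _ c(2)]]
  by simp_all

end

section \<open>Christoffel symbols from the Koszul formula\<close>

context riemannian_manifold
begin

definition gm :: "('m, 'e) chart \<Rightarrow> 'e \<Rightarrow> 'e \<Rightarrow> 'e \<Rightarrow> real" where
  "gm = metric_in_chart A g"

definition gder :: "('m, 'e) chart \<Rightarrow> 'e \<Rightarrow> 'e \<Rightarrow> 'e \<Rightarrow> 'e \<Rightarrow> real" where
  "gder c x z u w = frechet_derivative (\<lambda>y. gm c y u w) (at x) z"

text \<open>Lowering an index: the vector that represents g(v, -) with respect to the Euclidean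
  inner product of the model space.\<close>

definition gmat :: "('m, 'e) chart \<Rightarrow> 'e \<Rightarrow> 'e \<Rightarrow> 'e" where
  "gmat c x v = (\<Sum>i\<in>Basis. gm c x v i *\<^sub>R i)"

text \<open>Right-hand side of the Koszul formula for constant fields in a chart, that is, the
  Christoffel symbols of the first kind.\<close>

definition koszul :: "('m, 'e) chart \<Rightarrow> 'e \<Rightarrow> 'e \<Rightarrow> 'e \<Rightarrow> 'e \<Rightarrow> real" where
  "koszul c x u v w = (gder c x u v w + gder c x v u w - gder c x w u v) / 2"

text \<open>Raising the index of the first-kind symbols by the inverse of \<open>gmat\<close>; these
  are the symbols of the second kind.\<close>

definition christoffel :: "('m, 'e) chart \<Rightarrow> 'e \<Rightarrow> 'e \<Rightarrow> 'e \<Rightarrow> 'e" where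
  "christoffel c x u v = inv (gmat c x) (\<Sum>i\<in>Basis. koszul c x u v i *\<^sub>R i)"

lemma gm_coord: "c \<in> A \<Longrightarrow> p \<in> dom_of c \<Longrightarrow>
    gm c (coord c p) u w = g p (coord_tvec A c p u) (coord_tvec A c p w)"
  by (simp add: gm_def metric_in_chart_def inv_coord)

context
  fixes c x
  assumes c: "c \<in> A" and x: "x \<in> coord c ` dom_of c"
begin

lemma gm_sym: "gm c x u w = gm c x w u"
proof -
  obtain p where p: "p \<in> dom_of c" "x = coord c p" using x by blast
  show ?thesis unfolding p(2) gm_coord[OF c p(1)]
    by (intro metric_sym coord_tvec_tangent c p)
qed

lemma gm_linear_left: "linear (\<lambda>u. gm c x u w)"
proof -
  obtain p where p: "p \<in> dom_of c" "x = coord c p" using x by blast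
  note t = coord_tvec_tangent[OF c p(1)]
  show ?thesis unfolding p(2) gm_coord[OF c p(1)]
    by (rule linearI) (simp_all add: coord_tvec_linear[OF c p(1)] metric_add[OF t t t] metric_scale[OF t t])
qed

lemma gm_linear_right: "linear (\<lambda>w. gm c x u w)"
  using gm_linear_left[of u] by (simp add: gm_sym)

lemma gm_pos: "u \<noteq> 0 \<Longrightarrow> 0 < gm c x u u"
proof -
  assume u: "u \<noteq> 0"
  obtain p where p: "p \<in> dom_of c" "x = coord c p" using x by blast
  have "coord_tvec A c p u \<noteq> (\<lambda>d. 0)"
    using coord_tvec_self[OF c p(1), of u] u by metis
  then show ?thesis unfolding p(2) gm_coord[OF c p(1)]
    by (intro metric_pos coord_tvec_tangent c p)
qed

lemma gm_nondegenerate: "(\<And>w. gm c x u w = gm c x v w) \<Longrightarrow> u = v"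
proof -
  assume eq: "\<And>w. gm c x u w = gm c x v w"
  have "gm c x (u - v) (u - v) = 0" using eq[of "u - v"] by (simp add: linear_diff[OF gm_linear_left])
  then show "u = v" using gm_pos[of "u - v"] by auto
qed

lemma gm_has_derivative: "((\<lambda>y. gm c y u w) has_derivative (\<lambda>z. gder c x z u w)) (at x)"
proof -
  have "((\<lambda>y. gm c y u w) has_derivative frechet_derivative (\<lambda>y. gm c y u w) (at x)) (at x)"
    unfolding gm_def by (rule smooth_on_has_derivative[OF metric_smooth[OF c] chart_image_open[OF c] x])
  then show ?thesis by (simp add: gder_def)
qed

lemma gder_linear: "linear (\<lambda>z. gder c x z u w)"
  by (rule has_derivative_linear[OF gm_has_derivative])

end

text \<open>The chart image is open, so an algebraic identity between metric coefficients on it may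
  be differentiated. Symmetry and bilinearity of \<open>gder\<close> in its last two arguments come
  from here.\<close>

lemma gder_eqI:
  assumes c: "c \<in> A" "x \<in> coord c ` dom_of c"
    and f: "(f has_derivative f') (at x)" and eq: "\<And>y. y \<in> coord c ` dom_of c \<Longrightarrow> f y = gm c y u w"
  shows "gder c x z u w = f' z"
proof -
  have "((\<lambda>y. gm c y u w) has_derivative f') (at x)"
    by (rule has_derivative_transform_within_open[OF f chart_image_open[OF c(1)] c(2) eq])
  from fun_cong[OF has_derivative_unique[OF gm_has_derivative[OF c] this]] show ?thesis .
qed

context
  fixes c x
  assumes c: "c \<in> A" and x: "x \<in> coord c ` dom_of c"
begin

lemma gder_sym: "gder c x z u w = gder c x z w u"
  by (rule gder_eqI[OF c x gm_has_derivative[OF c x]]) (rule gm_sym[OF c])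

lemma gder_linear_left: "linear (\<lambda>u. gder c x z u w)"
proof (rule linearI)
  show "gder c x z (u + v) w = gder c x z u w + gder c x z v w" for u v
    by (rule gder_eqI[OF c x has_derivative_add[OF gm_has_derivative[OF c x] gm_has_derivative[OF c x]]])
      (rule linear_add[OF gm_linear_left[OF c], symmetric])
  show "gder c x z (r *\<^sub>R u) w = r *\<^sub>R gder c x z u w" for r u
    by (rule gder_eqI[OF c x has_derivative_scaleR_right[OF gm_has_derivative[OF c x]]])
      (rule linear_scale[OF gm_linear_left[OF c], symmetric])
qed

lemma gder_linear_right: "linear (\<lambda>w. gder c x z u w)"
  using gder_linear_left[of z u] by (simp add: gder_sym)

lemma gmat_inner: "gmat c x v \<bullet> w = gm c x v w"
proof -
  have "gmat c x v \<bullet> w = (\<Sum>i\<in>Basis. (w \<bullet> i) *\<^sub>R gm c x v i)"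
    by (simp add: gmat_def inner_sum_left) (simp add: inner_commute[of w] mult.commute)
  also have "\<dots> = gm c x v w" by (rule linear_sum_Basis[OF gm_linear_right[OF c x], symmetric])
  finally show ?thesis .
qed

lemma gmat_linear: "linear (gmat c x)"
  unfolding gmat_def
  by (intro linear_compose_sum ballI)
    (simp add: linear_iff linear_add[OF gm_linear_left[OF c x]] linear_scale[OF gm_linear_left[OF c x]] scaleR_add_left)

lemma gmat_inj: "inj (gmat c x)"
proof (rule injI)
  fix u v assume "gmat c x u = gmat c x v"
  then show "u = v"
    using gmat_inner by (intro gm_nondegenerate[OF c x]) metis
qed

lemma gmat_inv: "gmat c x (inv (gmat c x) v) = v"
  by (rule surj_f_inv_f[OF linear_injective_imp_surjective[OF gmat_linear gmat_inj refl]])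

lemma koszul_linear: "linear (\<lambda>w. koszul c x u v w)" "linear (\<lambda>u. koszul c x u v w)"
  unfolding koszul_def
  by (simp_all add: linear_iff linear_add[OF gder_linear_right] linear_scale[OF gder_linear_right]
      linear_add[OF gder_linear_left] linear_scale[OF gder_linear_left]
      linear_add[OF gder_linear[OF c x]] linear_scale[OF gder_linear[OF c x]] field_simps)

lemma koszul_sym: "koszul c x u v w = koszul c x v u w"
  by (simp add: koszul_def gder_sym[of w u v])

lemma gm_christoffel: "gm c x (christoffel c x u v) w = koszul c x u v w"
proof -
  have "gm c x (christoffel c x u v) w = (\<Sum>i\<in>Basis. koszul c x u v i *\<^sub>R i) \<bullet> w"
    by (simp add: christoffel_def gmat_inner[symmetric] gmat_inv)
  also have "\<dots> = (\<Sum>i\<in>Basis. (w \<bullet> i) *\<^sub>R koszul c x u v i)"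
    by (simp add: inner_sum_left) (simp add: inner_commute[of w] mult.commute)
  also have "\<dots> = koszul c x u v w" by (rule linear_sum_Basis[OF koszul_linear(1), symmetric])
  finally show ?thesis .
qed

lemma christoffel_sym: "christoffel c x u v = christoffel c x v u"
  by (simp add: christoffel_def koszul_sym[of u v])

lemma christoffel_linear: "linear (\<lambda>u. christoffel c x u v)"
proof (rule linearI)
  fix u u' :: 'e and r :: real
  show "christoffel c x (u + u') v = christoffel c x u v + christoffel c x u' v"
    by (rule gm_nondegenerate[OF c x])
      (simp add: gm_christoffel linear_add[OF gm_linear_left[OF c x]] linear_add[OF koszul_linear(2)])
  show "christoffel c x (r *\<^sub>R u) v = r *\<^sub>R christoffel c x u v"
    by (rule gm_nondegenerate[OF c x])
      (simp add: gm_christoffel linear_scale[OF gm_linear_left[OF c x]] linear_scale[OF koszul_linear(2)])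
qed

lemma christoffel_bilinear: "bilinear (christoffel c x)"
  unfolding bilinear_def using christoffel_linear by (simp add: christoffel_sym)

text \<open>Adding the compatibility condition for two orders of the arguments and subtracting it
  for the third leaves 2 g(G u v, w), so nondegeneracy determines G. Conversely, the first-kind
  symbols of (u, v, w) and (u, w, v) add up to the derivative of g(v, w) in direction u.\<close>

lemma riemannian_connection_eq: "riemannian_connection A g c x = christoffel c x"
  unfolding riemannian_connection_def gm_def[symmetric] gder_def[symmetric]
proof (rule the_equality)
  show "bilinear (christoffel c x) \<and> (\<forall>u v. christoffel c x u v = christoffel c x v u) \<and>
    (\<forall>u v w. gder c x u v w = gm c x (christoffel c x u v) w + gm c x v (christoffel c x u w))"
  proof (intro conjI allI)
    fix u v w
    have "gm c x v (christoffel c x u w) = koszul c x u w v"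
      using gm_sym[OF c x] gm_christoffel by simp
    then show "gder c x u v w = gm c x (christoffel c x u v) w + gm c x v (christoffel c x u w)"
      unfolding gm_christoffel koszul_def
      using gder_sym[of u v w] gder_sym[of v u w] gder_sym[of w u v]
        by (simp only:) (simp add: field_simps)
  qed (rule christoffel_bilinear christoffel_sym)+
next
  fix G assume G: "bilinear G \<and> (\<forall>u v. G u v = G v u) \<and>
    (\<forall>u v w. gder c x u v w = gm c x (G u v) w + gm c x v (G u w))"
  note sym = spec[OF spec[OF conjunct1[OF conjunct2[OF G]]]]
    and comp = spec[OF spec[OF spec[OF conjunct2[OF conjunct2[OF G]]]]]
  show "G = christoffel c x"
  proof (intro ext gm_nondegenerate[OF c x])
    fix u v w
    have "koszul c x u v w = gm c x (G u v) w"
      unfolding koszul_def comp using sym[of v u] sym[of w u] sym[of w v] gm_sym[OF c x, of "G u w" v]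
      by simp
    then show "gm c x (G u v) w = gm c x (christoffel c x u v) w" by (simp add: gm_christoffel)
  qed
qed

end

lemma christoffel_smooth:
  assumes c: "c \<in> A" shows "smooth_on (coord c ` dom_of c) (\<lambda>x. christoffel c x u v)"
proof -
  let ?O = "coord c ` dom_of c"
  have O: "open ?O" by (rule chart_image_open[OF c])
  have th: "thick ?O" by (rule thick_open[OF O])
  have gm: "smooth_on ?O (\<lambda>x. gm c x v w)" for v w
    unfolding gm_def by (rule metric_smooth[OF c])
  have gder: "smooth_on ?O (\<lambda>x. gder c x z v w)" for z v w
    unfolding gder_def by (rule smooth_on_deriv[OF gm O])
  have kos: "smooth_on ?O (\<lambda>x. koszul c x u v i)" for i
  proof -
    have "smooth_on ?O (\<lambda>x. (1/2) * (gder c x u v i + gder c x v u i - gder c x i u v))"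
      by (intro smooth_on_mult smooth_on_add smooth_on_diff smooth_on_const gder th)
    then show ?thesis by (simp add: koszul_def)
  qed
  have inv: "smooth_on ?O (\<lambda>x. inv (gmat c x) i)" for i
  proof (rule smooth_on_inv_linear[OF O gmat_linear[OF c] gmat_inj[OF c]])
    show "smooth_on ?O (\<lambda>x. gmat c x v)" for v
      unfolding gmat_def by (intro smooth_on_sum smooth_on_scaleR gm smooth_on_const th)
  qed
  \<comment> \<open>The inverse is moved inside the sum, so that it acts on fixed basis vectors as
    in \<open>smooth_on_inv_linear\<close>.\<close>
  have "smooth_on ?O (\<lambda>x. \<Sum>i\<in>Basis. koszul c x u v i *\<^sub>R inv (gmat c x) i)"
    by (intro smooth_on_sum smooth_on_scaleR kos inv th)
  then show ?thesis
  proof (rule smooth_on_cong[THEN iffD1, rotated])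
    fix x assume x: "x \<in> ?O"
    have "linear (inv (gmat c x))"
      by (rule inj_linear_imp_inv_linear[OF gmat_linear[OF c x] gmat_inj[OF c x]])
    from linear_sum[OF this, of "\<lambda>i. koszul c x u v i *\<^sub>R i" Basis] linear_scale[OF this]
    show "(\<Sum>i\<in>Basis. koszul c x u v i *\<^sub>R inv (gmat c x) i) = christoffel c x u v"
      unfolding christoffel_def by simp
  qed
qed

text \<open>The geodesic equation as a first-order system for position and velocity in a bundle
  chart.\<close>

definition spray :: "('m, 'e) chart \<Rightarrow> 'e \<times> 'e \<Rightarrow> 'e \<times> 'e" where
  "spray c z = (snd z, - riemannian_connection A g c (fst z) (snd z) (snd z))"

lemma spray_smooth:
  assumes c: "c \<in> A" shows "smooth_on (coord c ` dom_of c \<times> UNIV) (spray c)"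
proof -
  let ?S = "coord c ` dom_of c \<times> (UNIV :: 'e set)"
  have th: "thick ?S" by (intro thick_open open_Times chart_image_open c open_UNIV)
  have fst: "smooth_on ?S fst"
    using smooth_on_linear[OF th bounded_linear_fst smooth_on_id[OF th]] by simp
  have snd: "smooth_on ?S snd"
    using smooth_on_linear[OF th bounded_linear_snd smooth_on_id[OF th]] by simp
  have comp: "smooth_on ?S (\<lambda>z. christoffel c (fst z) i j)" for i j
    by (rule smooth_on_compose[OF th _ fst christoffel_smooth[OF c]]) auto
  have "smooth_on ?S (\<lambda>z. (snd z, - (\<Sum>i\<in>Basis. \<Sum>j\<in>Basis. ((snd z \<bullet> i) * (snd z \<bullet> j)) *\<^sub>R christoffel c (fst z) i j)))"
    by (intro smooth_on_Pair smooth_on_minus smooth_on_sum smooth_on_scaleR smooth_on_mult smooth_on_inner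
        smooth_on_const comp snd th)
  then show ?thesis
  proof (rule smooth_on_cong[THEN iffD1, rotated])
    fix z assume "z \<in> ?S"
    then have x: "fst z \<in> coord c ` dom_of c" by auto
    have lin: "linear (\<lambda>v. christoffel c (fst z) u v)" for u
      using christoffel_linear[OF c x, of u] by (simp add: christoffel_sym[OF c x])
    have "christoffel c (fst z) (snd z) (snd z) = (\<Sum>i\<in>Basis. (snd z \<bullet> i) *\<^sub>R christoffel c (fst z) i (snd z))"
      by (rule linear_sum_Basis[OF christoffel_linear[OF c x]])
    also have "\<dots> = (\<Sum>i\<in>Basis. (snd z \<bullet> i) *\<^sub>R (\<Sum>j\<in>Basis. (snd z \<bullet> j) *\<^sub>R christoffel c (fst z) i j))"
      by (intro sum.cong refl arg_cong2[where f = scaleR] linear_sum_Basis[OF lin])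
    finally show "(snd z, - (\<Sum>i\<in>Basis. \<Sum>j\<in>Basis. ((snd z \<bullet> i) * (snd z \<bullet> j)) *\<^sub>R christoffel c (fst z) i j)) = spray c z"
      by (simp add: spray_def riemannian_connection_eq[OF c x] scaleR_sum_right)
  qed
qed

section \<open>Transformation law of the Christoffel symbols; the spray as a vector field on
  TM\<close>

lemma gm_change:
  assumes c: "c \<in> A" "p \<in> dom_of c" and d: "d \<in> A" "p \<in> dom_of d"
  shows "gm c (coord c p) u w = gm d (coord d p)
    (frechet_derivative (transition c d) (at (coord c p)) u) (frechet_derivative (transition c d) (at (coord c p)) w)"
  by (simp add: gm_coord[OF c] gm_coord[OF d] coord_tvec_change[OF c d])

text \<open>In the chart c the metric is the pullback of its expression in d. Differentiation
  therefore hits the base point and, through second derivatives of the transition map, each of the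
  two vectors.\<close>

lemma gder_change:
  assumes c: "c \<in> A" "p \<in> dom_of c" and d: "d \<in> A" "p \<in> dom_of d"
  defines "D \<equiv> \<lambda>x. frechet_derivative (transition c d) (at x)"
  defines "H \<equiv> \<lambda>a z. frechet_derivative (\<lambda>x. D x a) (at (coord c p)) z"
  shows "gder c (coord c p) z a b =
    gder d (coord d p) (D (coord c p) z) (D (coord c p) a) (D (coord c p) b)
    + gm d (coord d p) (H a z) (D (coord c p) b) + gm d (coord d p) (D (coord c p) a) (H b z)"
proof -
  let ?O = "coord c ` (dom_of c \<inter> dom_of d)" and ?\<phi> = "transition c d" and ?x = "coord c p" and ?y =
    "coord d p"
  have O: "open ?O" "?x \<in> ?O" using overlap_open[OF c(1) d(1)] c d by blast+
  have y: "?y \<in> coord d ` dom_of d" using d by blast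
  have xO: "?x \<in> coord c ` dom_of c" using c by blast
  have H: "((\<lambda>x. D x a) has_derivative H a) (at ?x)" for a
    unfolding H_def D_def
    by (rule smooth_on_has_derivative[OF smooth_on_deriv[OF transition_smooth[OF c(1) d(1)] O(1)] O])
  have \<phi>: "(?\<phi> has_derivative D ?x) (at ?x)" unfolding D_def
    by (rule transition_derivative[OF c(1) d(1) c(2) d(2)])
  have "((\<lambda>y. gm d y i j) has_derivative (\<lambda>z. gder d ?y z i j)) (at (?\<phi> ?x))" for i j
    using gm_has_derivative[OF d(1) y] by (simp add: transition_coord[OF c])
  from diff_chain_at[OF \<phi> this]
  have G: "((\<lambda>x. gm d (?\<phi> x) i j) has_derivative (\<lambda>z. gder d ?y (D ?x z) i j)) (at ?x)" for i j
    by (simp add: o_def)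
  \<comment> \<open>Base point and both vectors vary with x; expanded over pairs of basis vectors
    the metric becomes a sum of products of functions of x.\<close>
  let ?F = "\<lambda>x. \<Sum>i\<in>Basis. \<Sum>j\<in>Basis. ((D x a \<bullet> i) * (D x b \<bullet> j)) * gm d (?\<phi> x) i j"
  let ?F' = "\<lambda>z. \<Sum>i\<in>Basis. \<Sum>j\<in>Basis. ((D ?x a \<bullet> i) * (D ?x b \<bullet> j)) * gder d ?y (D ?x z) i j
     + ((D ?x a \<bullet> i) * (H b z \<bullet> j) + (H a z \<bullet> i) * (D ?x b \<bullet> j)) * gm d (?\<phi> ?x) i j"
  have "(?F has_derivative ?F') (at ?x)"
    by (intro has_derivative_sum has_derivative_mult has_derivative_inner_left H G)
  then have "((\<lambda>x. gm c x a b) has_derivative ?F') (at ?x)"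
  proof (rule has_derivative_transform_within_open[OF _ O])
    fix x assume "x \<in> ?O"
    then obtain q where q: "q \<in> dom_of c" "q \<in> dom_of d" "x = coord c q" by blast
    have yq: "coord d q \<in> coord d ` dom_of d" using q by blast
    show "?F x = gm c x a b"
      unfolding q(3) transition_coord[OF c(1) q(1)] gm_change[OF c(1) q(1) d(1) q(2)] D_def
      by (rule bilinear_form_sum[OF gm_linear_left[OF d(1) yq] gm_linear_right[OF d(1) yq], symmetric])
  qed
  from fun_cong[OF has_derivative_unique[OF gm_has_derivative[OF c(1) xO] this], of z]
  have "gder c ?x z a b = ?F' z" .
  also have "\<dots> = (\<Sum>i\<in>Basis. \<Sum>j\<in>Basis. ((D ?x a \<bullet> i) * (D ?x b \<bullet> j)) * gder d ?y (D ?x z) i j)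
      + (\<Sum>i\<in>Basis. \<Sum>j\<in>Basis. ((H a z \<bullet> i) * (D ?x b \<bullet> j)) * gm d ?y i j)
      + (\<Sum>i\<in>Basis. \<Sum>j\<in>Basis. ((D ?x a \<bullet> i) * (H b z \<bullet> j)) * gm d ?y i j)"
    by (simp add: transition_coord[OF c] sum.distrib distrib_right)
  also have "\<dots> = gder d ?y (D ?x z) (D ?x a) (D ?x b) + gm d ?y (H a z) (D ?x b) + gm d ?y (D ?x a) (H b z)"
    unfolding bilinear_form_sum[OF gm_linear_left[OF d(1) y] gm_linear_right[OF d(1) y], symmetric]
      bilinear_form_sum[OF gder_linear_left[OF d(1) y] gder_linear_right[OF d(1) y], symmetric] ..
  finally show ?thesis .
qed

text \<open>Of the second derivatives that \<open>gder_change\<close> produces in the Koszul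
  expression, those involving w cancel by symmetry of second derivatives, and H u u remains. Only
  the diagonal is considered because the spray evaluates the Christoffel symbols at (u, u).\<close>

lemma christoffel_change:
  assumes c: "c \<in> A" "p \<in> dom_of c" and d: "d \<in> A" "p \<in> dom_of d"
  defines "D \<equiv> \<lambda>x. frechet_derivative (transition c d) (at x)"
  defines "H \<equiv> \<lambda>a z. frechet_derivative (\<lambda>x. D x a) (at (coord c p)) z"
  shows "christoffel d (coord d p) (D (coord c p) u) (D (coord c p) u)
    = D (coord c p) (christoffel c (coord c p) u u) - H u u"
proof -
  let ?x = "coord c p" and ?y = "coord d p"
  let ?D = "D (coord c p)"
  have x: "?x \<in> coord c ` dom_of c" and y: "?y \<in> coord d ` dom_of d" using c d by blast+
  have O: "open (coord c ` (dom_of c \<inter> dom_of d))" "?x \<in> coord c ` (dom_of c \<inter> dom_of d)"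
    using overlap_open[OF c(1) d(1)] c d by blast+
  have Hsym: "H a b = H b a" for a b
    unfolding H_def D_def
    by (rule second_derivative_symmetric[OF transition_smooth[OF c(1) d(1)] O])
  \<comment> \<open>The derivative of the transition map is onto, so every test vector in the chart
    d can be written as the image of a vector w in the chart c.\<close>
  have onto: "?D (frechet_derivative (transition d c) (at ?y) w) = w" for w
    unfolding D_def by (simp add: transition_cocycle[OF d c d] transition_self_derivative[OF d])
  have change: "gder c ?x z a b = gder d ?y (?D z) (?D a) (?D b) + gm d ?y (H a z) (?D b) + gm d ?y (?D a) (H b z)"
    for z a b unfolding D_def H_def by (rule gder_change[OF c d])
  show ?thesis
  proof (rule gm_nondegenerate[OF d(1) y])
    fix w'
    define w where "w = frechet_derivative (transition d c) (at ?y) w'"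
    have w: "?D w = w'" by (simp add: w_def onto)
    have "gm d ?y (?D (christoffel c ?x u u)) w' = gm c ?x (christoffel c ?x u u) w"
      unfolding D_def gm_change[OF c d] using w by (simp add: D_def)
    also have "\<dots> = koszul c ?x u u w" by (rule gm_christoffel[OF c(1) x])
    also have "\<dots> = koszul d ?y (?D u) (?D u) (?D w) + gm d ?y (H u u) (?D w)"
      unfolding koszul_def change Hsym[of u w] gm_sym[OF d(1) y, of "?D u" "H w u"]
      by (simp add: field_simps)
    also have "koszul d ?y (?D u) (?D u) (?D w) = gm d ?y (christoffel d ?y (?D u) (?D u)) w'"
      by (simp add: gm_christoffel[OF d(1) y] w)
    finally show "gm d ?y (christoffel d ?y (?D u) (?D u)) w' = gm d ?y (?D (christoffel c ?x u u) - H u u) w'"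
      by (simp add: linear_diff[OF gm_linear_left[OF d(1) y]] w)
  qed
qed

text \<open>In \<open>field_related\<close> the second derivative of the transition map from
  \<open>bundle_transition_derivative\<close> cancels against the one in
  \<open>christoffel_change\<close>: the local sprays form one vector field on TM.\<close>

sublocale flow: chart_flow A "bundle_chart A" spray
proof
  fix c assume c: "c \<in> A"
  show "inj_on (coord (bundle_chart A c)) (dom_of (bundle_chart A c))" by (rule bundle_inj[OF c])
  show "open (coord (bundle_chart A c) ` dom_of (bundle_chart A c))"
    unfolding bundle_image_dom[OF c] by (intro open_Times chart_image_open c open_UNIV)
  show "smooth_on (coord (bundle_chart A c) ` dom_of (bundle_chart A c)) (spray c)"
    unfolding bundle_image_dom[OF c] by (rule spray_smooth[OF c])
next
  fix c d assume c: "c \<in> A" and d: "d \<in> A"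
  show "open (coord (bundle_chart A c) ` (dom_of (bundle_chart A c) \<inter> dom_of (bundle_chart A d)))"
    unfolding bundle_image[OF c] by (intro open_Times overlap_open c d open_UNIV)
  show "smooth_on (coord (bundle_chart A c) ` (dom_of (bundle_chart A c) \<inter> dom_of (bundle_chart A d)))
    (transition (bundle_chart A c) (bundle_chart A d))" by (rule bundle_transition_smooth[OF c d])
next
  fix c d p q and z :: "nat \<Rightarrow> 'm \<times> ('m, 'e) tvec"
  assume "c \<in> A" "d \<in> A" "p \<in> dom_of (bundle_chart A c)" "q \<in> dom_of (bundle_chart A d)"
    "\<And>n. z n \<in> dom_of (bundle_chart A c) \<inter> dom_of (bundle_chart A d)"
    "(\<lambda>n. coord (bundle_chart A c) (z n)) \<longlonglongrightarrow> coord (bundle_chart A c) p"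
    "(\<lambda>n. coord (bundle_chart A d) (z n)) \<longlonglongrightarrow> coord (bundle_chart A d) q"
  then show "p = q" by (intro bundle_limit_unique)
next
  fix c d v assume c: "c \<in> A" and d: "d \<in> A" and vc: "v \<in> dom_of (bundle_chart A c)" and vd:
    "v \<in> dom_of (bundle_chart A d)"
  define p where "p = fst v"
  define u where "u = snd v c"
  have p: "p \<in> dom_of c" "p \<in> dom_of d" and t: "snd v \<in> tangent_space A p"
    using vc vd by (simp_all add: bundle_dom p_def)
  have x: "coord c p \<in> coord c ` dom_of c" and y: "coord d p \<in> coord d ` dom_of d" using p by blast+
  have ud: "snd v d = frechet_derivative (transition c d) (at (coord c p)) u"
    using tangent_component[OF t c p(1) d p(2)] by (simp add: u_def)
  have vcoord: "coord (bundle_chart A c) v = (coord c p, u)"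
    "coord (bundle_chart A d) v = (coord d p, snd v d)"
    by (simp_all add: bundle_coord p_def u_def)
  have "frechet_derivative (transition (bundle_chart A c) (bundle_chart A d)) (at (coord c p, u))
      (u, - christoffel c (coord c p) u u) = (snd v d, - christoffel d (coord d p) (snd v d) (snd v d))"
    unfolding bundle_transition_derivative[OF c p(1) d p(2)] ud christoffel_change[OF c p(1) d p(2)]
    by (simp add: linear_neg[OF transition_linear[OF c d p]])
  then show "frechet_derivative (transition (bundle_chart A c) (bundle_chart A d)) (at (coord (bundle_chart A c) v))
      (spray c (coord (bundle_chart A c) v)) = spray d (coord (bundle_chart A d) v)"
    unfolding vcoord spray_def fst_conv snd_conv
      riemannian_connection_eq[OF c x] riemannian_connection_eq[OF d y] .
qed

end

section \<open>The cut-off exponential map\<close>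

lemma smooth_curve_onD:
  assumes "smooth_curve_on B I l" "t \<in> I" "C \<in> B" "l t \<in> dom_of C"
  obtains \<epsilon> where "0 < \<epsilon>" "l ` (I \<inter> ball t \<epsilon>) \<subseteq> dom_of C" "smooth_on (I \<inter> ball t \<epsilon>) (\<lambda>r. coord C (l r))"
  using assms unfolding smooth_curve_on_def by blast

lemma at_within_Int_ball:
  assumes "r \<in> ball s \<epsilon>" shows "at r within I \<inter> ball s \<epsilon> = at r within I"
  by (rule at_within_nhd[OF assms open_ball]) blast

text \<open>The geodesic equation is of second order, so the first two derivatives are extracted
  from smoothness.\<close>

lemma smooth_on_real_derivatives:
  fixes f :: "real \<Rightarrow> 'b::real_normed_vector"
  assumes "smooth_on J f" "r \<in> J"
  shows "(f has_vector_derivative frechet_derivative f (at r within J) 1) (at r within J)"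
    and "\<exists>f''. ((\<lambda>r. frechet_derivative f (at r within J) 1) has_vector_derivative f'') (at r within J)"
proof -
  have "C_k_on (Suc 0) J f" "C_k_on (Suc (Suc 0)) J f"
    using assms(1) by (simp_all add: smooth_on_def del: C_k_on.simps)
  then show "(f has_vector_derivative frechet_derivative f (at r within J) 1) (at r within J)"
    using has_derivative_imp_has_vector_derivative[OF C_k_on_SucD] assms(2) by blast
  have "C_k_on (Suc 0) J (\<lambda>r. frechet_derivative f (at r within J) 1)"
    using \<open>C_k_on (Suc (Suc 0)) J f\<close> C_k_on.simps(2)[of "Suc 0" J f] by blast
  from has_derivative_imp_has_vector_derivative[OF C_k_on_SucD[OF this assms(2)]]
  show "\<exists>f''. ((\<lambda>r. frechet_derivative f (at r within J) 1) has_vector_derivative f'') (at r within J)"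
    by blast
qed

definition scale_vec :: "real \<Rightarrow> 'm \<times> ('m, 'e::real_normed_vector) tvec \<Rightarrow> 'm \<times> ('m, 'e) tvec" where
  "scale_vec r v = (fst v, \<lambda>c. r *\<^sub>R snd v c)"

lemma scale_vec_scale_vec: "scale_vec r (scale_vec s v) = scale_vec (r * s) v"
  by (simp add: scale_vec_def)

section \<open>Velocities and curves in the tangent bundle\<close>

context smooth_manifold
begin

lemma velocity_component:
  "c \<in> A \<Longrightarrow> \<sigma> s \<in> dom_of c \<Longrightarrow>
    snd (velocity A I \<sigma> s) c = vector_derivative (\<lambda>r. coord c (\<sigma> r)) (at s within I)"
  by (simp add: velocity_def)

lemma fst_velocity: "fst (velocity A I \<sigma> s) = \<sigma> s"
  by (simp add: velocity_def)

text \<open>\<open>velocity\<close> differentiates within [a,b], while smoothness is recorded on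
  pieces of [a,b] cut out by balls. At points of such a ball the two filters agree, so the velocity
  equals the derivative on the piece and can be differentiated once more.\<close>

lemma smooth_curve_local:
  assumes ab: "a < b" and \<sigma>: "smooth_curve_on A {a..b} \<sigma>" and s: "s \<in> {a..b}"
    and c: "c \<in> A" "\<sigma> s \<in> dom_of c"
  shows "\<forall>\<^sub>F r in at s within {a..b}. \<sigma> r \<in> dom_of c"
    and "((\<lambda>r. coord c (\<sigma> r)) has_vector_derivative snd (velocity A {a..b} \<sigma> s) c) (at s within {a..b})"
    and "((\<lambda>r. snd (velocity A {a..b} \<sigma> r) c) has_vector_derivative
      vector_derivative (\<lambda>r. snd (velocity A {a..b} \<sigma> r) c) (at s within {a..b})) (at s within {a..b})"
proof -
  let ?I = "{a..b}" and ?f = "\<lambda>r. coord c (\<sigma> r)"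
  obtain \<epsilon> where \<epsilon>: "0 < \<epsilon>" "\<sigma> ` (?I \<inter> ball s \<epsilon>) \<subseteq> dom_of c" "smooth_on (?I \<inter> ball s \<epsilon>) ?f"
    using smooth_curve_onD[OF \<sigma> s c] .
  let ?J = "?I \<inter> ball s \<epsilon>"
  have near: "\<forall>\<^sub>F r in at s within ?I. r \<in> ?J"
    unfolding eventually_at using \<epsilon>(1) by (intro exI[of _ \<epsilon>]) (simp add: dist_commute)
  then show "\<forall>\<^sub>F r in at s within ?I. \<sigma> r \<in> dom_of c"
    by eventually_elim (use \<epsilon>(2) in blast)
  have f: "(?f has_vector_derivative frechet_derivative ?f (at r within ?J) 1) (at r within ?I)" if
    "r \<in> ?J" for r
    using smooth_on_real_derivatives(1)[OF \<epsilon>(3) that] at_within_Int_ball[of r s \<epsilon> ?I] that by simp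
  have vel: "snd (velocity A ?I \<sigma> r) c = frechet_derivative ?f (at r within ?J) 1" if r: "r \<in> ?J" for r
  proof -
    have "\<sigma> r \<in> dom_of c" using \<epsilon>(2) r by blast
    moreover have "vector_derivative ?f (at r within ?I) = frechet_derivative ?f (at r within ?J) 1"
      using vector_derivative_within_closed_interval[OF ab _ f[OF r]] r by blast
    ultimately show ?thesis using velocity_component[OF c(1)] by simp
  qed
  have sJ: "s \<in> ?J" using s \<epsilon>(1) by simp
  show "(?f has_vector_derivative snd (velocity A ?I \<sigma> s) c) (at s within ?I)"
    unfolding vel[OF sJ] by (rule f[OF sJ])
  obtain f'' where "((\<lambda>r. frechet_derivative ?f (at r within ?J) 1) has_vector_derivative f'') (at s within ?J)"
    using smooth_on_real_derivatives(2)[OF \<epsilon>(3) sJ] by blast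
  then have "((\<lambda>r. snd (velocity A ?I \<sigma> r) c) has_vector_derivative f'') (at s within ?J)"
    by (rule has_vector_derivative_transform[OF sJ, rotated]) (rule vel)
  then have "((\<lambda>r. snd (velocity A ?I \<sigma> r) c) has_vector_derivative f'') (at s within ?I)"
    using at_within_Int_ball[of s s \<epsilon> ?I] \<epsilon>(1) by simp
  moreover from vector_derivative_within_closed_interval[OF ab s this]
  have "vector_derivative (\<lambda>r. snd (velocity A ?I \<sigma> r) c) (at s within ?I) = f''" .
  ultimately show "((\<lambda>r. snd (velocity A ?I \<sigma> r) c) has_vector_derivative
      vector_derivative (\<lambda>r. snd (velocity A ?I \<sigma> r) c) (at s within ?I)) (at s within ?I)" by simp
qed

lemma velocity_tangent:
  assumes ab: "a < b" and \<sigma>: "smooth_curve_on A {a..b} \<sigma>" and s: "s \<in> {a..b}"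
  shows "snd (velocity A {a..b} \<sigma> s) \<in> tangent_space A (\<sigma> s)"
proof -
  let ?w = "snd (velocity A {a..b} \<sigma> s)"
  have "?w d = frechet_derivative (transition c d) (at (coord c (\<sigma> s))) (?w c)"
    if c: "c \<in> A" and d: "d \<in> A" and p: "\<sigma> s \<in> dom_of c \<inter> dom_of d" for c d
  proof -
    have pc: "\<sigma> s \<in> dom_of c" and pd: "\<sigma> s \<in> dom_of d" using p by blast+
    note lc = smooth_curve_local[OF ab \<sigma> s c pc] and ld = smooth_curve_local[OF ab \<sigma> s d pd]
    have "((\<lambda>r. transition c d (coord c (\<sigma> r))) has_vector_derivative
        frechet_derivative (transition c d) (at (coord c (\<sigma> s))) (?w c)) (at s within {a..b})"
      using vector_derivative_diff_chain_within[OF lc(2) has_derivative_at_withinI[OF transition_derivative[OF c d pc pd]]]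
      by (simp add: o_def)
    then have "((\<lambda>r. coord d (\<sigma> r)) has_vector_derivative
        frechet_derivative (transition c d) (at (coord c (\<sigma> s))) (?w c)) (at s within {a..b})"
      unfolding has_vector_derivative_def
    proof (rule has_derivative_transform_eventually)
      show "\<forall>\<^sub>F r in at s within {a..b}. transition c d (coord c (\<sigma> r)) = coord d (\<sigma> r)"
        using lc(1) by eventually_elim (simp add: transition_coord[OF c])
      show "transition c d (coord c (\<sigma> s)) = coord d (\<sigma> s)" by (rule transition_coord[OF c pc])
    qed (rule s)
    from vector_derivative_within_closed_interval[OF ab s this] show ?thesis
      using velocity_component[where \<sigma> = \<sigma> and s = s, OF d pd] by simp
  qed
  moreover have "?w c = 0" if "\<not> (c \<in> A \<and> \<sigma> s \<in> dom_of c)" for c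
    unfolding velocity_def snd_conv using that by (rule if_not_P)
  ultimately show ?thesis unfolding tangent_space_def by blast
qed

lemma scale_vec_dom: "v \<in> dom_of (bundle_chart A c) \<Longrightarrow> scale_vec r v \<in> dom_of (bundle_chart A c)"
  unfolding bundle_dom by (simp add: scale_vec_def tangent_space_scale)

lemma scale_vec_coord: "coord (bundle_chart A c) (scale_vec r v) = (coord c (fst v), r *\<^sub>R snd v c)"
  by (simp add: scale_vec_def bundle_coord)

lemma scale_vec_coord_dist:
  "dist (coord (bundle_chart A c) (scale_vec r v)) (coord (bundle_chart A c) (scale_vec r w))
    \<le> (1 + \<bar>r\<bar>) * dist (coord (bundle_chart A c) v) (coord (bundle_chart A c) w)"
proof -
  have "dist (coord (bundle_chart A c) (scale_vec r v)) (coord (bundle_chart A c) (scale_vec r w))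
      \<le> dist (coord c (fst v)) (coord c (fst w)) + dist (r *\<^sub>R snd v c) (r *\<^sub>R snd w c)"
    unfolding scale_vec_coord dist_Pair_Pair by (rule sqrt_sum_squares_le_sum) simp_all
  also have "dist (r *\<^sub>R snd v c) (r *\<^sub>R snd w c) = \<bar>r\<bar> * dist (snd v c) (snd w c)"
    by (simp add: dist_norm scaleR_diff_right[symmetric])
  also have "dist (coord c (fst v)) (coord c (fst w)) \<le> dist (coord (bundle_chart A c) v) (coord (bundle_chart A c) w)"
    using dist_fst_le[of "coord (bundle_chart A c) v" "coord (bundle_chart A c) w"]
      by (simp add: bundle_coord)
  also have "dist (snd v c) (snd w c) \<le> dist (coord (bundle_chart A c) v) (coord (bundle_chart A c) w)"
    using dist_snd_le[of "coord (bundle_chart A c) v" "coord (bundle_chart A c) w"]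
      by (simp add: bundle_coord)
  finally show ?thesis by (simp add: distrib_right mult_left_mono)
qed

lemma bundle_chart_exists: "v \<in> tangent_bundle A \<Longrightarrow> \<exists>c\<in>A. v \<in> dom_of (bundle_chart A c)"
proof -
  assume v: "v \<in> tangent_bundle A"
  obtain c where "c \<in> A" "fst v \<in> dom_of c" using charts_cover by blast
  then show ?thesis using v by (intro bexI[of _ c]) (simp_all add: bundle_chart_def)
qed

lemma bundle_domI: "v \<in> tangent_bundle A \<Longrightarrow> fst v \<in> dom_of c \<Longrightarrow> v \<in> dom_of (bundle_chart A c)"
  by (simp add: bundle_chart_def)

lemma bundle_domD: "v \<in> dom_of (bundle_chart A c) \<Longrightarrow> v \<in> tangent_bundle A \<and> fst v \<in> dom_of c"
  by (simp add: bundle_chart_def)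

lemma curve_in_bundle:
  assumes "smooth_curve_on (tangent_atlas A) I l" "t \<in> I" shows "l t \<in> tangent_bundle A"
proof -
  obtain C where "C \<in> tangent_atlas A" "l t \<in> dom_of C"
    using assms unfolding smooth_curve_on_def by blast
  then show ?thesis unfolding tangent_atlas_def using bundle_domD by blast
qed

lemma curve_base:
  assumes l: "smooth_curve_on (tangent_atlas A) I l" and I: "thick I"
  shows "smooth_curve_on A I (\<lambda>t. fst (l t))"
  unfolding smooth_curve_on_def
proof (intro conjI ballI impI)
  show "(\<lambda>t. fst (l t)) ` I \<subseteq> (\<Union>c\<in>A. dom_of c)" using charts_cover by simp
  fix c t assume c: "c \<in> A" and t: "t \<in> I" and p: "fst (l t) \<in> dom_of c"
  have "l t \<in> dom_of (bundle_chart A c)" by (rule bundle_domI[OF curve_in_bundle[OF l t] p])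
  moreover have "bundle_chart A c \<in> tangent_atlas A" using c by (simp add: tangent_atlas_def)
  ultimately obtain \<epsilon> where \<epsilon>: "0 < \<epsilon>" "l ` (I \<inter> ball t \<epsilon>) \<subseteq> dom_of (bundle_chart A c)"
    "smooth_on (I \<inter> ball t \<epsilon>) (\<lambda>r. coord (bundle_chart A c) (l r))"
    using smooth_curve_onD[OF l t] by metis
  have "(\<lambda>t. fst (l t)) ` (I \<inter> ball t \<epsilon>) \<subseteq> dom_of c"
    using \<epsilon>(2) bundle_domD by blast
  moreover have "smooth_on (I \<inter> ball t \<epsilon>) (\<lambda>r. coord c (fst (l r)))"
    using smooth_on_linear[OF thick_Int_open[OF I open_ball] bounded_linear_fst \<epsilon>(3)]
      by (simp add: bundle_coord)
  ultimately show "\<exists>\<epsilon>>0. (\<lambda>t. fst (l t)) ` (I \<inter> ball t \<epsilon>) \<subseteq> dom_of c \<and>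
      smooth_on (I \<inter> ball t \<epsilon>) (\<lambda>r. coord c (fst (l r)))" using \<epsilon>(1) by blast
qed

lemma curve_scale:
  assumes l: "smooth_curve_on (tangent_atlas A) I l" and I: "thick I"
    and f: "\<And>t. t \<in> I \<Longrightarrow> \<exists>\<epsilon>>0. smooth_on (I \<inter> ball t \<epsilon>) f"
  shows "smooth_curve_on (tangent_atlas A) I (\<lambda>t. scale_vec (f t) (l t))"
  unfolding smooth_curve_on_def
proof (intro conjI ballI impI)
  have fst: "fst (scale_vec r v) = fst v" for r and v :: "'m \<times> ('m, 'e) tvec"
    by (simp add: scale_vec_def)
  show "(\<lambda>t. scale_vec (f t) (l t)) ` I \<subseteq> (\<Union>C\<in>tangent_atlas A. dom_of C)"
  proof
    fix v assume "v \<in> (\<lambda>t. scale_vec (f t) (l t)) ` I"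
    then obtain t where t: "t \<in> I" "v = scale_vec (f t) (l t)" by blast
    obtain c where "c \<in> A" "l t \<in> dom_of (bundle_chart A c)"
      using bundle_chart_exists[OF curve_in_bundle[OF l t(1)]] by blast
    then show "v \<in> (\<Union>C\<in>tangent_atlas A. dom_of C)"
      unfolding t(2) tangent_atlas_def using scale_vec_dom by blast
  qed
  fix C t assume "C \<in> tangent_atlas A" and t: "t \<in> I" and p: "scale_vec (f t) (l t) \<in> dom_of C"
  then obtain c where c: "c \<in> A" "C = bundle_chart A c" unfolding tangent_atlas_def by blast
  have "fst (l t) \<in> dom_of c" using bundle_domD[OF p[unfolded c(2)]] by (simp add: fst)
  then have "l t \<in> dom_of (bundle_chart A c)" by (rule bundle_domI[OF curve_in_bundle[OF l t]])
  moreover have "bundle_chart A c \<in> tangent_atlas A" using c by (simp add: tangent_atlas_def)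
  ultimately obtain \<epsilon>1 where \<epsilon>1: "0 < \<epsilon>1" "l ` (I \<inter> ball t \<epsilon>1) \<subseteq> dom_of (bundle_chart A c)"
    "smooth_on (I \<inter> ball t \<epsilon>1) (\<lambda>r. coord (bundle_chart A c) (l r))"
    using smooth_curve_onD[OF l t] by metis
  obtain \<epsilon>2 where \<epsilon>2: "0 < \<epsilon>2" "smooth_on (I \<inter> ball t \<epsilon>2) f" using f[OF t] by blast
  define \<epsilon> where "\<epsilon> = min \<epsilon>1 \<epsilon>2"
  let ?J = "I \<inter> ball t \<epsilon>"
  have J: "thick ?J" by (rule thick_Int_open[OF I open_ball])
  have sub: "?J \<subseteq> I \<inter> ball t \<epsilon>1" "?J \<subseteq> I \<inter> ball t \<epsilon>2" by (auto simp: \<epsilon>_def)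
  have lJ: "smooth_on ?J (\<lambda>r. coord (bundle_chart A c) (l r))"
    by (rule smooth_on_subset[OF \<epsilon>1(3) J sub(1)])
  have "smooth_on ?J (\<lambda>r. (fst (coord (bundle_chart A c) (l r)), f r *\<^sub>R snd (coord (bundle_chart A c) (l r))))"
    by (intro smooth_on_Pair smooth_on_scaleR J smooth_on_linear[OF J bounded_linear_fst lJ]
        smooth_on_linear[OF J bounded_linear_snd lJ] smooth_on_subset[OF \<epsilon>2(2) J sub(2)])
  then have "smooth_on ?J (\<lambda>r. coord C (scale_vec (f r) (l r)))"
    unfolding c(2) scale_vec_coord by (simp add: bundle_coord)
  moreover have "(\<lambda>t. scale_vec (f t) (l t)) ` ?J \<subseteq> dom_of C"
    using \<epsilon>1(2) sub(1) scale_vec_dom unfolding c(2) by blast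
  moreover have "0 < \<epsilon>" using \<epsilon>1 \<epsilon>2 by (simp add: \<epsilon>_def)
  ultimately show "\<exists>\<epsilon>>0. (\<lambda>t. scale_vec (f t) (l t)) ` (I \<inter> ball t \<epsilon>) \<subseteq> dom_of C \<and>
      smooth_on (I \<inter> ball t \<epsilon>) (\<lambda>r. coord C (scale_vec (f r) (l r)))" by blast
qed

text \<open>Smooth curves are defined through charts. Composition with the inverse of a chart, which
  is continuous, recovers continuity for the topology of M, where the complement of C is
  open.\<close>

lemma curve_avoids_compact:
  assumes l: "smooth_curve_on A I l" and t: "t \<in> I" and "closed C" "l t \<notin> C"
  obtains \<epsilon> where "0 < \<epsilon>" "\<And>r. r \<in> I \<inter> ball t \<epsilon> \<Longrightarrow> l r \<notin> C"
proof -
  obtain d where d: "d \<in> A" "l t \<in> dom_of d" using charts_cover by blast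
  obtain \<epsilon>1 where \<epsilon>1: "0 < \<epsilon>1" "l ` (I \<inter> ball t \<epsilon>1) \<subseteq> dom_of d"
    "smooth_on (I \<inter> ball t \<epsilon>1) (\<lambda>r. coord d (l r))"
    using smooth_curve_onD[OF l t d] .
  have inv: "continuous_on (coord d ` dom_of d) (chart_inv d)"
    using chart_homeomorphism[OF d(1)] by (simp add: homeomorphism_def)
  have "continuous_on (I \<inter> ball t \<epsilon>1) (\<lambda>r. chart_inv d (coord d (l r)))"
    by (rule continuous_on_compose2[OF inv smooth_on_continuous[OF \<epsilon>1(3)]]) (use \<epsilon>1(2) in blast)
  then have cont: "continuous_on (I \<inter> ball t \<epsilon>1) l"
  proof (rule continuous_on_eq)
    fix r assume "r \<in> I \<inter> ball t \<epsilon>1"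
    then have "l r \<in> dom_of d" using \<epsilon>1(2) by blast
    then show "chart_inv d (coord d (l r)) = l r" by (rule inv_coord[OF d(1)])
  qed
  have tJ: "t \<in> I \<inter> ball t \<epsilon>1" using t \<epsilon>1(1) by simp
  have "\<forall>\<^sub>F r in at t within I \<inter> ball t \<epsilon>1. l r \<in> - C"
    using cont tJ assms(3,4) unfolding continuous_on_def
    by (intro topological_tendstoD[of l "l t"]) (auto intro: open_Compl)
  then obtain \<epsilon>2 where \<epsilon>2: "0 < \<epsilon>2" "\<And>r. r \<in> I \<inter> ball t \<epsilon>1 \<Longrightarrow> r \<noteq> t \<Longrightarrow> dist r t < \<epsilon>2 \<Longrightarrow> l r \<in> - C"
    unfolding eventually_at by blast
  show thesis
  proof (rule that[of "min \<epsilon>1 \<epsilon>2"])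
    fix r assume "r \<in> I \<inter> ball t (min \<epsilon>1 \<epsilon>2)"
    then show "l r \<notin> C" using \<epsilon>2(2)[of r] assms(4) by (cases "r = t") (auto simp: dist_commute)
  qed (use \<epsilon>1 \<epsilon>2 in simp)
qed

end

section \<open>Geodesics as flow lines and their homogeneity\<close>

context riemannian_manifold
begin

lemma riemannian_connection_scale:
  assumes "c \<in> A" "x \<in> coord c ` dom_of c"
  shows "riemannian_connection A g c x (r *\<^sub>R u) (r *\<^sub>R u) = (r * r) *\<^sub>R riemannian_connection A g c x u u"
  unfolding riemannian_connection_eq[OF assms]
  using bilinear_lmul[OF christoffel_bilinear[OF assms]] bilinear_rmul[OF christoffel_bilinear[OF assms]]
    by simp

text \<open>Vanishing of the covariant derivative of the velocity is the fibre component of the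
  spray equation; the base component is the definition of the velocity.\<close>

lemma geodesic_flow_line:
  assumes ab: "a < b" and geo: "geodesic_on A g {a..b} \<sigma>"
  shows "flow.flow_line {a..b} (velocity A {a..b} \<sigma>)"
proof (rule flow.flow_lineI)
  let ?I = "{a..b}" and ?V = "velocity A {a..b} \<sigma>"
  have \<sigma>: "smooth_curve_on A ?I \<sigma>" using geo by (simp add: geodesic_on_def)
  fix s assume s: "s \<in> ?I"
  obtain c where c: "c \<in> A" "\<sigma> s \<in> dom_of c" using charts_cover by blast
  have dom: "?V r \<in> dom_of (bundle_chart A c)" if "r \<in> ?I" "\<sigma> r \<in> dom_of c" for r
    unfolding bundle_dom using velocity_tangent[OF ab \<sigma> that(1)] that(2) by (simp add: fst_velocity)
  note loc = smooth_curve_local[OF ab \<sigma> s c]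
  have "\<forall>\<^sub>F r in at s within ?I. r \<in> ?I" by (simp add: eventually_at_filter)
  with loc(1) have ev: "\<forall>\<^sub>F r in at s within ?I. ?V r \<in> dom_of (bundle_chart A c)"
    by eventually_elim (rule dom)
  let ?w = "snd (?V s) c"
  have "covariant_derivative A g ?I ?V s c = 0"
    using geo s c unfolding geodesic_on_def by blast
  then have "vector_derivative (\<lambda>r. snd (?V r) c) (at s within ?I)
      = - riemannian_connection A g c (coord c (\<sigma> s)) (vector_derivative (\<lambda>r. coord c (\<sigma> r)) (at s within ?I)) ?w"
    unfolding covariant_derivative_def fst_velocity by (simp only: eq_neg_iff_add_eq_0)
  also have "vector_derivative (\<lambda>r. coord c (\<sigma> r)) (at s within ?I) = ?w"
    by (rule velocity_component[where \<sigma> = \<sigma> and s = s, OF c, symmetric])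
  finally have eq: "vector_derivative (\<lambda>r. snd (?V r) c) (at s within ?I)
      = - riemannian_connection A g c (coord c (\<sigma> s)) ?w ?w" .
  have "((\<lambda>r. (coord c (\<sigma> r), snd (?V r) c)) has_vector_derivative
      (?w, - riemannian_connection A g c (coord c (\<sigma> s)) ?w ?w)) (at s within ?I)"
    using has_derivative_Pair[OF loc(2,3)[unfolded has_vector_derivative_def]] unfolding eq
    by (simp add: has_vector_derivative_def)
  then have "((\<lambda>r. coord (bundle_chart A c) (?V r)) has_vector_derivative spray c (coord (bundle_chart A c) (?V s))) (at s within ?I)"
    unfolding bundle_coord spray_def fst_velocity fst_conv snd_conv .
  then show "\<exists>c\<in>A. ?V s \<in> dom_of (bundle_chart A c) \<and> (\<forall>\<^sub>F r in at s within ?I. ?V r \<in> dom_of (bundle_chart A c)) \<and>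
     ((\<lambda>r. coord (bundle_chart A c) (?V r)) has_vector_derivative spray c (coord (bundle_chart A c) (?V s))) (at s within ?I)"
    using c(1) dom[OF s c(2)] ev by blast
qed

text \<open>Running a geodesic at k times the speed multiplies its velocity by k and its
  acceleration by k^2, in accordance with a spray that is quadratic in the velocity. Negative k and
  k = 0 are included, since geodesics are followed from time 0 in both directions.\<close>

lemma flow_line_scale:
  assumes V: "flow.flow_line I V" and k: "\<And>r. r \<in> J \<Longrightarrow> k * r \<in> I"
  shows "flow.flow_line J (\<lambda>r. scale_vec k (V (k * r)))"
proof (rule flow.flow_lineI)
  fix s assume s: "s \<in> J"
  note sI = k[OF s]
  obtain c where c: "c \<in> A" "V (k * s) \<in> dom_of (bundle_chart A c)" using flow.flow_lineD(1)[OF V sI]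
    by blast
  let ?C = "bundle_chart A c"
  obtain \<epsilon> where \<epsilon>: "0 < \<epsilon>" "\<And>r. r \<in> I \<Longrightarrow> r \<noteq> k * s \<Longrightarrow> dist r (k * s) < \<epsilon> \<Longrightarrow> V r \<in> dom_of ?C"
    using flow.flow_lineD(2)[OF V sI c] unfolding eventually_at by blast
  have ev: "\<forall>\<^sub>F r in at s within J. scale_vec k (V (k * r)) \<in> dom_of ?C"
    unfolding eventually_at
  \<comment> \<open>Adding 1 avoids a division by 0 for k = 0.\<close>
  proof (intro exI[of _ "\<epsilon> / (\<bar>k\<bar> + 1)"] conjI ballI impI)
    show "0 < \<epsilon> / (\<bar>k\<bar> + 1)" using \<epsilon>(1) by (simp add: add_nonneg_pos)
    fix r assume r: "r \<in> J" "r \<noteq> s \<and> dist r s < \<epsilon> / (\<bar>k\<bar> + 1)"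
    have "dist (k * r) (k * s) = \<bar>k\<bar> * dist r s"
      by (simp add: dist_real_def abs_mult[symmetric] right_diff_distrib)
    also have "\<dots> \<le> (\<bar>k\<bar> + 1) * dist r s" by (intro mult_right_mono) auto
    also have "\<dots> < \<epsilon>" using r by (simp add: field_simps add_nonneg_pos)
    finally have "dist (k * r) (k * s) < \<epsilon>" .
    then have "V (k * r) \<in> dom_of ?C" using \<epsilon>(2)[OF k[OF r(1)]] c(2) by metis
    then show "scale_vec k (V (k * r)) \<in> dom_of ?C" by (rule scale_vec_dom)
  qed
  define x where "x = coord c (fst (V (k * s)))"
  define u where "u = snd (V (k * s)) c"
  have x: "x \<in> coord c ` dom_of c" using bundle_domD[OF c(2)] by (simp add: x_def)
  have "((\<lambda>r. k * r) has_vector_derivative k) (at s within J)" by (auto intro!: derivative_eq_intros)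
  moreover have "((\<lambda>r. coord ?C (V r)) has_vector_derivative spray c (x, u)) (at (k * s) within (\<lambda>r. k * r) ` J)"
  proof (rule has_vector_derivative_within_subset)
    show "((\<lambda>r. coord ?C (V r)) has_vector_derivative spray c (x, u)) (at (k * s) within I)"
      using flow.flow_lineD(3)[OF V sI c] unfolding x_def u_def bundle_coord .
  qed (use k in blast)
  ultimately have "((\<lambda>r. coord ?C (V (k * r))) has_vector_derivative k *\<^sub>R spray c (x, u)) (at s within J)"
    using vector_diff_chain_within by (force simp: o_def)
  then have 1: "((\<lambda>r. coord ?C (V (k * r))) has_derivative (\<lambda>h. h *\<^sub>R (k *\<^sub>R spray c (x, u)))) (at s within J)"
    by (simp add: has_vector_derivative_def)
  have "((\<lambda>r. (fst (coord ?C (V (k * r))), k *\<^sub>R snd (coord ?C (V (k * r))))) has_derivative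
      (\<lambda>h. (fst (h *\<^sub>R (k *\<^sub>R spray c (x, u))), k *\<^sub>R snd (h *\<^sub>R (k *\<^sub>R spray c (x, u)))))) (at s within J)"
    by (intro has_derivative_Pair has_derivative_scaleR_right has_derivative_fst has_derivative_snd 1)
  \<comment> \<open>The position receives the inner factor k only, the velocity the outer one as
    well; the resulting k^2 is absorbed because the connection term is quadratic.\<close>
  moreover have "(fst (h *\<^sub>R (k *\<^sub>R spray c (x, u))), k *\<^sub>R snd (h *\<^sub>R (k *\<^sub>R spray c (x, u)))) = h *\<^sub>R spray c (x, k *\<^sub>R u)" for h
    by (simp add: spray_def riemannian_connection_scale[OF c(1) x])
  ultimately have "((\<lambda>r. coord ?C (scale_vec k (V (k * r)))) has_vector_derivative
      spray c (coord ?C (scale_vec k (V (k * s))))) (at s within J)"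
    unfolding scale_vec_coord has_vector_derivative_def by (simp add: bundle_coord x_def u_def)
  then show "\<exists>c\<in>A. scale_vec k (V (k * s)) \<in> dom_of (bundle_chart A c) \<and>
     (\<forall>\<^sub>F r in at s within J. scale_vec k (V (k * r)) \<in> dom_of (bundle_chart A c)) \<and>
     ((\<lambda>r. coord (bundle_chart A c) (scale_vec k (V (k * r)))) has_vector_derivative
       spray c (coord (bundle_chart A c) (scale_vec k (V (k * s))))) (at s within J)"
    using c(1) scale_vec_dom[OF c(2)] ev by blast
qed

lemma flow_dom_scale:
  assumes "v \<in> flow.flow_dom" "k \<in> {0..1}" shows "scale_vec k v \<in> flow.flow_dom"
proof -
  obtain V where V: "flow.flow_line {0..1} V" "V 0 = v" using assms(1) unfolding flow.flow_dom_def
    by blast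
  have "flow.flow_line {0..1} (\<lambda>r. scale_vec k (V (k * r)))"
    by (rule flow_line_scale[OF V(1)]) (use assms(2) in \<open>auto intro: mult_le_one\<close>)
  then show ?thesis unfolding flow.flow_dom_def using V(2) by force
qed

text \<open>The spray vanishes at zero vectors, by homogeneity with factor 0, so the constant curve
  is a flow line.\<close>

lemma flow_dom_zero:
  assumes "v \<in> tangent_bundle A" shows "scale_vec 0 v \<in> flow.flow_dom"
proof -
  obtain c where c: "c \<in> A" "v \<in> dom_of (bundle_chart A c)" using bundle_chart_exists[OF assms] by blast
  have x: "coord c (fst v) \<in> coord c ` dom_of c" using bundle_domD[OF c(2)] by simp
  have "spray c (coord (bundle_chart A c) (scale_vec 0 v)) = 0"
    using riemannian_connection_scale[OF c(1) x, of 0 0] unfolding scale_vec_coord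
      by (simp add: spray_def zero_prod_def)
  then have "((\<lambda>r. coord (bundle_chart A c) (scale_vec 0 v)) has_vector_derivative
      spray c (coord (bundle_chart A c) (scale_vec 0 v))) (at s within {0..1})" for s :: real
    by simp
  then have "flow.flow_line {0..1} (\<lambda>r. scale_vec 0 v)"
    using c(1) scale_vec_dom[OF c(2), of 0] by (intro flow.flow_lineI bexI[of _ c]) simp_all
  then show ?thesis unfolding flow.flow_dom_def by blast
qed

text \<open>For r in [0,1] the geodesic at time s r, with velocity multiplied by s, is the flow line
  that starts at s X(t). As 0 and s lie in [a,b], so does s r, also for negative s.\<close>

lemma path_space_geodesic_flow:
  assumes ab: "a < b" "0 \<in> {a..b}" "s \<in> {a..b}" and \<Gamma>: "path_space_geodesic A g a b \<gamma> X \<Gamma>" and t: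
    "t \<in> {0..1}"
  shows "scale_vec s (X t) \<in> flow.flow_dom" "fst (flow.flow_end (scale_vec s (X t))) = \<Gamma> s t"
proof -
  let ?V = "velocity A {a..b} (\<lambda>s. \<Gamma> s t)"
  have geo: "geodesic_on A g {a..b} (\<lambda>s. \<Gamma> s t)" and init: "?V 0 = X t"
    using \<Gamma> t unfolding path_space_geodesic_def by blast+
  have "s * r \<in> {a..b}" if "r \<in> {0..1}" for r
  proof -
    have r: "0 \<le> r" "r \<le> 1" using that by auto
    have "min 0 s \<le> s * r" "s * r \<le> max 0 s"
      using mult_left_le[OF r(2)] mult_left_le[OF r(2), of
        "- s"] r mult_nonneg_nonneg[of s r] mult_nonpos_nonneg[of s r]
      by (auto simp: min_def max_def)
    then show ?thesis using ab by auto
  qed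
  from flow_line_scale[OF geodesic_flow_line[OF ab(1) geo] this]
  have W: "flow.flow_line {0..1} (\<lambda>r. scale_vec s (?V (s * r)))" .
  then show "scale_vec s (X t) \<in> flow.flow_dom" unfolding flow.flow_dom_def using init by force
  show "fst (flow.flow_end (scale_vec s (X t))) = \<Gamma> s t"
    using flow.flow_end_eq[OF W] init by (simp add: scale_vec_def fst_velocity)
qed

text \<open>Rescaling \<open>v\<close> by \<open>\<kappa> v * s\<close> brings every tangent vector into the domain of the time-one flow;
  where \<open>\<kappa> v = 1\<close>, homogeneity of geodesics identifies the result with the geodesic at time \<open>s\<close>.\<close>

definition admissible :: "real \<Rightarrow> ('m \<times> ('m, 'e) tvec \<Rightarrow> real) \<Rightarrow> bool" where
  "admissible s \<kappa> \<longleftrightarrow> (\<forall>v. 0 \<le> \<kappa> v \<and> \<kappa> v \<le> 1) \<and>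
     (\<forall>v\<in>tangent_bundle A. \<kappa> v \<noteq> 0 \<longrightarrow> scale_vec s v \<in> flow.flow_dom) \<and>
     (\<forall>l. smooth_curve_on (tangent_atlas A) {0..1} l \<longrightarrow>
        (\<forall>t\<in>{0..1}. \<exists>\<epsilon>>0. smooth_on ({0..1} \<inter> ball t \<epsilon>) (\<lambda>r. \<kappa> (l r))))"

lemma thick_unit: "thick {0..1::real}"
  by (rule thick_convex_real[of _ 0 1]) auto

text \<open>A bump in one bundle chart around v0, extended by 0. On its support, scaling by s stays
  so close to \<open>scale_vec s v0\<close> that it remains in the open domain of the flow. For
  curves outside the chart, smoothness of the extension uses that compact subsets of M are
  closed.\<close>

lemma admissible_bump:
  assumes c: "c \<in> A" "v0 \<in> dom_of (bundle_chart A c)" and dom: "scale_vec s v0 \<in> flow.flow_dom"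
  obtains \<kappa> r where "admissible s \<kappa>" "0 < r"
    "\<And>v. v \<in> dom_of (bundle_chart A c) \<Longrightarrow>
       dist (coord (bundle_chart A c) v) (coord (bundle_chart A c) v0) < r \<Longrightarrow> \<kappa> v = 1"
proof -
  let ?C = "bundle_chart A c" and ?x0 = "coord c (fst v0)"
  obtain \<delta> where \<delta>: "0 < \<delta>"
    "\<And>q. q \<in> dom_of ?C \<Longrightarrow> dist (coord ?C q) (coord ?C (scale_vec s v0)) < \<delta> \<Longrightarrow> q \<in> flow.flow_dom"
    using flow.flow_dom_open[OF dom c(1) scale_vec_dom[OF c(2)]] by metis
  have "?x0 \<in> coord c ` dom_of c" using bundle_domD[OF c(2)] by simp
  then obtain \<rho> where \<rho>: "0 < \<rho>" "cball ?x0 \<rho> \<subseteq> coord c ` dom_of c"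
    using chart_image_open[OF c(1)] open_contains_cball_eq by blast
  \<comment> \<open>The bound by \<rho> keeps the base part of the support, of radius 2r, inside the
    chart image; the other one accounts for the factor 1 + |s| by which scaling may enlarge
    distances.\<close>
  define r where "r = min (\<rho> / 2) (\<delta> / (2 * (1 + \<bar>s\<bar>)))"
  have s1: "0 < 1 + \<bar>s\<bar>" by simp
  have r: "0 < r" "2 * r \<le> \<rho>" "(1 + \<bar>s\<bar>) * (2 * r) \<le> \<delta>"
  proof -
    show "0 < r" "2 * r \<le> \<rho>" using \<rho>(1) \<delta>(1) s1 by (auto simp: r_def)
    have "(1 + \<bar>s\<bar>) * (2 * r) \<le> (1 + \<bar>s\<bar>) * (2 * (\<delta> / (2 * (1 + \<bar>s\<bar>))))"
      using s1 by (intro mult_left_mono) (auto simp: r_def)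
    also have "\<dots> = \<delta>" using s1 by (simp add: field_simps)
    finally show "(1 + \<bar>s\<bar>) * (2 * r) \<le> \<delta>" .
  qed
  define \<kappa> where "\<kappa> v = (if fst v \<in> dom_of c then bump (coord ?C v0) r (coord ?C v) else 0)" for v
  have supp: "fst v \<in> dom_of c \<and> dist (coord ?C v) (coord ?C v0) < 2 * r" if "\<kappa> v \<noteq> 0" for v
  proof -
    have v: "fst v \<in> dom_of c" using that by (meson \<kappa>_def)
    then have "bump (coord ?C v0) r (coord ?C v) \<noteq> 0" using that by (simp add: \<kappa>_def)
    then have "\<not> 2 * r \<le> dist (coord ?C v) (coord ?C v0)" using bump_eq_0[OF r(1)] by blast
    then show ?thesis using v by simp
  qed
  have "admissible s \<kappa>"
    unfolding admissible_def
  proof (intro conjI allI ballI impI)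
    show "0 \<le> \<kappa> v" "\<kappa> v \<le> 1" for v
      using bump_range[OF r(1), of "coord ?C v0" "coord ?C v"] by (simp_all add: \<kappa>_def)
  next
    fix v assume v: "v \<in> tangent_bundle A" "\<kappa> v \<noteq> 0"
    have vC: "v \<in> dom_of ?C" using bundle_domI[OF v(1)] supp[OF v(2)] by blast
    have "dist (coord ?C (scale_vec s v)) (coord ?C (scale_vec s v0)) \<le> (1 + \<bar>s\<bar>) * dist (coord ?C v) (coord ?C v0)"
      by (rule scale_vec_coord_dist)
    also have "\<dots> < (1 + \<bar>s\<bar>) * (2 * r)" using supp[OF v(2)] s1 by (intro mult_strict_left_mono) auto
    finally show "scale_vec s v \<in> flow.flow_dom"
      using r(3) by (intro \<delta>(2) scale_vec_dom[OF vC]) linarith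
  next
    fix l :: "real \<Rightarrow> 'm \<times> ('m, 'e) tvec" and t :: real
    assume l: "smooth_curve_on (tangent_atlas A) {0..1} l" and t: "t \<in> {0..1}"
    show "\<exists>\<epsilon>>0. smooth_on ({0..1} \<inter> ball t \<epsilon>) (\<lambda>r. \<kappa> (l r))"
    proof (cases "fst (l t) \<in> dom_of c")
      case True
      have lt: "l t \<in> dom_of ?C" by (rule bundle_domI[OF curve_in_bundle[OF l t] True])
      have CA: "?C \<in> tangent_atlas A" using c(1) by (simp add: tangent_atlas_def)
      obtain \<epsilon> where \<epsilon>: "0 < \<epsilon>" "l ` ({0..1} \<inter> ball t \<epsilon>) \<subseteq> dom_of ?C"
        "smooth_on ({0..1} \<inter> ball t \<epsilon>) (\<lambda>r. coord ?C (l r))"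
        using smooth_curve_onD[OF l t CA lt] .
      have "smooth_on ({0..1} \<inter> ball t \<epsilon>) (\<lambda>q. bump (coord ?C v0) r (coord ?C (l q)))"
        by (rule smooth_on_compose[OF thick_Int_open[OF thick_unit open_ball] _ \<epsilon>(3) smooth_on_bump[OF r(1)]]) simp
      then have "smooth_on ({0..1} \<inter> ball t \<epsilon>) (\<lambda>r. \<kappa> (l r))"
      proof (rule smooth_on_cong[THEN iffD1, rotated])
        fix q assume "q \<in> {0..1} \<inter> ball t \<epsilon>"
        then have "l q \<in> dom_of ?C" using \<epsilon>(2) by blast
        then show "bump (coord ?C v0) r (coord ?C (l q)) = \<kappa> (l q)" using bundle_domD
          by (simp add: \<kappa>_def)
      qed
      then show ?thesis using \<epsilon>(1) by blast
    next
      case False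
      \<comment> \<open>A compact subset of the chart domain that contains the base points of the
        support. A base point outside the chart is off this closed set, and so are those at nearby
        parameters.\<close>
      let ?K = "chart_inv c ` cball ?x0 (2 * r)"
      have sub: "cball ?x0 (2 * r) \<subseteq> coord c ` dom_of c" using \<rho>(2) r(2) subset_cball by blast
      have "continuous_on (cball ?x0 (2 * r)) (chart_inv c)"
        using chart_homeomorphism[OF c(1)] sub
          by (auto simp: homeomorphism_def intro: continuous_on_subset)
      then have "closed ?K" by (intro compact_imp_closed compact_continuous_image compact_cball)
      moreover have "?K \<subseteq> dom_of c" using sub inv_into_into[of _ "coord c" "dom_of c"] by blast
      ultimately obtain \<epsilon> where \<epsilon>: "0 < \<epsilon>" "\<And>q. q \<in> {0..1} \<inter> ball t \<epsilon> \<Longrightarrow> fst (l q) \<notin> ?K"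
        using curve_avoids_compact[OF curve_base[OF l thick_unit] t, of ?K] False by blast
      have zero: "\<kappa> (l q) = 0" if q: "q \<in> {0..1} \<inter> ball t \<epsilon>" for q
      proof (rule ccontr)
        assume "\<kappa> (l q) \<noteq> 0"
        from supp[OF this] have *: "fst (l q) \<in> dom_of c" "dist (coord ?C (l q)) (coord ?C v0) < 2 * r"
          by blast+
        have "dist (coord c (fst (l q))) ?x0 \<le> dist (coord ?C (l q)) (coord ?C v0)"
          using dist_fst_le[of "coord ?C (l q)" "coord ?C v0"] by (simp add: bundle_coord)
        then have "coord c (fst (l q)) \<in> cball ?x0 (2 * r)" using *(2) by (simp add: dist_commute)
        then have "chart_inv c (coord c (fst (l q))) \<in> ?K" by (rule imageI)
        then show False using \<epsilon>(2)[OF q] inv_coord[OF c(1) *(1)] by simp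
      qed
      have "smooth_on ({0..1} \<inter> ball t \<epsilon>) (\<lambda>q. 0 :: real)"
        by (rule smooth_on_const[OF thick_Int_open[OF thick_unit open_ball]])
      then have "smooth_on ({0..1} \<inter> ball t \<epsilon>) (\<lambda>r. \<kappa> (l r))"
        by (rule smooth_on_cong[THEN iffD1, rotated]) (simp add: zero)
      then show ?thesis using \<epsilon>(1) by blast
    qed
  qed
  moreover have "\<kappa> v = 1" if "v \<in> dom_of ?C" "dist (coord ?C v) (coord ?C v0) < r" for v
    using bump_eq_1[OF r(1), of "coord ?C v" "coord ?C v0"] that bundle_domD[OF that(1)]
      by (simp add: \<kappa>_def)
  ultimately show thesis using that r(1) by blast
qed

text \<open>A smooth substitute for the maximum: equal to 1 where either function is 1, and nonzero
  only where one of them is nonzero.\<close>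

lemma admissible_join:
  assumes \<kappa>: "admissible s \<kappa>1" "admissible s \<kappa>2"
  shows "admissible s (\<lambda>v. 1 - (1 - \<kappa>1 v) * (1 - \<kappa>2 v))"
  unfolding admissible_def
proof (intro conjI allI ballI impI)
  have range: "0 \<le> \<kappa>1 v" "\<kappa>1 v \<le> 1" "0 \<le> \<kappa>2 v" "\<kappa>2 v \<le> 1" for v
    using \<kappa> unfolding admissible_def by blast+
  show "0 \<le> 1 - (1 - \<kappa>1 v) * (1 - \<kappa>2 v)" for v
    using mult_le_one[of "1 - \<kappa>1 v" "1 - \<kappa>2 v"] range[of v] by simp
  show "1 - (1 - \<kappa>1 v) * (1 - \<kappa>2 v) \<le> 1" for v
    using range[of v] by simp
next
  fix v assume v: "v \<in> tangent_bundle A" "1 - (1 - \<kappa>1 v) * (1 - \<kappa>2 v) \<noteq> 0"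
  then have "\<kappa>1 v \<noteq> 0 \<or> \<kappa>2 v \<noteq> 0" by auto
  then show "scale_vec s v \<in> flow.flow_dom" using \<kappa> v(1) unfolding admissible_def by blast
next
  fix l :: "real \<Rightarrow> 'm \<times> ('m, 'e) tvec" and t :: real
  assume l: "smooth_curve_on (tangent_atlas A) {0..1} l" and t: "t \<in> {0..1}"
  obtain \<epsilon>1 where \<epsilon>1: "0 < \<epsilon>1" "smooth_on ({0..1} \<inter> ball t \<epsilon>1) (\<lambda>r. \<kappa>1 (l r))"
    using \<kappa>(1) l t unfolding admissible_def by blast
  obtain \<epsilon>2 where \<epsilon>2: "0 < \<epsilon>2" "smooth_on ({0..1} \<inter> ball t \<epsilon>2) (\<lambda>r. \<kappa>2 (l r))"
    using \<kappa>(2) l t unfolding admissible_def by blast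
  let ?J = "{0..1} \<inter> ball t (min \<epsilon>1 \<epsilon>2)"
  have J: "thick ?J" by (rule thick_Int_open[OF thick_unit open_ball])
  have sub: "?J \<subseteq> {0..1} \<inter> ball t \<epsilon>1" "?J \<subseteq> {0..1} \<inter> ball t \<epsilon>2" by auto
  have "smooth_on ?J (\<lambda>r. 1 - (1 - \<kappa>1 (l r)) * (1 - \<kappa>2 (l r)))"
    by (intro smooth_on_diff smooth_on_mult smooth_on_const J smooth_on_subset[OF \<epsilon>1(2) J sub(1)]
        smooth_on_subset[OF \<epsilon>2(2) J sub(2)])
  then show "\<exists>\<epsilon>>0. smooth_on ({0..1} \<inter> ball t \<epsilon>) (\<lambda>r. 1 - (1 - \<kappa>1 (l r)) * (1 - \<kappa>2 (l r)))"
    using \<epsilon>1(1) \<epsilon>2(1) by (intro exI[of _ "min \<epsilon>1 \<epsilon>2"]) simp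
qed

text \<open>Compactness of [0,1] in the form of real induction: near every parameter some bump
  equals 1 on the curve, and \<open>admissible_join\<close> merges it with what has been reached
  before.\<close>

lemma admissible_along_curve:
  assumes X: "smooth_curve_on (tangent_atlas A) {0..1} X"
    and dom: "\<And>t. t \<in> {0..1} \<Longrightarrow> scale_vec s (X t) \<in> flow.flow_dom"
  obtains \<kappa> where "admissible s \<kappa>" "\<And>t. t \<in> {0..1} \<Longrightarrow> \<kappa> (X t) = 1"
proof -
  have near: "\<exists>\<kappa> \<epsilon>. admissible s \<kappa> \<and> 0 < \<epsilon> \<and> (\<forall>r\<in>{0..1} \<inter> ball t \<epsilon>. \<kappa> (X r) = 1)" if t: "t \<in> {0..1}"
    for t
  proof -
    obtain c where c: "c \<in> A" "X t \<in> dom_of (bundle_chart A c)"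
      using bundle_chart_exists[OF curve_in_bundle[OF X t]] by blast
    let ?C = "bundle_chart A c"
    obtain \<kappa> r where \<kappa>: "admissible s \<kappa>" "0 < r"
      "\<And>v. v \<in> dom_of ?C \<Longrightarrow> dist (coord ?C v) (coord ?C (X t)) < r \<Longrightarrow> \<kappa> v = 1"
      using admissible_bump[OF c dom[OF t]] by metis
    have CA: "?C \<in> tangent_atlas A" using c(1) by (simp add: tangent_atlas_def)
    obtain \<epsilon> where \<epsilon>: "0 < \<epsilon>" "X ` ({0..1} \<inter> ball t \<epsilon>) \<subseteq> dom_of ?C"
      "smooth_on ({0..1} \<inter> ball t \<epsilon>) (\<lambda>r. coord ?C (X r))"
      using smooth_curve_onD[OF X t CA c(2)] .
    have "t \<in> {0..1} \<inter> ball t \<epsilon>" using t \<epsilon>(1) by simp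
    then obtain \<epsilon>2 where \<epsilon>2: "0 < \<epsilon>2"
      "\<And>q. q \<in> {0..1} \<inter> ball t \<epsilon> \<Longrightarrow> dist q t < \<epsilon>2 \<Longrightarrow> dist (coord ?C (X q)) (coord ?C (X t)) < r"
      using smooth_on_continuous[OF \<epsilon>(3)] \<kappa>(2) unfolding continuous_on_iff by blast
    have "\<kappa> (X q) = 1" if q: "q \<in> {0..1} \<inter> ball t (min \<epsilon> \<epsilon>2)" for q
    proof (rule \<kappa>(3))
      have q': "q \<in> {0..1} \<inter> ball t \<epsilon>" "dist q t < \<epsilon>2" using q by (auto simp: dist_commute)
      show "X q \<in> dom_of ?C" using \<epsilon>(2) q'(1) by blast
      show "dist (coord ?C (X q)) (coord ?C (X t)) < r" by (rule \<epsilon>2(2)[OF q'])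
    qed
    then show ?thesis using \<kappa>(1) \<epsilon>(1) \<epsilon>2(1) by (intro exI[of _ \<kappa>] exI[of _ "min \<epsilon> \<epsilon>2"]) simp
  qed
  define P where "P \<tau> \<longleftrightarrow> (\<exists>\<kappa>. admissible s \<kappa> \<and> (\<forall>t\<in>{0..\<tau>}. \<kappa> (X t) = 1))" for \<tau>
  \<comment> \<open>Joining keeps the value 1 on the part up to q and adds the part from q to
    r.\<close>
  have extend: "P r" if Pq: "P q" and \<kappa>: "admissible s \<kappa>" "\<forall>t\<in>{q..r}. \<kappa> (X t) = 1" for q r \<kappa>
  proof -
    obtain \<kappa>1 where \<kappa>1: "admissible s \<kappa>1" "\<forall>t\<in>{0..q}. \<kappa>1 (X t) = 1" using Pq unfolding P_def by blast
    have "1 - (1 - \<kappa>1 (X t)) * (1 - \<kappa> (X t)) = 1" if "t \<in> {0..r}" for t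
      using \<kappa>1(2) \<kappa>(2) that by (cases "t \<le> q") auto
    then show ?thesis unfolding P_def using admissible_join[OF \<kappa>1(1) \<kappa>(1)] by blast
  qed
  have "P 1"
  proof (rule real_induction[where P = P and \<alpha> = 0 and \<beta> = 1])
    obtain \<kappa> \<epsilon> where "admissible s \<kappa>" "0 < \<epsilon>" "\<forall>r\<in>{0..1} \<inter> ball 0 \<epsilon>. \<kappa> (X r) = 1" using near[of 0]
      by auto
    then show "P 0" unfolding P_def by auto
  next
    fix q :: real assume q: "0 \<le> q" "q < 1" "P q"
    then obtain \<kappa> \<epsilon> where \<kappa>: "admissible s \<kappa>" "0 < \<epsilon>" "\<forall>r\<in>{0..1} \<inter> ball q \<epsilon>. \<kappa> (X r) = 1"
      using near[of q] by auto
    show "\<exists>\<epsilon>>0. \<forall>r. q < r \<and> r < q + \<epsilon> \<and> r \<le> 1 \<longrightarrow> P r"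
    proof (intro exI[of _ \<epsilon>] conjI allI impI \<kappa>(2))
      fix r assume r: "q < r \<and> r < q + \<epsilon> \<and> r \<le> 1"
      show "P r" by (rule extend[OF q(3) \<kappa>(1)]) (use \<kappa>(3) q r in \<open>auto simp: dist_real_def\<close>)
    qed
  next
    fix r :: real assume r: "0 < r" "r \<le> 1" and below: "\<And>q. 0 \<le> q \<Longrightarrow> q < r \<Longrightarrow> P q"
    then obtain \<kappa> \<epsilon> where \<kappa>: "admissible s \<kappa>" "0 < \<epsilon>" "\<forall>q\<in>{0..1} \<inter> ball r \<epsilon>. \<kappa> (X q) = 1"
      using near[of r] by auto
    define q where "q = max 0 (r - \<epsilon> / 2)"
    have q: "0 \<le> q" "q < r" "r - q < \<epsilon>" using r \<kappa>(2) by (auto simp: q_def)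
    show "P r" by (rule extend[OF below[OF q(1,2)] \<kappa>(1)]) (use \<kappa>(3) q r in \<open>auto simp: dist_real_def\<close>)
  qed auto
  then show thesis using that unfolding P_def by blast
qed

definition flow_map :: "real \<Rightarrow> ('m \<times> ('m, 'e) tvec \<Rightarrow> real) \<Rightarrow> 'm \<times> ('m, 'e) tvec \<Rightarrow> 'm" where
  "flow_map s \<kappa> v = fst (flow.flow_end (scale_vec (\<kappa> v * s) v))"

text \<open>No tangent vector is excluded: where \<kappa> vanishes the rescaled vector is zero, and
  elsewhere it is a multiple, by a factor in [0,1], of a vector in the star-shaped domain. So the
  flow can be applied along arbitrary smooth paths in TM.\<close>

lemma flow_map_path:
  assumes \<kappa>: "admissible s \<kappa>" and l: "l \<in> path_space (tangent_atlas A)"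
  shows "flow_map s \<kappa> \<circ> l \<in> path_space A"
proof -
  have l': "smooth_curve_on (tangent_atlas A) {0..1} l" using l by (simp add: path_space_def)
  have "\<exists>\<epsilon>>0. smooth_on ({0..1} \<inter> ball t \<epsilon>) (\<lambda>r. \<kappa> (l r) * s)" if t: "t \<in> {0..1}" for t
  proof -
    obtain \<epsilon> where \<epsilon>: "0 < \<epsilon>" "smooth_on ({0..1} \<inter> ball t \<epsilon>) (\<lambda>r. \<kappa> (l r))"
      using \<kappa> l' t unfolding admissible_def by blast
    have "thick ({0..1} \<inter> ball t \<epsilon>)" by (rule thick_Int_open[OF thick_unit open_ball])
    then have "smooth_on ({0..1} \<inter> ball t \<epsilon>) (\<lambda>r. \<kappa> (l r) * s)"
      by (intro smooth_on_mult smooth_on_const \<epsilon>(2))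
    then show ?thesis using \<epsilon>(1) by blast
  qed
  from curve_scale[OF l' thick_unit this]
  have m: "smooth_curve_on (bundle_chart A ` A) {0..1} (\<lambda>t. scale_vec (\<kappa> (l t) * s) (l t))"
    unfolding tangent_atlas_def .
  have "scale_vec (\<kappa> v * s) v \<in> flow.flow_dom" if v: "v \<in> tangent_bundle A" for v
  proof (cases "\<kappa> v = 0")
    case True
    then show ?thesis using flow_dom_zero[OF v] by simp
  next
    case False
    have "scale_vec s v \<in> flow.flow_dom" "0 \<le> \<kappa> v \<and> \<kappa> v \<le> 1"
      using \<kappa> v False unfolding admissible_def by blast+
    then have "scale_vec s v \<in> flow.flow_dom" "\<kappa> v \<in> {0..1}" by simp_all
    from flow_dom_scale[OF this] show ?thesis by (simp add: scale_vec_scale_vec)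
  qed
  then have "(\<lambda>t. scale_vec (\<kappa> (l t) * s) (l t)) ` {0..1} \<subseteq> flow.flow_dom"
    using curve_in_bundle[OF l'] by blast
  from flow.flow_end_smooth[OF convex_real_interval(5) thick_unit m this]
  have "smooth_curve_on (tangent_atlas A) {0..1} (\<lambda>t. flow.flow_end (scale_vec (\<kappa> (l t) * s) (l t)))"
    unfolding tangent_atlas_def .
  from curve_base[OF this thick_unit] show ?thesis
    by (simp add: path_space_def flow_map_def o_def)
qed

end

section \<open>Back-track equivalence\<close>

lemma reparametrization_of_compose: "reparametrization_of p q \<Longrightarrow> reparametrization_of (f \<circ> p) (f \<circ> q)"
  unfolding reparametrization_of_def by fastforce

text \<open>Composition with f commutes with joining and reversing paths, so the three pieces are
  replaced by their images and the reparametrizations stay the same.\<close>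

lemma backtrack_erasure_compose:
  assumes f: "\<And>l. l \<in> path_space B \<Longrightarrow> f \<circ> l \<in> path_space A" and "backtrack_erasure B p q"
  shows "backtrack_erasure A (f \<circ> p) (f \<circ> q)"
proof -
  obtain l1 l2 l3 where l: "l1 \<in> path_space B" "l2 \<in> path_space B" "l3 \<in> path_space B"
    "pathfinish l3 = pathstart l2" "pathfinish l3 = pathstart l1"
    "reparametrization_of p (l3 +++ (l2 +++ (reversepath l2 +++ l1)))"
      "reparametrization_of q (l3 +++ l1)"
    using assms(2) unfolding backtrack_erasure_def by blast
  show ?thesis
    unfolding backtrack_erasure_def
  proof (intro bexI conjI)
    show "pathfinish (f \<circ> l3) = pathstart (f \<circ> l2)" "pathfinish (f \<circ> l3) = pathstart (f \<circ> l1)"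
      using l(4,5) by (simp_all add: pathfinish_compose pathstart_compose)
    show "reparametrization_of (f \<circ> p) ((f \<circ> l3) +++ ((f \<circ> l2) +++ (reversepath (f \<circ> l2) +++ (f \<circ> l1))))"
      using reparametrization_of_compose[OF l(6), of f]
        by (simp add: path_compose_join path_compose_reversepath)
    show "reparametrization_of (f \<circ> q) ((f \<circ> l3) +++ (f \<circ> l1))"
      using reparametrization_of_compose[OF l(7), of f] by (simp add: path_compose_join)
  qed (use f l in blast)+
qed

lemma bt_equivalent_compose:
  assumes f: "\<And>l. l \<in> path_space B \<Longrightarrow> f \<circ> l \<in> path_space A" and "bt_equivalent B p q"
  shows "bt_equivalent A (f \<circ> p) (f \<circ> q)"
  using assms(2) unfolding bt_equivalent_def
proof (induction rule: rtranclp_induct)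
  case (step y z)
  have "reparametrization_of (f \<circ> y) (f \<circ> z) \<or> elementary_bt_equivalent A (f \<circ> y) (f \<circ> z)"
    using step.hyps(2) reparametrization_of_compose backtrack_erasure_compose[OF f]
    unfolding elementary_bt_equivalent_def by blast
  then show ?case by (intro rtranclp.rtrancl_into_rtrancl[OF step.IH])
qed simp

lemma reparametrization_of_eq: "(\<And>t. t \<in> {0..1} \<Longrightarrow> p t = q t) \<Longrightarrow> reparametrization_of p q"
  unfolding reparametrization_of_def by (intro exI[of _ "\<lambda>t. t"]) (auto simp: strict_mono_on_def)

theorem proposition4p2:
  fixes A :: "('m::{t2_space, second_countable_topology}, 'e::euclidean_space) chart set"
    and g :: "'m \<Rightarrow> ('m, 'e) tvec \<Rightarrow> ('m, 'e) tvec \<Rightarrow> real"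
    and \<gamma>1 \<gamma>2 :: "real \<Rightarrow> 'm"
    and X1 X2 :: "real \<Rightarrow> 'm \<times> ('m, 'e) tvec"
    and \<Gamma>1 \<Gamma>2 :: "real \<Rightarrow> real \<Rightarrow> 'm"
    and a b s :: real
  assumes "riemannian_manifold A g"
    and "\<gamma>1 \<in> path_space_c A" and "\<gamma>2 \<in> path_space_c A"
    and "bt_equivalent A \<gamma>1 \<gamma>2"
    and "X1 \<in> tangent_path_space_c A \<gamma>1" and "X2 \<in> tangent_path_space_c A \<gamma>2"
    and "bt_equivalent (tangent_atlas A) X1 X2"
    and "a < b" and "0 \<in> {a..b}"
    and "path_space_geodesic A g a b \<gamma>1 X1 \<Gamma>1"
    and "path_space_geodesic A g a b \<gamma>2 X2 \<Gamma>2"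
    and "s \<in> {a..b}"
  shows "bt_equivalent A (\<Gamma>1 s) (\<Gamma>2 s)"
proof -
  interpret riemannian_manifold A g by (rule assms(1))
  note flow1 = path_space_geodesic_flow[OF assms(8,9,12,10)]
    and flow2 = path_space_geodesic_flow[OF assms(8,9,12,11)]
  have X: "smooth_curve_on (tangent_atlas A) {0..1} X1" "smooth_curve_on (tangent_atlas A) {0..1} X2"
    using assms(5,6) by (simp_all add: tangent_path_space_c_def path_space_c_def path_space_def)
  obtain \<kappa>1 where \<kappa>1: "admissible s \<kappa>1" "\<And>t. t \<in> {0..1} \<Longrightarrow> \<kappa>1 (X1 t) = 1"
    using admissible_along_curve[OF X(1) flow1(1)] by blast
  obtain \<kappa>2 where \<kappa>2: "admissible s \<kappa>2" "\<And>t. t \<in> {0..1} \<Longrightarrow> \<kappa>2 (X2 t) = 1"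
    using admissible_along_curve[OF X(2) flow2(1)] by blast
  \<comment> \<open>Equal to 1 on both curves, so that one map transports the whole chain and sends
    its two ends to the longitudinal paths.\<close>
  define \<kappa> where "\<kappa> v = 1 - (1 - \<kappa>1 v) * (1 - \<kappa>2 v)" for v
  have \<kappa>: "admissible s \<kappa>" unfolding \<kappa>_def[abs_def] by (rule admissible_join[OF \<kappa>1(1) \<kappa>2(1)])
  have "bt_equivalent A (flow_map s \<kappa> \<circ> X1) (flow_map s \<kappa> \<circ> X2)"
    by (rule bt_equivalent_compose[OF flow_map_path[OF \<kappa>] assms(7)])
  \<comment> \<open>The two paths are known to agree on [0,1] only; the identity reparametrization
    bridges the gap to equality of functions on the real line.\<close>
  moreover have "reparametrization_of (\<Gamma>1 s) (flow_map s \<kappa> \<circ> X1)"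
    by (rule reparametrization_of_eq) (simp add: flow_map_def \<kappa>_def \<kappa>1(2) flow1(2))
  moreover have "reparametrization_of (flow_map s \<kappa> \<circ> X2) (\<Gamma>2 s)"
    by (rule reparametrization_of_eq) (simp add: flow_map_def \<kappa>_def \<kappa>2(2) flow2(2))
  ultimately show ?thesis
    unfolding bt_equivalent_def
    by (metis (mono_tags, lifting) converse_rtranclp_into_rtranclp rtranclp.rtrancl_into_rtrancl)
qed

end
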